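(* Let $d\ge 1$ and let $\mathcal{X}_1,\ldots,\mathcal{X}_d$ be free symmetric collections of finite sets with $\mathcal{X}_k(\underline{0})=\mathcal{X}_k(\underline{1})=\varnothing$ for all $1\le k\le d$. Then \[ \mathcal{C}^{(d)}_{\mathcal{X}_\bullet}\cong \mathcal{T}(\mathcal{X}_1)\otimes\cdots\otimes\mathcal{T}(\mathcal{X}_d) \] as operads, where $\mathcal{C}^{(d)}_{\mathcal{X}_\bullet}$ is the $d$-dimensional cut operad and $\otimes$ is the Boardman--Vogt tensor product.
   Context: A symmetric collection of finite sets is a contravariant functor from the category of nonempty finite sets and bijections to finite sets; $\underline{n}=\{1,\ldots,n\}$; the collection is free if for each $n$ the action of $S_n$ on its value at $\underline{n}$ is free. $\mathcal{T}(\mathcal{X})$ is the free symmetric operad generated by $\mathcal{X}$; $\gamma$ denotes operadic composition. The Boardman--Vogt tensor product $\mathcal{P}\otimes\mathcal{Q}$ of symmetric set operads is the quotient of the coproduct $\mathcal{P}\sqcup\mathcal{Q}$ by the ideal generated by all interchange relations $\gamma(p;q,\ldots,q)=\gamma(q;p,\ldots,p).\sigma_{k,l}$ with $p\in\mathcal{P}(\underline{k})$, $q\in\mathcal{Q}(\underline{l})$, where $\sigma_{k,l}\in S_{kl}$ is the permutation exchanging rows and columns, $\sigma_{k,l}((i-1)l+j)=(j-1)k+i$ for $1\le i\le k$, $1\le j\le l$. Cut operad. An $\mathcal{X}_\bullet$-subdivision of arity $n$ of a $d$-dimensional rectangle $R=[a_1,b_1]\times\cdots\times[a_d,b_d]\subset\mathbb{R}^d$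 is defined recursively. The trivial subdivision, consisting just of $R$ without any extra data, is the only one of arity $1$. Otherwise, choose an integer $1\le k\le d$, an integer $m\ge2$, a partition $n=n_1+\cdots+n_m$, and an element $w\in\mathcal{X}_k(\underline{m})$; consider the $m-1$ hyperplane cuts $R\cap\{x_k=((m-l)a_k+l b_k)/m\}$, $1\le l\le m-1$, orthogonal to the $k$-th direction, that divide $R$ into $m$ equal parts; label the points of each of these cuts by $w$; and impose arbitrary $\mathcal{X}_\bullet$-subdivisions of arities $n_1,\ldots,n_m$ on the $m$ parts. All $\mathcal{X}_\bullet$-subdivisions of arity $n$ are obtained in this way. The $d$-dimensional cut operad $\mathcal{C}^{(d)}_{\mathcal{X}_\bullet}$ has, as its arity $n$ component, the $\mathcal{X}_\bullet$-subdivisions of arity $n$ of the unit cube $[0,1]^d$ where the interiors of the rectangles into which the cube is subdivided are labelled by the integers $1,\ldots,n$ in all possible ways. The composition $\gamma(c;c_1,\ldots,c_m)$ shrinks each $c_i$ in the directions of the coordinate axes so that the ambient unit cube fits exactly into the $i$-th rectangle of $c$, and glues the result in place of that rectangle, copying the labels of cuts and adjusting the labels of rectangles in the usual way.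
   Formalization: Cuts into m parts in direction k are labelled by S_m-orbits of X_k(m) (free generators) instead of elements w of X_k(m), since with all rectangle numberings the latter counts S_m twice (d=1, X_1(2) one free orbit: 4 versus 2 elements); labels for different (k,m) are taken disjoint. *)

theory Defs
  imports Complex_Main "HOL-Library.FuncSet" "HOL-Combinatorics.Permutations"
begin

section \<open>Symmetric collections\<close>

text \<open>A contravariant functor on the groupoid of nonempty finite sets; the finite subsets of
  \<open>nat\<close> form an equivalent small subcategory.  \<open>Mor X I J f\<close> is the map
  \<open>X(J) \<rightarrow> X(I)\<close> induced by a bijection \<open>f : I \<rightarrow> J\<close>, of which only the values
  on \<open>I\<close> matter.  \<open>Ob X {}\<close> is not constrained by functoriality.\<close>

record 'x symcoll =
  Ob :: "nat set \<Rightarrow> 'x set"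
  Mor :: "nat set \<Rightarrow> nat set \<Rightarrow> (nat \<Rightarrow> nat) \<Rightarrow> 'x \<Rightarrow> 'x"

definition fin_obj :: "nat set \<Rightarrow> bool" where
  "fin_obj I \<longleftrightarrow> finite I \<and> I \<noteq> {}"

definition symmetric_collection :: "'x symcoll \<Rightarrow> bool" where
  "symmetric_collection X \<longleftrightarrow>
     (\<forall>I. fin_obj I \<longrightarrow> finite (Ob X I)) \<and>
     (\<forall>I J f. fin_obj I \<and> fin_obj J \<and> bij_betw f I J \<longrightarrow> Mor X I J f \<in> Ob X J \<rightarrow> Ob X I) \<and>
     (\<forall>I J f g. fin_obj I \<and> fin_obj J \<and> bij_betw f I J \<and> (\<forall>i\<in>I. f i = g i) \<longrightarrow>
        (\<forall>w\<in>Ob X J. Mor X I J f w = Mor X I J g w)) \<and>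
     (\<forall>I. fin_obj I \<longrightarrow> (\<forall>w\<in>Ob X I. Mor X I I id w = w)) \<and>
     (\<forall>I J K f g. fin_obj I \<and> fin_obj J \<and> fin_obj K \<and> bij_betw f I J \<and> bij_betw g J K \<longrightarrow>
        (\<forall>w\<in>Ob X K. Mor X I K (g \<circ> f) w = Mor X I J f (Mor X J K g w)))"

abbreviation val :: "'x symcoll \<Rightarrow> nat \<Rightarrow> 'x set" where
  "val X n \<equiv> Ob X {1..n}"

abbreviation sact :: "'x symcoll \<Rightarrow> nat \<Rightarrow> 'x \<Rightarrow> (nat \<Rightarrow> nat) \<Rightarrow> 'x" where
  "sact X n w \<sigma> \<equiv> Mor X {1..n} {1..n} \<sigma> w"

definition free_collection :: "'x symcoll \<Rightarrow> bool" where
  "free_collection X \<longleftrightarrow>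
     (\<forall>n\<ge>1. \<forall>\<sigma>. \<forall>w\<in>val X n. \<sigma> permutes {1..n} \<and> sact X n w \<sigma> = w \<longrightarrow> \<sigma> = id)"

definition orbits :: "'x symcoll \<Rightarrow> nat \<Rightarrow> 'x set set" where
  "orbits X n = {{sact X n w \<sigma> |\<sigma>. \<sigma> permutes {1..n}} |w. w \<in> val X n}"


section \<open>Symmetric set operads\<close>

text \<open>An operad is given by its components at \<open>{1..n}\<close>, stored as the disjoint union
  \<open>ops\<close> graded by \<open>arity\<close>.  The symmetric groups act on the right;
  \<open>compose p [q\<^sub>1,\<dots>,q\<^sub>k]\<close> is \<open>\<gamma>(p;q\<^sub>1,\<dots>,q\<^sub>k)\<close>.\<close>

record 'a operad =
  ops :: "'a set"
  arity :: "'a \<Rightarrow> nat"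
  ident :: "'a"
  act :: "'a \<Rightarrow> (nat \<Rightarrow> nat) \<Rightarrow> 'a"
  compose :: "'a \<Rightarrow> 'a list \<Rightarrow> 'a"

definition composable :: "'a operad \<Rightarrow> 'a \<Rightarrow> 'a list \<Rightarrow> bool" where
  "composable P p qs \<longleftrightarrow> p \<in> ops P \<and> set qs \<subseteq> ops P \<and> length qs = arity P p"

definition total_arity :: "'a operad \<Rightarrow> 'a list \<Rightarrow> nat" where
  "total_arity P qs = (\<Sum>q\<leftarrow>qs. arity P q)"

text \<open>\<open>offset P qs i\<close> is the number of inputs preceding those of the \<open>i\<close>-th entry of
  \<open>qs\<close>, entries being counted from 1.\<close>

definition offset :: "'a operad \<Rightarrow> 'a list \<Rightarrow> nat \<Rightarrow> nat" where
  "offset P qs i = total_arity P (take (i - 1) qs)"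

text \<open>In the two equivariance axioms, \<open>\<beta>\<close> is the block permutation induced by
  \<open>\<sigma>\<close>, respectively the direct sum of the \<open>\<tau> i\<close>; it is determined by the values
  listed.  Permutations act so that the input named \<open>j\<close> of \<open>p\<close> is the input
  named \<open>\<sigma>\<^sup>-\<^sup>1(j)\<close> of \<open>p.\<sigma>\<close>.\<close>

definition is_operad :: "'a operad \<Rightarrow> bool" where
  "is_operad P \<longleftrightarrow>
     (\<forall>p\<in>ops P. arity P p \<ge> 1) \<and>
     ident P \<in> ops P \<and> arity P (ident P) = 1 \<and>
     (\<forall>p\<in>ops P. \<forall>\<sigma>. \<sigma> permutes {1..arity P p} \<longrightarrow>
        act P p \<sigma> \<in> ops P \<and> arity P (act P p \<sigma>) = arity P p) \<and>
     (\<forall>p\<in>ops P. act P p id = p) \<and>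
     (\<forall>p\<in>ops P. \<forall>\<sigma> \<tau>. \<sigma> permutes {1..arity P p} \<and> \<tau> permutes {1..arity P p} \<longrightarrow>
        act P p (\<sigma> \<circ> \<tau>) = act P (act P p \<sigma>) \<tau>) \<and>
     (\<forall>p qs. composable P p qs \<longrightarrow>
        compose P p qs \<in> ops P \<and> arity P (compose P p qs) = total_arity P qs) \<and>
     (\<forall>p\<in>ops P. compose P (ident P) [p] = p) \<and>
     (\<forall>p\<in>ops P. compose P p (replicate (arity P p) (ident P)) = p) \<and>
     (\<forall>p qs rss. composable P p qs \<and> list_all2 (composable P) qs rss \<longrightarrow>
        compose P (compose P p qs) (concat rss) = compose P p (map2 (compose P) qs rss)) \<and>
     (\<forall>p qs qs' \<sigma> \<beta>. composable P p qs \<and> \<sigma> permutes {1..arity P p} \<and>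
        qs' = map (\<lambda>i. qs ! (inv \<sigma> i - 1)) [1..<arity P p + 1] \<and>
        \<beta> permutes {1..total_arity P qs} \<and>
        (\<forall>i\<in>{1..arity P p}. \<forall>j\<in>{1..arity P (qs ! (i - 1))}.
           \<beta> (offset P qs i + j) = offset P qs' (\<sigma> i) + j) \<longrightarrow>
        compose P (act P p \<sigma>) qs = act P (compose P p qs') \<beta>) \<and>
     (\<forall>p qs \<tau> \<beta>. composable P p qs \<and>
        (\<forall>i\<in>{1..arity P p}. \<tau> i permutes {1..arity P (qs ! (i - 1))}) \<and>
        \<beta> permutes {1..total_arity P qs} \<and>
        (\<forall>i\<in>{1..arity P p}. \<forall>j\<in>{1..arity P (qs ! (i - 1))}.
           \<beta> (offset P qs i + j) = offset P qs i + \<tau> i j) \<longrightarrow>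
        compose P p (map (\<lambda>i. act P (qs ! (i - 1)) (\<tau> i)) [1..<arity P p + 1])
          = act P (compose P p qs) \<beta>)"

definition operad_iso :: "('a \<Rightarrow> 'b) \<Rightarrow> 'a operad \<Rightarrow> 'b operad \<Rightarrow> bool" where
  "operad_iso f P Q \<longleftrightarrow>
     bij_betw f (ops P) (ops Q) \<and>
     (\<forall>p\<in>ops P. arity Q (f p) = arity P p) \<and>
     f (ident P) = ident Q \<and>
     (\<forall>p\<in>ops P. \<forall>\<sigma>. \<sigma> permutes {1..arity P p} \<longrightarrow> f (act P p \<sigma>) = act Q (f p) \<sigma>) \<and>
     (\<forall>p qs. composable P p qs \<longrightarrow> f (compose P p qs) = compose Q (f p) (map f qs))"

definition operad_isomorphic :: "'a operad \<Rightarrow> 'b operad \<Rightarrow> bool"  (infix "\<cong>\<^sub>o\<^sub>p" 50) where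
  "P \<cong>\<^sub>o\<^sub>p Q \<longleftrightarrow> is_operad P \<and> is_operad Q \<and> (\<exists>f. operad_iso f P Q)"


subsection \<open>Quotients\<close>

text \<open>The ideal generated by \<open>R\<close> is the least operadic congruence containing \<open>R\<close>.\<close>

inductive ideal :: "'a operad \<Rightarrow> ('a \<times> 'a) set \<Rightarrow> 'a \<Rightarrow> 'a \<Rightarrow> bool"
  for P :: "'a operad" and R :: "('a \<times> 'a) set" where
  ideal_base: "(p, q) \<in> R \<Longrightarrow> p \<in> ops P \<Longrightarrow> q \<in> ops P \<Longrightarrow> arity P p = arity P q \<Longrightarrow> ideal P R p q"
| ideal_refl: "p \<in> ops P \<Longrightarrow> ideal P R p p"
| ideal_sym: "ideal P R p q \<Longrightarrow> ideal P R q p"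
| ideal_trans: "ideal P R p q \<Longrightarrow> ideal P R q r \<Longrightarrow> ideal P R p r"
| ideal_act: "ideal P R p q \<Longrightarrow> \<sigma> permutes {1..arity P p} \<Longrightarrow> ideal P R (act P p \<sigma>) (act P q \<sigma>)"
| ideal_compose: "ideal P R p q \<Longrightarrow> length ps = arity P p \<Longrightarrow> list_all2 (ideal P R) ps qs \<Longrightarrow>
    ideal P R (compose P p ps) (compose P q qs)"

text \<open>Congruence classes are represented by a chosen element, so that a quotient has the same
  type as the operad itself and constructions can be iterated.\<close>

definition rep :: "'a operad \<Rightarrow> ('a \<times> 'a) set \<Rightarrow> 'a \<Rightarrow> 'a" where
  "rep P R p = (SOME q. ideal P R p q)"

definition quotient_operad :: "'a operad \<Rightarrow> ('a \<times> 'a) set \<Rightarrow> 'a operad" where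
  "quotient_operad P R =
     \<lparr>ops = rep P R ` ops P, arity = arity P, ident = rep P R (ident P),
      act = (\<lambda>p \<sigma>. rep P R (act P p \<sigma>)), compose = (\<lambda>p qs. rep P R (compose P p qs))\<rparr>"


subsection \<open>Planar trees with named leaves\<close>

text \<open>Vertices carry a generator or an element of the left or right factor of a coproduct.
  Those elements are trees themselves: this makes the type closed under coproducts.\<close>

datatype ('x, 't) sym = Gen 'x | FromL 't | FromR 't

datatype 'x tree = Leaf nat | Node "('x, 'x tree) sym" "'x tree list"

fun leaves :: "'x tree \<Rightarrow> nat list" where
  "leaves (Leaf i) = [i]"
| "leaves (Node s ts) = concat (map leaves ts)"

fun graft :: "(nat \<Rightarrow> 'x tree) \<Rightarrow> 'x tree \<Rightarrow> 'x tree" where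
  "graft f (Leaf i) = f i"
| "graft f (Node s ts) = Node s (map (graft f) ts)"

fun over_sig :: "(('x, 'x tree) sym \<times> nat) set \<Rightarrow> 'x tree \<Rightarrow> bool" where
  "over_sig S (Leaf i) \<longleftrightarrow> True"
| "over_sig S (Node s ts) \<longleftrightarrow> (s, length ts) \<in> S \<and> (\<forall>t\<in>set ts. over_sig S t)"

definition relabel :: "(nat \<Rightarrow> nat) \<Rightarrow> 'x tree \<Rightarrow> 'x tree" where
  "relabel h = graft (\<lambda>i. Leaf (h i))"

text \<open>The free symmetric operad on a set \<open>S\<close> of generators with prescribed arities and no
  relation between a generator and its permuted versions.\<close>

definition tree_operad :: "(('x, 'x tree) sym \<times> nat) set \<Rightarrow> 'x tree operad" where
  "tree_operad S =
     \<lparr>ops = {t. over_sig S t \<and> distinct (leaves t) \<and> set (leaves t) = {1..length (leaves t)}},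
      arity = (\<lambda>t. length (leaves t)),
      ident = Leaf 1,
      act = (\<lambda>t \<sigma>. relabel (inv \<sigma>) t),
      compose = (\<lambda>t qs. graft (\<lambda>i. relabel
        (\<lambda>j. (\<Sum>q\<leftarrow>take (i - 1) qs. length (leaves q)) + j) (qs ! (i - 1))) t)\<rparr>"

definition corolla :: "('x, 'x tree) sym \<Rightarrow> nat \<Rightarrow> 'x tree" where
  "corolla s m = Node s (map Leaf [1..<m + 1])"


subsection \<open>Free operads, coproducts and Boardman--Vogt tensor products\<close>

definition gen_sig :: "'x symcoll \<Rightarrow> (('x, 'x tree) sym \<times> nat) set" where
  "gen_sig X = {(Gen w, m) |w m. m \<ge> 1 \<and> w \<in> val X m}"

definition gen_rels :: "'x symcoll \<Rightarrow> ('x tree \<times> 'x tree) set" where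
  "gen_rels X =
     {(corolla (Gen (sact X m w \<sigma>)) m, act (tree_operad (gen_sig X)) (corolla (Gen w) m) \<sigma>)
       |w m \<sigma>. m \<ge> 1 \<and> w \<in> val X m \<and> \<sigma> permutes {1..m}}"

definition free_operad :: "'x symcoll \<Rightarrow> 'x tree operad" where
  "free_operad X = quotient_operad (tree_operad (gen_sig X)) (gen_rels X)"

text \<open>Relations making \<open>p \<mapsto> corolla (\<iota> p) (arity P p)\<close> a morphism of operads from
  \<open>P\<close> to a quotient of \<open>T\<close>.\<close>

definition embed_rels ::
  "'x tree operad \<Rightarrow> ('a \<Rightarrow> ('x, 'x tree) sym) \<Rightarrow> 'a operad \<Rightarrow> ('x tree \<times> 'x tree) set" where
  "embed_rels T \<iota> P = (let e = (\<lambda>p. corolla (\<iota> p) (arity P p)) in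
     {(e (ident P), ident T)} \<union>
     {(e (act P p \<sigma>), act T (e p) \<sigma>) |p \<sigma>. p \<in> ops P \<and> \<sigma> permutes {1..arity P p}} \<union>
     {(e (compose P p qs), compose T (e p) (map e qs)) |p qs. composable P p qs})"

definition coprod_sig :: "'x tree operad \<Rightarrow> 'x tree operad \<Rightarrow> (('x, 'x tree) sym \<times> nat) set" where
  "coprod_sig P Q =
     {(FromL p, arity P p) |p. p \<in> ops P} \<union> {(FromR q, arity Q q) |q. q \<in> ops Q}"

definition coprod_rels :: "'x tree operad \<Rightarrow> 'x tree operad \<Rightarrow> ('x tree \<times> 'x tree) set" where
  "coprod_rels P Q =
     embed_rels (tree_operad (coprod_sig P Q)) FromL P \<union>
     embed_rels (tree_operad (coprod_sig P Q)) FromR Q"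

definition coproduct :: "'x tree operad \<Rightarrow> 'x tree operad \<Rightarrow> 'x tree operad" where
  "coproduct P Q = quotient_operad (tree_operad (coprod_sig P Q)) (coprod_rels P Q)"

definition inj_left :: "'x tree operad \<Rightarrow> 'x tree operad \<Rightarrow> 'x tree \<Rightarrow> 'x tree" where
  "inj_left P Q p =
     rep (tree_operad (coprod_sig P Q)) (coprod_rels P Q) (corolla (FromL p) (arity P p))"

definition inj_right :: "'x tree operad \<Rightarrow> 'x tree operad \<Rightarrow> 'x tree \<Rightarrow> 'x tree" where
  "inj_right P Q q =
     rep (tree_operad (coprod_sig P Q)) (coprod_rels P Q) (corolla (FromR q) (arity Q q))"

text \<open>\<open>(i-1)l+j \<mapsto> (j-1)k+i\<close> for \<open>1 \<le> i \<le> k\<close>, \<open>1 \<le> j \<le> l\<close>.\<close>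

definition exchange_perm :: "nat \<Rightarrow> nat \<Rightarrow> nat \<Rightarrow> nat" where
  "exchange_perm k l x =
     (if x \<in> {1..k * l} then ((x - 1) mod l) * k + ((x - 1) div l + 1) else x)"

definition interchange_rels :: "'x tree operad \<Rightarrow> 'x tree operad \<Rightarrow> ('x tree \<times> 'x tree) set" where
  "interchange_rels P Q = (let U = coproduct P Q in
     {(compose U (inj_left P Q p) (replicate k (inj_right P Q q)),
       act U (compose U (inj_right P Q q) (replicate l (inj_left P Q p))) (exchange_perm k l))
       |p q k l. p \<in> ops P \<and> q \<in> ops Q \<and> arity P p = k \<and> arity Q q = l})"

definition bv_tensor :: "'x tree operad \<Rightarrow> 'x tree operad \<Rightarrow> 'x tree operad"
    (infixl "\<otimes>\<^sub>B\<^sub>V" 70) where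
  "P \<otimes>\<^sub>B\<^sub>V Q = quotient_operad (coproduct P Q) (interchange_rels P Q)"


section \<open>The cut operad\<close>

text \<open>Points of \<open>\<real>\<^sup>d\<close> are functions that are \<open>undefined\<close> outside \<open>{1..d}\<close>; a
  rectangle is the pair of its extreme corners.\<close>

type_synonym point = "nat \<Rightarrow> real"
type_synonym box = "point \<times> point"

definition box_pts :: "nat \<Rightarrow> box \<Rightarrow> point set" where
  "box_pts d R = (\<Pi>\<^sub>E i\<in>{1..d}. {fst R i..snd R i})"

definition unit_box :: "nat \<Rightarrow> box" where
  "unit_box d = (restrict (\<lambda>_. 0) {1..d}, restrict (\<lambda>_. 1) {1..d})"

definition cut_pos :: "box \<Rightarrow> nat \<Rightarrow> nat \<Rightarrow> nat \<Rightarrow> real" where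
  "cut_pos R k m l = ((real m - real l) * fst R k + real l * snd R k) / real m"

definition box_part :: "box \<Rightarrow> nat \<Rightarrow> nat \<Rightarrow> nat \<Rightarrow> box" where
  "box_part R k m l = ((fst R)(k := cut_pos R k m (l - 1)), (snd R)(k := cut_pos R k m l))"

text \<open>\<open>subdivision d L R n B C\<close>: the rectangles \<open>B\<close> and the labelled points \<open>C\<close> form
  a subdivision of \<open>R\<close> of arity \<open>n\<close>, where \<open>L k m\<close> is the set of labels for a cut
  into \<open>m\<close> parts orthogonal to direction \<open>k\<close>.  The sets \<open>L k m\<close> are made disjoint by
  recording \<open>k\<close> and \<open>m\<close> with each label.  A point lying on several cuts has several labels.
  Two recursive constructions with the same \<open>B\<close> and \<open>C\<close> give the same subdivision.\<close>

inductive subdivision :: "nat \<Rightarrow> (nat \<Rightarrow> nat \<Rightarrow> 'l set) \<Rightarrow> box \<Rightarrow> nat \<Rightarrow> box set \<Rightarrow>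
    (point \<times> nat \<times> nat \<times> 'l) set \<Rightarrow> bool"
  for d :: nat and L :: "nat \<Rightarrow> nat \<Rightarrow> 'l set" where
  trivial: "subdivision d L R 1 {R} {}"
| cut: "k \<in> {1..d} \<Longrightarrow> m \<ge> 2 \<Longrightarrow> w \<in> L k m \<Longrightarrow>
    (\<forall>l\<in>{1..m}. subdivision d L (box_part R k m l) (n l) (B l) (C l)) \<Longrightarrow>
    subdivision d L R (\<Sum>l=1..m. n l) (\<Union>l\<in>{1..m}. B l)
      ((\<Union>l\<in>{1..m - 1}. {x \<in> box_pts d R. x k = cut_pos R k m l} \<times> {(k, m, w)})
        \<union> (\<Union>l\<in>{1..m}. C l))"

definition rescale :: "nat \<Rightarrow> box \<Rightarrow> point \<Rightarrow> point" where
  "rescale d R x = restrict (\<lambda>i. fst R i + (snd R i - fst R i) * x i) {1..d}"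

text \<open>An element \<open>(rs, C)\<close> consists of the rectangles, listed in the order of their
  numbers \<open>1, \<dots>, n\<close>, and the labelled points of the cuts.\<close>

definition cut_operad :: "nat \<Rightarrow> (nat \<Rightarrow> nat \<Rightarrow> 'l set) \<Rightarrow>
    (box list \<times> (point \<times> nat \<times> nat \<times> 'l) set) operad" where
  "cut_operad d L =
     \<lparr>ops = {(rs, C). distinct rs \<and> subdivision d L (unit_box d) (length rs) (set rs) C},
      arity = (\<lambda>(rs, C). length rs),
      ident = ([unit_box d], {}),
      act = (\<lambda>(rs, C) \<sigma>. (map (\<lambda>i. rs ! (\<sigma> i - 1)) [1..<length rs + 1], C)),
      compose = (\<lambda>(rs, C) cs.
        (concat (map2 (\<lambda>R (rs', C'). map (map_prod (rescale d R) (rescale d R)) rs') rs cs),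
         C \<union> (\<Union>(R, (rs', C')) \<in> set (zip rs cs). map_prod (rescale d R) id ` C')))\<rparr>"

text \<open>For the comparison with operads generated by free collections \<open>X\<^sub>k\<close> the labels of the
  cuts are \<open>L k m = orbits (X k) m\<close>, the free generators of \<open>X\<^sub>k\<close> in arity \<open>m\<close>.  Since the
  rectangles are numbered in all possible ways, labelling by all elements of \<open>X\<^sub>k({1..m})\<close> would
  count the action of the symmetric group twice: for \<open>d = 1\<close> and \<open>X\<^sub>1\<close> consisting of a single free orbit
  in arity 2, it would give four elements in arity 2, whereas the free operad on \<open>X\<^sub>1\<close> has
  two.\<close>

end

theory Submission
  imports Defs
begin

text \<open>A cut in direction \<open>k\<close> into \<open>m\<close> parts carrying a label \<open>w\<close> is a symbol \<open>(k, m, w)\<close>, and a tree over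
  these symbols is both a recipe for a subdivision of the cube and a composite of generators of the
  tensor product; since the collections are free, choosing a base point in every orbit turns the
  orbits into free generators. So the free operad on the symbols maps onto both operads, and it
  suffices that the two maps have the same kernel.

  Subdivisions using disjoint sets of directions interchange geometrically, so the universal
  properties of free operads, coproducts and tensor products yield a map from the iterated tensor
  product to the cut operad. Hence trees that agree in the tensor product define the same
  subdivision. The same surjection from the free operad shows that the cut operad is an operad.

  Conversely, let two trees define the same subdivision. A line in direction \<open>k\<close> with irrational
  coordinates meets the cuts in a one-dimensional subdivision, which determines its tree because the
  label of the innermost cut at the left end tells how to enlarge the leftmost interval step by step.
  If the first tree starts with a cut in direction \<open>k\<close>, then so do the traces of the second tree on
  all these lines, and exchanging consecutive cuts in different directions pulls this cut to the root
  of the second tree. By induction the trees differ by such exchanges, which hold in the tensor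
  product.\<close>

section \<open>Blocks of a concatenated list\<close>

text \<open>No normal form for the operations of a tensor product is at hand, so no map out of the
  cut operad is defined directly: the isomorphism is the inverse of a map into it. All that is used
  of the tensor product is that its generators generate it, that generators of different directions
  interchange, and that it maps to the cut operad.

  Two difficulties shape the rest. Subtrees of an operation carry arbitrary leaf names and are no
  operations themselves; so recursions run over trees with arbitrary names, and renaming is kept
  apart from shape. And a subdivision is only a set of rectangles with a set of labelled points; a
  cut is not given as an object. Its position does not tell its level: cuts at 1/4, 1/2, 3/4 come
  from one cut into four parts as well as from repeated halving. The number of parts recorded in the
  label decides this. Nor do labelled points on a common face of two parts tell to which part they
  belong. Lines with irrational coordinates avoid every cut in another direction and so pass through
  well-defined parts.\<close>

lemma nth_concat_block:
  assumes "i < length xss" "j < length (xss ! i)"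
  shows "concat xss ! (sum_list (map length (take i xss)) + j) = xss ! i ! j"
  using assms
proof (induction xss arbitrary: i)
  case (Cons xs xss)
  then show ?case by (cases i) (auto simp: nth_append)
qed simp

lemma sum_list_block_bound:
  fixes ns :: "nat list"
  assumes "i < length ns" "j < ns ! i"
  shows "sum_list (take i ns) + j < sum_list ns"
  using assms
proof (induction ns arbitrary: i)
  case (Cons n ns)
  then show ?case by (cases i) auto
qed simp

lemma sum_list_block_exists:
  fixes ns :: "nat list"
  assumes "x < sum_list ns"
  obtains i j where "i < length ns" "j < ns ! i" "x = sum_list (take i ns) + j"
proof -
  have "\<exists>i j. i < length ns \<and> j < ns ! i \<and> x = sum_list (take i ns) + j"
    using assms
  proof (induction ns arbitrary: x)
    case (Cons n ns)
    show ?case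
    proof (cases "x < n")
      case True
      then show ?thesis by (intro exI[of _ 0] exI[of _ x]) simp
    next
      case False
      with Cons.prems have "x - n < sum_list ns" by simp
      from Cons.IH[OF this] obtain i j where "i < length ns" "j < ns ! i"
        "x - n = sum_list (take i ns) + j" by blast
      with False show ?thesis by (intro exI[of _ "Suc i"] exI[of _ j]) auto
    qed
  qed simp
  then show ?thesis using that by blast
qed

lemma take_concat_block:
  assumes "i < length xss" "j \<le> length (xss ! i)"
  shows "take (sum_list (map length (take i xss)) + j) (concat xss)
    = concat (take i xss) @ take j (xss ! i)"
  using assms
proof (induction xss arbitrary: i)
  case (Cons xs xss)
  then show ?case by (cases i) auto
qed simp

text \<open>The inputs of a composite are named block by block. The shifted blocks exhaust an
  initial interval without repetition, so a composite of operations has admissible leaf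
  names.\<close>

lemma concat_blocks_upt:
  fixes ns :: "nat list"
  shows "concat (map (\<lambda>i. map (\<lambda>j. sum_list (take i ns) + j) [1..<ns ! i + 1]) [0..<length ns])
    = [1..<sum_list ns + 1]"
proof (induction ns rule: rev_induct)
  case (snoc n ns)
  have shift: "map ((+) k) [Suc 0..<Suc l] = [Suc k..<Suc (k + l)]" for k l :: nat
    by (rule nth_equalityI) (auto simp del: upt_Suc)
  have "concat (map (\<lambda>i. map (\<lambda>j. sum_list (take i (ns @ [n])) + j) [1..<(ns @ [n]) ! i + 1])
      [0..<length ns])
    = concat (map (\<lambda>i. map (\<lambda>j. sum_list (take i ns) + j) [1..<ns ! i + 1]) [0..<length ns])"
    by (rule arg_cong[where f = concat], rule map_cong) (auto simp: nth_append)
  then have "concat (map (\<lambda>i. map (\<lambda>j. sum_list (take i (ns @ [n])) + j) [1..<(ns @ [n]) ! i + 1])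
      [0..<length ns]) = [1..<sum_list ns + 1]"
    using snoc.IH by simp
  then have "concat (map (\<lambda>i. map (\<lambda>j. sum_list (take i (ns @ [n])) + j) [1..<(ns @ [n]) ! i + 1])
      [0..<length (ns @ [n])])
    = [1..<sum_list ns + 1] @ [sum_list ns + 1..<sum_list ns + n + 1]"
    by (simp add: shift del: upt_Suc) (simp add: upt_Suc)
  also have "\<dots> = [1..<sum_list (ns @ [n]) + 1]"
    using upt_add_eq_append[of 1 "sum_list ns + 1" n] by (simp add: ac_simps del: upt_Suc)
  finally show ?case .
qed simp


section \<open>Homomorphisms of operads\<close>

lemma operad_arity_pos:
  assumes "is_operad P" "p \<in> ops P"
  shows "1 \<le> arity P p"
proof -
  have "\<forall>p\<in>ops P. 1 \<le> arity P p"
    using assms(1) unfolding is_operad_def by (elim conjE)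
  with assms show ?thesis by blast
qed

lemma
  assumes "is_operad P"
  shows operad_ident: "ident P \<in> ops P" and operad_arity_ident: "arity P (ident P) = 1"
proof -
  show "ident P \<in> ops P" using assms unfolding is_operad_def by (elim conjE)
  show "arity P (ident P) = 1" using assms unfolding is_operad_def by (elim conjE)
qed

lemma
  assumes "is_operad P" "p \<in> ops P" "\<sigma> permutes {1..arity P p}"
  shows operad_act: "act P p \<sigma> \<in> ops P"
    and operad_arity_act: "arity P (act P p \<sigma>) = arity P p"
proof -
  have "\<forall>p\<in>ops P. \<forall>\<sigma>. \<sigma> permutes {1..arity P p} \<longrightarrow>
      act P p \<sigma> \<in> ops P \<and> arity P (act P p \<sigma>) = arity P p"
    using assms(1) unfolding is_operad_def by (elim conjE)
  with assms show "act P p \<sigma> \<in> ops P" "arity P (act P p \<sigma>) = arity P p" by blast+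
qed

lemma operad_act_id:
  assumes "is_operad P" "p \<in> ops P"
  shows "act P p id = p"
proof -
  have "\<forall>p\<in>ops P. act P p id = p"
    using assms(1) unfolding is_operad_def by (elim conjE)
  with assms show ?thesis by blast
qed

lemma operad_act_comp:
  assumes "is_operad P" "p \<in> ops P" "\<sigma> permutes {1..arity P p}" "\<tau> permutes {1..arity P p}"
  shows "act P p (\<sigma> \<circ> \<tau>) = act P (act P p \<sigma>) \<tau>"
proof -
  have "\<forall>p\<in>ops P. \<forall>\<sigma> \<tau>. \<sigma> permutes {1..arity P p} \<and> \<tau> permutes {1..arity P p} \<longrightarrow>
      act P p (\<sigma> \<circ> \<tau>) = act P (act P p \<sigma>) \<tau>"
    using assms(1) unfolding is_operad_def by (elim conjE)
  with assms show ?thesis by blast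
qed

lemma
  assumes "is_operad P" "composable P p qs"
  shows operad_compose: "compose P p qs \<in> ops P"
    and operad_arity_compose: "arity P (compose P p qs) = total_arity P qs"
proof -
  have "\<forall>p qs. composable P p qs \<longrightarrow>
      compose P p qs \<in> ops P \<and> arity P (compose P p qs) = total_arity P qs"
    using assms(1) unfolding is_operad_def by (elim conjE)
  with assms show "compose P p qs \<in> ops P" "arity P (compose P p qs) = total_arity P qs" by blast+
qed

lemma operad_ident_left:
  assumes "is_operad P" "p \<in> ops P"
  shows "compose P (ident P) [p] = p"
proof -
  have "\<forall>p\<in>ops P. compose P (ident P) [p] = p"
    using assms(1) unfolding is_operad_def by (elim conjE)
  with assms show ?thesis by blast
qed

lemma operad_ident_right:
  assumes "is_operad P" "p \<in> ops P"
  shows "compose P p (replicate (arity P p) (ident P)) = p"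
proof -
  have "\<forall>p\<in>ops P. compose P p (replicate (arity P p) (ident P)) = p"
    using assms(1) unfolding is_operad_def by (elim conjE)
  with assms show ?thesis by blast
qed

lemma operad_assoc:
  assumes "is_operad P" "composable P p qs" "list_all2 (composable P) qs rss"
  shows "compose P (compose P p qs) (concat rss) = compose P p (map2 (compose P) qs rss)"
proof -
  have "\<forall>p qs rss. composable P p qs \<and> list_all2 (composable P) qs rss \<longrightarrow>
      compose P (compose P p qs) (concat rss) = compose P p (map2 (compose P) qs rss)"
    using assms(1) unfolding is_operad_def by (elim conjE)
  with assms show ?thesis by blast
qed

lemma operad_equivariant_outer:
  assumes "is_operad P" "composable P p qs" "\<sigma> permutes {1..arity P p}"
    "qs' = map (\<lambda>i. qs ! (inv \<sigma> i - 1)) [1..<arity P p + 1]"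
    "\<beta> permutes {1..total_arity P qs}"
    "\<And>i j. i \<in> {1..arity P p} \<Longrightarrow> j \<in> {1..arity P (qs ! (i - 1))} \<Longrightarrow>
       \<beta> (offset P qs i + j) = offset P qs' (\<sigma> i) + j"
  shows "compose P (act P p \<sigma>) qs = act P (compose P p qs') \<beta>"
proof -
  have "\<forall>p qs qs' \<sigma> \<beta>. composable P p qs \<and> \<sigma> permutes {1..arity P p} \<and>
        qs' = map (\<lambda>i. qs ! (inv \<sigma> i - 1)) [1..<arity P p + 1] \<and>
        \<beta> permutes {1..total_arity P qs} \<and>
        (\<forall>i\<in>{1..arity P p}. \<forall>j\<in>{1..arity P (qs ! (i - 1))}.
           \<beta> (offset P qs i + j) = offset P qs' (\<sigma> i) + j) \<longrightarrow>
        compose P (act P p \<sigma>) qs = act P (compose P p qs') \<beta>"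
    using assms(1) unfolding is_operad_def by (elim conjE)
  with assms(2-) show ?thesis by blast
qed

lemma operad_equivariant_inner:
  assumes "is_operad P" "composable P p qs"
    "\<And>i. i \<in> {1..arity P p} \<Longrightarrow> \<tau> i permutes {1..arity P (qs ! (i - 1))}"
    "\<beta> permutes {1..total_arity P qs}"
    "\<And>i j. i \<in> {1..arity P p} \<Longrightarrow> j \<in> {1..arity P (qs ! (i - 1))} \<Longrightarrow>
       \<beta> (offset P qs i + j) = offset P qs i + \<tau> i j"
  shows "compose P p (map (\<lambda>i. act P (qs ! (i - 1)) (\<tau> i)) [1..<arity P p + 1])
    = act P (compose P p qs) \<beta>"
proof -
  have "\<forall>p qs \<tau> \<beta>. composable P p qs \<and>
        (\<forall>i\<in>{1..arity P p}. \<tau> i permutes {1..arity P (qs ! (i - 1))}) \<and>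
        \<beta> permutes {1..total_arity P qs} \<and>
        (\<forall>i\<in>{1..arity P p}. \<forall>j\<in>{1..arity P (qs ! (i - 1))}.
           \<beta> (offset P qs i + j) = offset P qs i + \<tau> i j) \<longrightarrow>
        compose P p (map (\<lambda>i. act P (qs ! (i - 1)) (\<tau> i)) [1..<arity P p + 1])
          = act P (compose P p qs) \<beta>"
    using assms(1) unfolding is_operad_def by (elim conjE)
  with assms(2-) show ?thesis by blast
qed

definition operad_hom :: "('a \<Rightarrow> 'b) \<Rightarrow> 'a operad \<Rightarrow> 'b operad \<Rightarrow> bool" where
  "operad_hom f P Q \<longleftrightarrow>
     (\<forall>p\<in>ops P. f p \<in> ops Q \<and> arity Q (f p) = arity P p) \<and>
     f (ident P) = ident Q \<and>
     (\<forall>p\<in>ops P. \<forall>\<sigma>. \<sigma> permutes {1..arity P p} \<longrightarrow> f (act P p \<sigma>) = act Q (f p) \<sigma>) \<and>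
     (\<forall>p qs. composable P p qs \<longrightarrow> f (compose P p qs) = compose Q (f p) (map f qs))"

lemma hom_ops: "operad_hom f P Q \<Longrightarrow> p \<in> ops P \<Longrightarrow> f p \<in> ops Q"
  and hom_arity: "operad_hom f P Q \<Longrightarrow> p \<in> ops P \<Longrightarrow> arity Q (f p) = arity P p"
  and hom_ident: "operad_hom f P Q \<Longrightarrow> f (ident P) = ident Q"
  and hom_act: "operad_hom f P Q \<Longrightarrow> p \<in> ops P \<Longrightarrow> \<sigma> permutes {1..arity P p} \<Longrightarrow>
      f (act P p \<sigma>) = act Q (f p) \<sigma>"
  and hom_compose: "operad_hom f P Q \<Longrightarrow> composable P p qs \<Longrightarrow>
      f (compose P p qs) = compose Q (f p) (map f qs)"
  unfolding operad_hom_def by blast+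

lemma hom_composable: "operad_hom f P Q \<Longrightarrow> composable P p qs \<Longrightarrow> composable Q (f p) (map f qs)"
  unfolding composable_def using hom_ops[of f P Q] hom_arity[of f P Q] by auto

lemma hom_total_arity:
  "operad_hom f P Q \<Longrightarrow> set qs \<subseteq> ops P \<Longrightarrow> total_arity Q (map f qs) = total_arity P qs"
  unfolding total_arity_def by (induction qs) (auto simp: hom_arity[of f P Q])

lemma hom_offset:
  "operad_hom f P Q \<Longrightarrow> set qs \<subseteq> ops P \<Longrightarrow> offset Q (map f qs) i = offset P qs i"
  unfolding offset_def take_map using hom_total_arity[of f P Q "take (i - 1) qs"]
  by (meson order_trans set_take_subset)

lemma hom_trans:
  assumes "operad_hom f P Q" "operad_hom g Q O'"
  shows "operad_hom (g \<circ> f) P O'"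
proof -
  note f = hom_ops[OF assms(1)] hom_arity[OF assms(1)] hom_ident[OF assms(1)] hom_act[OF assms(1)]
    hom_compose[OF assms(1)] hom_composable[OF assms(1)]
  note g = hom_ops[OF assms(2)] hom_arity[OF assms(2)] hom_ident[OF assms(2)] hom_act[OF assms(2)]
    hom_compose[OF assms(2)]
  show ?thesis
    unfolding operad_hom_def using f g by simp
qed

lemma list_lift:
  assumes "set ys \<subseteq> f ` A"
  obtains xs where "set xs \<subseteq> A" "map f xs = ys"
proof -
  have "\<exists>xs. set xs \<subseteq> A \<and> map f xs = ys"
    using assms
  proof (induction ys)
    case (Cons y ys)
    then obtain xs x where "set xs \<subseteq> A" "map f xs = ys" "x \<in> A" "f x = y" by auto
    then show ?case by (intro exI[of _ "x # xs"]) simp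
  qed simp
  then show ?thesis using that by blast
qed

text \<open>Every axiom is a closure condition or an equation between operations, and its instances
  lift along a surjection \<open>f\<close>; since \<open>f\<close> keeps arities, composable lists
  lift to composable lists. Both quotients and the cut operad obtain their axioms in this
  way.\<close>

lemma hom_image_operad:
  assumes P: "is_operad P" and f: "operad_hom f P Q" and surj: "ops Q = f ` ops P"
  shows "is_operad Q"
proof -
  have lift: "\<exists>p\<in>ops P. f p = p'" if "p' \<in> ops Q" for p'
    using that surj by auto
  have liftc: "\<exists>qs. composable P p qs \<and> map f qs = qs'" if "composable Q (f p) qs'" "p \<in> ops P" for p qs'
  proof -
    have "set qs' \<subseteq> f ` ops P" using that surj by (simp add: composable_def)
    then obtain qs where "set qs \<subseteq> ops P" "map f qs = qs'" by (rule list_lift)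
    then show ?thesis using that hom_arity[OF f that(2)] by (auto simp: composable_def)
  qed
  have liftcs: "\<exists>rss. list_all2 (composable P) qs rss \<and> map (map f) rss = rss'"
    if "list_all2 (composable Q) (map f qs) rss'" "set qs \<subseteq> ops P" for qs rss'
    using that
  proof (induction qs arbitrary: rss')
    case (Cons q qs)
    then obtain rs' rss'' where r: "rss' = rs' # rss''" "composable Q (f q) rs'"
      "list_all2 (composable Q) (map f qs) rss''"
      by (auto simp: list_all2_Cons1)
    obtain rss where "list_all2 (composable P) qs rss" "map (map f) rss = rss''"
      using Cons.IH[OF r(3)] Cons.prems by auto
    moreover obtain rs where "composable P q rs" "map f rs = rs'"
      using liftc[OF r(2)] Cons.prems by auto
    ultimately show ?case using r(1) by (intro exI[of _ "rs # rss"]) simp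
  qed simp
  note fs = hom_ops[OF f] hom_arity[OF f] hom_ident[OF f] hom_act[OF f] hom_compose[OF f]
  show ?thesis
    unfolding is_operad_def
  proof (intro conjI ballI allI impI; (elim conjE)?)
    fix p' assume p': "p' \<in> ops Q"
    then obtain p where p: "p \<in> ops P" "f p = p'" using lift by blast
    show "1 \<le> arity Q p'" using p operad_arity_pos[OF P] fs by auto
    show "act Q p' id = p'"
      using p fs(4)[of p id] operad_act_id[OF P] by (simp add: permutes_id)
    show "compose Q (ident Q) [p'] = p'"
      using p fs(5)[of "ident P" "[p]"] fs(3) operad_ident_left[OF P]
      by (simp add: composable_def operad_ident[OF P] operad_arity_ident[OF P])
    show "compose Q p' (replicate (arity Q p') (ident Q)) = p'"
      using p fs(5)[of p "replicate (arity P p) (ident P)"] fs(2,3) operad_ident_right[OF P]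
      by (auto simp: composable_def operad_ident[OF P] set_replicate_conv_if)
    fix \<sigma> assume s: "\<sigma> permutes {1..arity Q p'}"
    then show "act Q p' \<sigma> \<in> ops Q" "arity Q (act Q p' \<sigma>) = arity Q p'"
      using p fs(4)[of p \<sigma>] fs(2)[of p] fs(1,2)[of "act P p \<sigma>"] operad_act[OF P, of p \<sigma>]
        operad_arity_act[OF P, of p \<sigma>] by auto
    fix \<tau> assume t: "\<tau> permutes {1..arity Q p'}"
    show "act Q p' (\<sigma> \<circ> \<tau>) = act Q (act Q p' \<sigma>) \<tau>"
    proof -
      have ar: "arity P p = arity Q p'" using p fs by auto
      have "f (act P p (\<sigma> \<circ> \<tau>)) = act Q (f p) (\<sigma> \<circ> \<tau>)"
        using fs(4)[of p "\<sigma> \<circ> \<tau>"] p s t ar by (simp add: permutes_compose)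
      moreover have "f (act P (act P p \<sigma>) \<tau>) = act Q (act Q (f p) \<sigma>) \<tau>"
        using fs(4)[of p \<sigma>] fs(4)[of "act P p \<sigma>" \<tau>] p s t ar
        by (simp add: operad_act[OF P] operad_arity_act[OF P])
      ultimately show ?thesis using operad_act_comp[OF P p(1), of \<sigma> \<tau>] s t ar p by simp
    qed
  next
    show "ident Q \<in> ops Q" "arity Q (ident Q) = 1"
      using fs(1,2)[OF operad_ident[OF P]] fs(3) operad_arity_ident[OF P] by auto
  next
    fix p' qs' assume c: "composable Q p' qs'"
    obtain p where p: "p \<in> ops P" "f p = p'" using lift c unfolding composable_def by blast
    then obtain qs where qs: "composable P p qs" "map f qs = qs'" using liftc c by blast
    have sub: "set qs \<subseteq> ops P" using qs by (simp add: composable_def)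
    show "compose Q p' qs' \<in> ops Q" "arity Q (compose Q p' qs') = total_arity Q qs'"
      using fs(5)[OF qs(1)] fs(1,2)[OF operad_compose[OF P qs(1)]] operad_arity_compose[OF P qs(1)]
        hom_total_arity[OF f sub] p qs by auto
    fix rss' assume "list_all2 (composable Q) qs' rss'"
    then obtain rss where rss: "list_all2 (composable P) qs rss" "map (map f) rss = rss'"
      using liftcs[of qs rss'] qs sub by auto
    have m: "map f (map2 (compose P) qs rss) = map2 (compose Q) (map f qs) (map (map f) rss)"
      using rss(1) by (induction rule: list_all2_induct) (auto simp: fs(5))
    have l: "length rss = length qs" using rss(1) by (simp add: list_all2_lengthD)
    have "set (map2 (compose P) qs rss) \<subseteq> ops P"
      using rss(1) by (induction rule: list_all2_induct) (auto simp: operad_compose[OF P])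
    then have c1: "composable P p (map2 (compose P) qs rss)"
      using qs(1) l by (simp add: composable_def)
    have len: "length (concat rss) = total_arity P qs"
      using rss(1) unfolding total_arity_def
      by (induction rule: list_all2_induct) (auto simp: composable_def)
    have sub2: "set (concat rss) \<subseteq> ops P"
      using rss(1) by (induction rule: list_all2_induct) (auto simp: composable_def)
    have c2: "composable P (compose P p qs) (concat rss)"
      using len sub2 operad_compose[OF P qs(1)] operad_arity_compose[OF P qs(1)]
      by (simp add: composable_def)
    have "compose Q (compose Q p' qs') (concat rss') = f (compose P (compose P p qs) (concat rss))"
      using fs(5)[OF c2] fs(5)[OF qs(1)] p qs rss by (simp add: map_concat)
    also have "\<dots> = f (compose P p (map2 (compose P) qs rss))"
      using operad_assoc[OF P qs(1) rss(1)] by simp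
    also have "\<dots> = compose Q p' (map2 (compose Q) qs' rss')"
      using fs(5)[OF c1] m p qs rss by simp
    finally show "compose Q (compose Q p' qs') (concat rss') = compose Q p' (map2 (compose Q) qs' rss')" .
  next
    fix p' qs' rs' \<sigma> \<beta>
    assume c: "composable Q p' qs'" and s: "\<sigma> permutes {1..arity Q p'}"
      and rs': "rs' = map (\<lambda>i. qs' ! (inv \<sigma> i - 1)) [1..<arity Q p' + 1]"
      and b: "\<beta> permutes {1..total_arity Q qs'}"
      and blk: "\<forall>i\<in>{1..arity Q p'}. \<forall>j\<in>{1..arity Q (qs' ! (i - 1))}.
        \<beta> (offset Q qs' i + j) = offset Q rs' (\<sigma> i) + j"
    obtain p where p: "p \<in> ops P" "f p = p'" using lift c unfolding composable_def by blast
    then obtain qs where qs: "composable P p qs" "map f qs = qs'" using liftc c by blast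
    have ar: "arity Q p' = arity P p" using fs(2) p by auto
    have sub: "set qs \<subseteq> ops P" and len: "length qs = arity P p" using qs by (auto simp: composable_def)
    define rs where "rs = map (\<lambda>i. qs ! (inv \<sigma> i - 1)) [1..<arity P p + 1]"
    have inr: "inv \<sigma> i - 1 < length qs" if "i \<in> {1..arity P p}" for i
      using permutes_in_image[OF permutes_inv[OF s], of i] that len ar by auto
    have rsf: "map f rs = rs'"
      using inr by (auto simp: rs_def rs' qs(2)[symmetric] ar simp del: upt_Suc)
    have subr: "set rs \<subseteq> ops P"
      using inr sub nth_mem by (fastforce simp: rs_def simp del: upt_Suc)
    have "compose P (act P p \<sigma>) qs = act P (compose P p rs) \<beta>"
    proof (rule operad_equivariant_outer[OF P qs(1) _ rs_def])
      show "\<sigma> permutes {1..arity P p}" using s ar by simp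
      show "\<beta> permutes {1..total_arity P qs}" using b hom_total_arity[OF f sub] qs by simp
      fix i j assume ij: "i \<in> {1..arity P p}" "j \<in> {1..arity P (qs ! (i - 1))}"
      then have "qs ! (i - 1) \<in> ops P" using sub len by (auto intro!: subsetD[OF sub] nth_mem)
      then have "j \<in> {1..arity Q (qs' ! (i - 1))}"
        using ij fs(2)[of "qs ! (i - 1)"] qs(2) len by auto
      then have "\<beta> (offset Q qs' i + j) = offset Q rs' (\<sigma> i) + j" using blk ij ar by auto
      then show "\<beta> (offset P qs i + j) = offset P rs (\<sigma> i) + j"
        using hom_offset[OF f sub] hom_offset[OF f subr] rsf qs(2) by metis
    qed
    moreover have c1: "composable P p rs"
      using subr p by (auto simp: composable_def rs_def simp del: upt_Suc)
    moreover have c2: "composable P (act P p \<sigma>) qs"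
      using qs(1) s ar p by (auto simp: composable_def operad_act[OF P] operad_arity_act[OF P])
    \<comment> \<open>\<open>\<beta>\<close> permutes the inputs counted along \<open>qs\<close>,
      but it acts on the composite along the rearranged list \<open>rs\<close>; the two counts
      agree.\<close>
    moreover have "total_arity P rs = total_arity P qs"
    proof -
      have "mset rs = mset qs"
      proof -
        have "mset rs = image_mset (\<lambda>i. qs ! (i - 1)) (image_mset (inv \<sigma>) (mset_set {1..arity P p}))"
          by (simp add: rs_def mset_upt image_mset.compositionality comp_def atLeastLessThanSuc_atLeastAtMost del: upt_Suc)
        also have "image_mset (inv \<sigma>) (mset_set {1..arity P p}) = mset_set {1..arity P p}"
          using permutes_image_mset[OF permutes_inv[OF s]] ar by (simp add: image_mset_mset_set permutes_inj_on[OF permutes_inv[OF s]] permutes_image[OF permutes_inv[OF s]])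
        also have "image_mset (\<lambda>i. qs ! (i - 1)) (mset_set {1..arity P p}) = mset (map (\<lambda>i. qs ! (i - 1)) [1..<arity P p + 1])"
          by (simp add: mset_upt atLeastLessThanSuc_atLeastAtMost del: upt_Suc)
        also have "map (\<lambda>i. qs ! (i - 1)) [1..<arity P p + 1] = qs"
          using len by (intro nth_equalityI) (auto simp del: upt_Suc)
        finally show ?thesis .
      qed
      then show ?thesis unfolding total_arity_def
        by (metis mset_map sum_mset_sum_list)
    qed
    moreover have "\<beta> permutes {1..total_arity P qs}" using b hom_total_arity[OF f sub] qs by simp
    ultimately show "compose Q (act Q p' \<sigma>) qs' = act Q (compose Q p' rs') \<beta>"
      using fs(5)[OF c1] fs(5)[OF c2] fs(4)[OF p(1), of \<sigma>] s ar p qs(2) rsf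
        fs(4)[OF operad_compose[OF P c1], of \<beta>] operad_arity_compose[OF P c1] by simp
  next
    fix p' qs' \<tau> \<beta>
    assume c: "composable Q p' qs'"
      and t: "\<forall>i\<in>{1..arity Q p'}. \<tau> i permutes {1..arity Q (qs' ! (i - 1))}"
      and b: "\<beta> permutes {1..total_arity Q qs'}"
      and blk: "\<forall>i\<in>{1..arity Q p'}. \<forall>j\<in>{1..arity Q (qs' ! (i - 1))}.
        \<beta> (offset Q qs' i + j) = offset Q qs' i + \<tau> i j"
    obtain p where p: "p \<in> ops P" "f p = p'" using lift c unfolding composable_def by blast
    then obtain qs where qs: "composable P p qs" "map f qs = qs'" using liftc c by blast
    have ar: "arity Q p' = arity P p" using fs(2) p by auto
    have sub: "set qs \<subseteq> ops P" and len: "length qs = arity P p" using qs by (auto simp: composable_def)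
    have mem: "qs ! (i - 1) \<in> ops P" if "i \<in> {1..arity P p}" for i
      using that sub len by (auto intro!: subsetD[OF sub] nth_mem)
    have arq: "arity Q (qs' ! (i - 1)) = arity P (qs ! (i - 1))" if "i \<in> {1..arity P p}" for i
      using fs(2)[OF mem[OF that]] that len qs(2) by auto
    have tp: "\<tau> i permutes {1..arity P (qs ! (i - 1))}" if "i \<in> {1..arity P p}" for i
      using bspec[OF t, of i] that ar arq[OF that] by metis
    define us where "us = map (\<lambda>i. act P (qs ! (i - 1)) (\<tau> i)) [1..<arity P p + 1]"
    have bp: "\<beta> permutes {1..total_arity P qs}" using b hom_total_arity[OF f sub] qs by simp
    have "compose P p us = act P (compose P p qs) \<beta>"
      unfolding us_def
    proof (rule operad_equivariant_inner[OF P qs(1) _ bp])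
      fix i assume i: "i \<in> {1..arity P p}"
      show "\<tau> i permutes {1..arity P (qs ! (i - 1))}" using tp[OF i] .
      fix j assume j: "j \<in> {1..arity P (qs ! (i - 1))}"
      then have "\<beta> (offset Q qs' i + j) = offset Q qs' i + \<tau> i j" using blk i arq[OF i] ar by auto
      then show "\<beta> (offset P qs i + j) = offset P qs i + \<tau> i j"
        using hom_offset[OF f sub] qs(2) by metis
    qed
    moreover have usf: "map f us = map (\<lambda>i. act Q (qs' ! (i - 1)) (\<tau> i)) [1..<arity Q p' + 1]"
    proof -
      have "f (act P (qs ! (i - 1)) (\<tau> i)) = act Q (qs' ! (i - 1)) (\<tau> i)" if "i \<in> {1..arity P p}" for i
        using fs(4)[OF mem[OF that] tp[OF that]] that len qs(2) by auto
      then show ?thesis by (auto simp: us_def ar simp del: upt_Suc)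
    qed
    moreover have c1: "composable P p us"
    proof -
      have "act P (qs ! (i - 1)) (\<tau> i) \<in> ops P" if "i \<in> {1..arity P p}" for i
        using operad_act[OF P mem[OF that] tp[OF that]] .
      then show ?thesis using p by (auto simp: composable_def us_def simp del: upt_Suc)
    qed
    ultimately show "compose Q p' (map (\<lambda>i. act Q (qs' ! (i - 1)) (\<tau> i)) [1..<arity Q p' + 1])
        = act Q (compose Q p' qs') \<beta>"
      using fs(5)[OF c1] fs(5)[OF qs(1)] p qs(2) bp
        fs(4)[OF operad_compose[OF P qs(1)], of \<beta>] operad_arity_compose[OF P qs(1)] by simp
  qed
qed


section \<open>Quotient operads\<close>

lemma ideal_ops:
  assumes P: "is_operad P"
  shows "ideal P R p q \<Longrightarrow> p \<in> ops P \<and> q \<in> ops P \<and> arity P p = arity P q"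
proof (induction rule: ideal.induct)
  case (ideal_act p q \<sigma>)
  then show ?case by (simp add: operad_act[OF P] operad_arity_act[OF P])
next
  case (ideal_compose p q ps qs)
  have "set ps \<subseteq> ops P \<and> set qs \<subseteq> ops P \<and> total_arity P ps = total_arity P qs \<and> length ps = length qs"
    using ideal_compose.IH(2) unfolding total_arity_def
    by (induction rule: list_all2_induct) auto
  then have "composable P p ps" "composable P q qs" "total_arity P ps = total_arity P qs"
    using ideal_compose by (auto simp: composable_def)
  then show ?case by (simp add: operad_compose[OF P] operad_arity_compose[OF P])
qed auto

text \<open>Equivalent elements define the same predicate under \<open>SOME\<close>, hence the same
  choice.\<close>

lemma rep_eq:
  assumes "ideal P R p q"
  shows "rep P R p = rep P R q"
proof -
  have "ideal P R p r = ideal P R q r" for r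
    using assms ideal_trans[of P R p q r] ideal_trans[of P R q p r] ideal_sym[of P R p q] by blast
  then show ?thesis by (simp add: rep_def)
qed

lemma ideal_rep: "p \<in> ops P \<Longrightarrow> ideal P R p (rep P R p)"
  unfolding rep_def by (rule someI) (rule ideal_refl)

lemma rep_hom:
  assumes P: "is_operad P"
  shows "operad_hom (rep P R) P (quotient_operad P R)"
  unfolding operad_hom_def
proof (intro conjI ballI allI impI)
  fix p assume p: "p \<in> ops P"
  show "rep P R p \<in> ops (quotient_operad P R)" using p by (simp add: quotient_operad_def)
  show "arity (quotient_operad P R) (rep P R p) = arity P p"
    using ideal_ops[OF P ideal_rep[OF p]] by (simp add: quotient_operad_def)
  fix \<sigma> assume "\<sigma> permutes {1..arity P p}"
  then show "rep P R (act P p \<sigma>) = act (quotient_operad P R) (rep P R p) \<sigma>"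
    using rep_eq[OF ideal_act[OF ideal_rep[OF p]]] by (simp add: quotient_operad_def)
next
  fix p qs assume c: "composable P p qs"
  have "list_all2 (ideal P R) qs (map (rep P R) qs)"
    using c by (auto simp: composable_def list_all2_conv_all_nth intro!: ideal_rep)
  then have "ideal P R (compose P p qs) (compose P (rep P R p) (map (rep P R) qs))"
    using c by (intro ideal_compose ideal_rep) (auto simp: composable_def)
  then show "rep P R (compose P p qs) = compose (quotient_operad P R) (rep P R p) (map (rep P R) qs)"
    by (simp add: quotient_operad_def rep_eq)
qed (simp add: quotient_operad_def)

lemma ops_quotient: "ops (quotient_operad P R) = rep P R ` ops P"
  by (simp add: quotient_operad_def)

lemma quotient_is_operad: "is_operad P \<Longrightarrow> is_operad (quotient_operad P R)"
  by (rule hom_image_operad[OF _ rep_hom ops_quotient])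

lemma rep_relation:
  "(p, q) \<in> R \<Longrightarrow> p \<in> ops P \<Longrightarrow> q \<in> ops P \<Longrightarrow> arity P p = arity P q \<Longrightarrow> rep P R p = rep P R q"
  by (intro rep_eq ideal_base)

lemma hom_ideal:
  assumes P: "is_operad P" and h: "operad_hom h P Q"
    and R: "\<And>p q. (p, q) \<in> R \<Longrightarrow> p \<in> ops P \<Longrightarrow> q \<in> ops P \<Longrightarrow> h p = h q"
  shows "ideal P R p q \<Longrightarrow> h p = h q"
proof (induction rule: ideal.induct)
  case (ideal_act p q \<sigma>)
  then show ?case using ideal_ops[OF P ideal_act.hyps(1)] by (simp add: hom_act[OF h])
next
  case (ideal_compose p q ps qs)
  have *: "set ps \<subseteq> ops P \<and> set qs \<subseteq> ops P \<and> map h ps = map h qs \<and> length ps = length qs"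
    using ideal_compose.IH(2)
    by (induction rule: list_all2_induct) (use ideal_ops[OF P] in auto)
  then have "composable P p ps" "composable P q qs"
    using ideal_compose.hyps ideal_ops[OF P ideal_compose.hyps(1)] by (auto simp: composable_def)
  then show ?case using ideal_compose.IH * by (simp add: hom_compose[OF h])
qed (auto simp: R)

lemma hom_rep:
  assumes "is_operad P" "operad_hom h P Q"
    and "\<And>p q. (p, q) \<in> R \<Longrightarrow> p \<in> ops P \<Longrightarrow> q \<in> ops P \<Longrightarrow> h p = h q"
    and "p \<in> ops P"
  shows "h (rep P R p) = h p"
  by (rule hom_ideal[OF assms(1-3) ideal_rep[OF assms(4)], symmetric])

text \<open>Classes are represented by elements of \<open>P\<close> itself, so the map induced on
  the quotient is again \<open>h\<close>, restricted to representatives; the point is that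
  \<open>h\<close> does not distinguish an element from its representative.\<close>

lemma hom_quotient:
  assumes P: "is_operad P" and h: "operad_hom h P Q"
    and R: "\<And>p q. (p, q) \<in> R \<Longrightarrow> p \<in> ops P \<Longrightarrow> q \<in> ops P \<Longrightarrow> h p = h q"
  shows "operad_hom h (quotient_operad P R) Q"
proof -
  have hr: "h (rep P R p) = h p" if "p \<in> ops P" for p
    by (rule hom_rep[OF P h R that])
  have sub: "ops (quotient_operad P R) \<subseteq> ops P"
    using ideal_ops[OF P ideal_rep] by (auto simp: quotient_operad_def)
  show ?thesis
    unfolding operad_hom_def
  proof (intro conjI ballI allI impI)
    show "h (ident (quotient_operad P R)) = ident Q"
      using hr[OF operad_ident[OF P]] hom_ident[OF h] by (simp add: quotient_operad_def)
  next
    fix p assume p: "p \<in> ops (quotient_operad P R)"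
    then have p': "p \<in> ops P" using sub by blast
    show "h p \<in> ops Q" using p' by (rule hom_ops[OF h])
    show "arity Q (h p) = arity (quotient_operad P R) p"
      using hom_arity[OF h p'] by (simp add: quotient_operad_def)
    fix \<sigma> assume "\<sigma> permutes {1..arity (quotient_operad P R) p}"
    then show "h (act (quotient_operad P R) p \<sigma>) = act Q (h p) \<sigma>"
      using p' hr[OF operad_act[OF P]] hom_act[OF h] by (simp add: quotient_operad_def)
  next
    fix p qs assume "composable (quotient_operad P R) p qs"
    then have "composable P p qs" using sub by (auto simp: composable_def quotient_operad_def)
    then show "h (compose (quotient_operad P R) p qs) = compose Q (h p) (map h qs)"
      using hr[OF operad_compose[OF P]] hom_compose[OF h] by (simp add: quotient_operad_def)
  qed
qed


section \<open>Tree operads\<close>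

declare upt_Suc [simp del]

lemma nth_map_upt_one: "i \<in> {1..n} \<Longrightarrow> map f [1..<n + 1] ! (i - 1) = f i"
  by (auto simp: nth_map_upt less_Suc_eq_le)

lemma concat_map_concat: "concat (map f (concat xss)) = concat (map (\<lambda>xs. concat (map f xs)) xss)"
  by (induction xss) simp_all

section \<open>Grafting and renaming of leaves\<close>

lemma leaves_graft: "leaves (graft f t) = concat (map (\<lambda>i. leaves (f i)) (leaves t))"
proof (induction t rule: leaves.induct)
  case (2 s ts)
  then have "map leaves (map (graft f) ts) = map (\<lambda>t. concat (map (\<lambda>i. leaves (f i)) (leaves t))) ts"
    by simp
  then show ?case by (simp add: concat_map_concat comp_def cong: map_cong)
qed simp

lemma graft_graft: "graft f (graft g t) = graft (\<lambda>i. graft f (g i)) t"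
  by (induction t rule: leaves.induct) simp_all

lemma graft_cong: "(\<And>i. i \<in> set (leaves t) \<Longrightarrow> f i = g i) \<Longrightarrow> graft f t = graft g t"
  by (induction t rule: leaves.induct) auto

lemma graft_Leaf: "graft Leaf t = t"
  by (induction t rule: leaves.induct) (simp_all add: map_idI)

lemma over_sig_graft:
  "over_sig S (graft f t) \<longleftrightarrow> over_sig S t \<and> (\<forall>i\<in>set (leaves t). over_sig S (f i))"
  by (induction t rule: leaves.induct) auto

lemma leaves_relabel: "leaves (relabel h t) = map h (leaves t)"
  by (simp add: relabel_def leaves_graft)

lemma over_sig_relabel: "over_sig S (relabel h t) \<longleftrightarrow> over_sig S t"
  by (simp add: relabel_def over_sig_graft)

lemma relabel_graft: "relabel h (graft f t) = graft (\<lambda>i. relabel h (f i)) t"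
  by (simp add: relabel_def graft_graft)

lemma graft_relabel: "graft f (relabel h t) = graft (\<lambda>i. f (h i)) t"
  by (simp add: relabel_def graft_graft)

lemma relabel_relabel: "relabel g (relabel h t) = relabel (\<lambda>i. g (h i)) t"
  by (simp add: relabel_def graft_graft)

lemma relabel_cong: "(\<And>i. i \<in> set (leaves t) \<Longrightarrow> g i = h i) \<Longrightarrow> relabel g t = relabel h t"
  unfolding relabel_def by (rule graft_cong) simp

lemma relabel_id: "(\<And>i. i \<in> set (leaves t) \<Longrightarrow> h i = i) \<Longrightarrow> relabel h t = t"
  using graft_cong[of t "\<lambda>i. Leaf (h i)" Leaf] by (simp add: relabel_def graft_Leaf)

text \<open>The function grafted in \<open>compose\<close>; with a name for it, composites take the
  form \<open>graft (shifted qs) t\<close>.\<close>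

definition shifted :: "'x tree list \<Rightarrow> nat \<Rightarrow> 'x tree" where
  "shifted qs i = relabel (\<lambda>j. (\<Sum>q\<leftarrow>take (i - 1) qs. length (leaves q)) + j) (qs ! (i - 1))"

lemma tree_operad_simps:
  "arity (tree_operad S) t = length (leaves t)"
  "ident (tree_operad S) = Leaf 1"
  "act (tree_operad S) t \<sigma> = relabel (inv \<sigma>) t"
  "compose (tree_operad S) t qs = graft (shifted qs) t"
  by (simp_all add: tree_operad_def shifted_def[abs_def])

text \<open>Multisets of leaf names are additive under concatenation and blind to order, which suits
  composites better than distinctness together with a set.\<close>

lemma mset_interval_iff:
  "distinct xs \<and> set xs = {1..length xs} \<longleftrightarrow> mset xs = mset [1..<length xs + 1]"
proof -
  have d: "distinct [1..<length xs + 1]" "set [1..<length xs + 1] = {1..length xs}" by auto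
  show ?thesis
  proof
    assume "distinct xs \<and> set xs = {1..length xs}"
    then show "mset xs = mset [1..<length xs + 1]"
      using set_eq_iff_mset_eq_distinct[OF _ d(1), of xs] d(2) by metis
  next
    assume m: "mset xs = mset [1..<length xs + 1]"
    show "distinct xs \<and> set xs = {1..length xs}"
      using mset_eq_imp_distinct_iff[OF m] mset_eq_setD[OF m] d by metis
  qed
qed

lemma mem_ops_tree:
  "t \<in> ops (tree_operad S) \<longleftrightarrow>
     over_sig S t \<and> distinct (leaves t) \<and> set (leaves t) = {1..length (leaves t)}"
  by (simp add: tree_operad_def)

lemma mem_ops_tree_mset:
  "t \<in> ops (tree_operad S) \<longleftrightarrow> over_sig S t \<and> mset (leaves t) = mset [1..<length (leaves t) + 1]"
  unfolding mem_ops_tree mset_interval_iff[symmetric] ..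

lemma composable_tree:
  "composable (tree_operad S) t qs \<longleftrightarrow> t \<in> ops (tree_operad S) \<and> set qs \<subseteq> ops (tree_operad S) \<and>
     length qs = length (leaves t)"
  by (simp add: composable_def tree_operad_simps)

lemma offset_tree: "offset (tree_operad S) qs i = (\<Sum>q\<leftarrow>take (i - 1) qs. length (leaves q))"
  by (simp add: offset_def total_arity_def tree_operad_simps comp_def)

lemma total_arity_tree: "total_arity (tree_operad S) qs = (\<Sum>q\<leftarrow>qs. length (leaves q))"
  by (simp add: total_arity_def tree_operad_simps comp_def)

lemma leaves_shifted:
  "leaves (shifted qs i) = map ((+) (\<Sum>q\<leftarrow>take (i - 1) qs. length (leaves q))) (leaves (qs ! (i - 1)))"
  by (simp add: shifted_def leaves_relabel)

lemma mset_concat_map_cong: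
  assumes "mset xs = mset ys" "\<And>x. x \<in> set xs \<Longrightarrow> mset (f x) = mset (g x)"
  shows "mset (concat (map f xs)) = mset (concat (map g ys))"
proof -
  have *: "mset (concat (map f xs)) = \<Sum>\<^sub># (image_mset (\<lambda>x. mset (f x)) (mset xs))" for f :: "'a \<Rightarrow> 'b list" and xs
    by (induction xs) auto
  have "image_mset (\<lambda>x. mset (f x)) (mset xs) = image_mset (\<lambda>x. mset (g x)) (mset xs)"
    using assms(2) by (intro image_mset_cong) auto
  then show ?thesis unfolding * using assms(1) by simp
qed

lemma concat_blocks_upt':
  "concat (map (\<lambda>i. map ((+) (\<Sum>q\<leftarrow>take (i - 1) qs. length (leaves q))) [1..<length (leaves (qs ! (i - 1))) + 1])
     [1..<length qs + 1]) = [1..<(\<Sum>q\<leftarrow>qs. length (leaves q)) + 1]"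
proof -
  have u: "[1..<length qs + 1] = map Suc [0..<length qs]" by (simp add: map_Suc_upt)
  have "concat (map (\<lambda>i. map ((+) (\<Sum>q\<leftarrow>take (i - 1) qs. length (leaves q))) [1..<length (leaves (qs ! (i - 1))) + 1])
     [1..<length qs + 1])
    = concat (map (\<lambda>i. map (\<lambda>j. sum_list (take i (map (\<lambda>q. length (leaves q)) qs)) + j)
        [1..<map (\<lambda>q. length (leaves q)) qs ! i + 1]) [0..<length (map (\<lambda>q. length (leaves q)) qs)])"
    unfolding u map_map by (intro arg_cong[where f = concat] map_cong) (auto simp: take_map comp_def)
  then show ?thesis unfolding concat_blocks_upt .
qed

text \<open>The leaves of \<open>t\<close> visit the arguments in some order; up to this order, and
  up to the order inside each argument, the names are the consecutive blocks of
  \<open>concat_blocks_upt'\<close>.\<close>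

lemma graft_shifted_ops:
  assumes "composable (tree_operad S) t qs"
  shows "graft (shifted qs) t \<in> ops (tree_operad S)"
    and "length (leaves (graft (shifted qs) t)) = (\<Sum>q\<leftarrow>qs. length (leaves q))"
proof -
  have t: "over_sig S t" "mset (leaves t) = mset [1..<length (leaves t) + 1]"
    and len: "length (leaves t) = length qs"
    using assms unfolding composable_tree mem_ops_tree_mset by simp_all
  have "qs ! i \<in> ops (tree_operad S)" if "i < length qs" for i
    using assms nth_mem[OF that] unfolding composable_tree by blast
  then have qs: "over_sig S (qs ! i)"
      "mset (leaves (qs ! i)) = mset [1..<length (leaves (qs ! i)) + 1]" if "i < length qs" for i
    using that unfolding mem_ops_tree_mset by blast+
  have s: "set (leaves t) = {1..length qs}"
    using assms by (simp add: composable_tree mem_ops_tree)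
  have "mset (leaves (graft (shifted qs) t))
    = mset (concat (map (\<lambda>i. map ((+) (\<Sum>q\<leftarrow>take (i - 1) qs. length (leaves q))) [1..<length (leaves (qs ! (i - 1))) + 1])
     [1..<length qs + 1]))"
    unfolding leaves_graft
  proof (rule mset_concat_map_cong)
    show "mset (leaves t) = mset [1..<length qs + 1]" using t len by simp
    fix x assume "x \<in> set (leaves t)"
    then have "x - 1 < length qs" using s by auto
    then show "mset (leaves (shifted qs x)) = mset (map ((+) (\<Sum>q\<leftarrow>take (x - 1) qs. length (leaves q))) [1..<length (leaves (qs ! (x - 1))) + 1])"
      unfolding leaves_shifted mset_map by (simp only: qs)
  qed
  then have m: "mset (leaves (graft (shifted qs) t)) = mset [1..<(\<Sum>q\<leftarrow>qs. length (leaves q)) + 1]"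
    unfolding concat_blocks_upt' .
  then show l: "length (leaves (graft (shifted qs) t)) = (\<Sum>q\<leftarrow>qs. length (leaves q))"
    using mset_eq_length[OF m] by simp
  have "over_sig S (shifted qs i)" if "i \<in> set (leaves t)" for i
    using that s qs(1)[of "i - 1"] by (auto simp: shifted_def over_sig_relabel)
  then show "graft (shifted qs) t \<in> ops (tree_operad S)"
    using m l t(1) by (auto simp: mem_ops_tree_mset over_sig_graft)
qed

lemma leaves_not_Nil:
  assumes "over_sig S t" "\<And>s m. (s, m) \<in> S \<Longrightarrow> 1 \<le> m"
  shows "leaves t \<noteq> []"
  using assms(1)
proof (induction t rule: leaves.induct)
  case (2 s ts)
  then have "ts \<noteq> []" using assms(2)[of s "length ts"] by auto
  then show ?case using 2 by (cases ts) auto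
qed simp

text \<open>In each law of composition both sides graft onto the same tree, by
  \<open>graft_graft\<close>; what has to be compared is the name that a leaf receives, that is,
  arithmetic of offsets. Positive arities exclude trees without leaves.\<close>

lemma tree_operad_is_operad:
  assumes S: "\<And>s m. (s, m) \<in> S \<Longrightarrow> 1 \<le> m"
  shows "is_operad (tree_operad S)"
  unfolding is_operad_def
proof (intro conjI ballI allI impI; (elim conjE)?)
  let ?P = "tree_operad S"
  fix p assume p: "p \<in> ops ?P"
  show "1 \<le> arity ?P p"
    using leaves_not_Nil[of S p] S p by (auto simp: tree_operad_simps mem_ops_tree Suc_le_eq)
  show "act ?P p id = p" by (simp add: tree_operad_simps relabel_id)
  show "compose ?P (ident ?P) [p] = p" by (simp add: tree_operad_simps shifted_def relabel_id)
  show "compose ?P p (replicate (arity ?P p) (ident ?P)) = p"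
  proof -
    have "shifted (replicate (length (leaves p)) (Leaf 1)) i = Leaf i" if "i \<in> set (leaves p)" for i
      using that p by (auto simp: mem_ops_tree shifted_def relabel_def sum_list_replicate take_replicate)
    then have "graft (shifted (replicate (length (leaves p)) (Leaf 1))) p = graft Leaf p"
      by (rule graft_cong)
    then show ?thesis by (simp only: tree_operad_simps graft_Leaf)
  qed
  fix \<sigma> assume s: "\<sigma> permutes {1..arity ?P p}"
  show "arity ?P (act ?P p \<sigma>) = arity ?P p" by (simp add: tree_operad_simps leaves_relabel)
  show "act ?P p \<sigma> \<in> ops ?P"
    using p s permutes_image[OF permutes_inv[OF s]] permutes_inj[OF permutes_inv[OF s]]
    by (auto simp: tree_operad_simps mem_ops_tree leaves_relabel over_sig_relabel distinct_map
        intro: inj_on_subset)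
  fix \<tau> assume t: "\<tau> permutes {1..arity ?P p}"
  show "act ?P p (\<sigma> \<circ> \<tau>) = act ?P (act ?P p \<sigma>) \<tau>"
    using o_inv_distrib[OF permutes_bij[OF s] permutes_bij[OF t]]
    by (simp add: tree_operad_simps relabel_relabel comp_def)
next
  let ?P = "tree_operad S"
  show "ident ?P \<in> ops ?P" "arity ?P (ident ?P) = 1" by (simp_all add: tree_operad_simps mem_ops_tree)
next
  let ?P = "tree_operad S"
  fix p qs assume c: "composable ?P p qs"
  show "compose ?P p qs \<in> ops ?P" "arity ?P (compose ?P p qs) = total_arity ?P qs"
    using graft_shifted_ops[OF c] by (simp_all add: tree_operad_simps total_arity_tree)
  fix rss assume r: "list_all2 (composable ?P) qs rss"
  have len: "length rss = length qs" using r by (simp add: list_all2_lengthD)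
  \<comment> \<open>On the left the leaf \<open>j\<close> of the \<open>i\<close>-th argument is
    numbered within the whole composite and selects an entry of \<open>concat rss\<close> by its
    position there; on the right it selects within the block \<open>rss ! (i - 1)\<close>.\<close>
  have "graft (shifted (concat rss)) (shifted qs i) = shifted (map2 (compose ?P) qs rss) i"
    if "i \<in> set (leaves p)" for i
  proof -
    have i: "i - 1 < length qs" using that c by (auto simp: composable_tree mem_ops_tree)
    have tk: "(\<Sum>q\<leftarrow>take (i - 1) qs. length (leaves q)) = sum_list (map length (take (i - 1) rss))"
      using list_all2_takeI[OF r, of "i - 1"]
      by (induction rule: list_all2_induct) (auto simp: composable_tree)
    have tk2: "(\<Sum>q\<leftarrow>take (i - 1) (map2 (compose ?P) qs rss). length (leaves q))
        = (\<Sum>q\<leftarrow>concat (take (i - 1) rss). length (leaves q))"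
      unfolding take_map take_zip using list_all2_takeI[OF r, of "i - 1"]
      by (induction rule: list_all2_induct) (auto simp: tree_operad_simps graft_shifted_ops(2))
    have ci: "composable ?P (qs ! (i - 1)) (rss ! (i - 1))" using r i by (simp add: list_all2_nthD)
    have "shifted (concat rss) ((\<Sum>q\<leftarrow>take (i - 1) qs. length (leaves q)) + j)
      = relabel (\<lambda>k. (\<Sum>q\<leftarrow>concat (take (i - 1) rss). length (leaves q)) + k) (shifted (rss ! (i - 1)) j)"
      if "j \<in> set (leaves (qs ! (i - 1)))" for j
    proof -
      have j: "1 \<le> j" "j - 1 < length (rss ! (i - 1))"
        using that ci by (auto simp: composable_tree mem_ops_tree)
      have jj: "sum_list (map length (take (i - 1) rss)) + j - 1 = sum_list (map length (take (i - 1) rss)) + (j - 1)"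
        using j by simp
      show ?thesis
        unfolding shifted_def tk jj
        using nth_concat_block[of "i - 1" rss "j - 1"] take_concat_block[of "i - 1" rss "j - 1"] i j len
        by (simp add: relabel_relabel) (rule relabel_cong, simp add: add.assoc)
    qed
    then have "graft (shifted (concat rss)) (shifted qs i)
      = graft (\<lambda>j. relabel (\<lambda>k. (\<Sum>q\<leftarrow>concat (take (i - 1) rss). length (leaves q)) + k) (shifted (rss ! (i - 1)) j)) (qs ! (i - 1))"
      unfolding shifted_def[of qs] graft_relabel by (rule graft_cong)
    also have "\<dots> = shifted (map2 (compose ?P) qs rss) i"
      unfolding shifted_def[of "map2 (compose ?P) qs rss"] tk2 using i len
      by (simp add: tree_operad_simps relabel_graft)
    finally show ?thesis .
  qed
  then show "compose ?P (compose ?P p qs) (concat rss) = compose ?P p (map2 (compose ?P) qs rss)"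
    unfolding tree_operad_simps(4) graft_graft by (intro graft_cong) (simp add: tree_operad_simps(4)[abs_def])
next
  let ?P = "tree_operad S"
  fix p qs qs' \<sigma> \<beta>
  assume c: "composable ?P p qs" and s: "\<sigma> permutes {1..arity ?P p}"
    and qs': "qs' = map (\<lambda>i. qs ! (inv \<sigma> i - 1)) [1..<arity ?P p + 1]"
    and b: "\<beta> permutes {1..total_arity ?P qs}"
    and blk: "\<forall>i\<in>{1..arity ?P p}. \<forall>j\<in>{1..arity ?P (qs ! (i - 1))}.
        \<beta> (offset ?P qs i + j) = offset ?P qs' (\<sigma> i) + j"
  \<comment> \<open>The leaf \<open>i\<close> of \<open>p\<close> receives the same argument on both
    sides, entry \<open>inv \<sigma> i\<close> of \<open>qs\<close>. Only its offset differs, and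
    \<open>\<beta>\<close> translates between the two offsets.\<close>
  have "shifted qs (inv \<sigma> i) = relabel (inv \<beta>) (shifted qs' i)" if "i \<in> set (leaves p)" for i
  proof -
    have i: "i \<in> {1..arity ?P p}" using that c by (simp add: composable_tree mem_ops_tree tree_operad_simps)
    then have i': "inv \<sigma> i \<in> {1..arity ?P p}" using permutes_in_image[OF permutes_inv[OF s]] by blast
    have si: "\<sigma> (inv \<sigma> i) = i" using permutes_inverses(1)[OF s] .
    have q: "qs' ! (i - 1) = qs ! (inv \<sigma> i - 1)" unfolding qs' using i by (rule nth_map_upt_one)
    have l: "inv \<sigma> i - 1 < length qs" using i' c by (auto simp: composable_tree tree_operad_simps)
    have "offset ?P qs (inv \<sigma> i) + j = inv \<beta> (offset ?P qs' i + j)"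
      if "j \<in> set (leaves (qs ! (inv \<sigma> i - 1)))" for j
    proof -
      have "qs ! (inv \<sigma> i - 1) \<in> ops ?P" using c l nth_mem by (auto simp: composable_tree)
      then have "j \<in> {1..arity ?P (qs ! (inv \<sigma> i - 1))}"
        using that by (auto simp: mem_ops_tree tree_operad_simps)
      then have "\<beta> (offset ?P qs (inv \<sigma> i) + j) = offset ?P qs' i + j" using blk i' si by metis
      then show ?thesis using permutes_inverses(2)[OF b] by metis
    qed
    then show ?thesis
      unfolding shifted_def q relabel_relabel offset_tree[of S, symmetric] by (rule relabel_cong)
  qed
  then show "compose ?P (act ?P p \<sigma>) qs = act ?P (compose ?P p qs') \<beta>"
    unfolding tree_operad_simps graft_relabel relabel_graft by (rule graft_cong)
next
  let ?P = "tree_operad S"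
  fix p qs \<tau> \<beta>
  assume c: "composable ?P p qs"
    and t: "\<forall>i\<in>{1..arity ?P p}. \<tau> i permutes {1..arity ?P (qs ! (i - 1))}"
    and b: "\<beta> permutes {1..total_arity ?P qs}"
    and blk: "\<forall>i\<in>{1..arity ?P p}. \<forall>j\<in>{1..arity ?P (qs ! (i - 1))}.
        \<beta> (offset ?P qs i + j) = offset ?P qs i + \<tau> i j"
  let ?us = "map (\<lambda>i. act ?P (qs ! (i - 1)) (\<tau> i)) [1..<arity ?P p + 1]"
  have "shifted ?us i = relabel (inv \<beta>) (shifted qs i)" if "i \<in> set (leaves p)" for i
  proof -
    have i: "i \<in> {1..arity ?P p}" using that c by (simp add: composable_tree mem_ops_tree tree_operad_simps)
    have l: "i - 1 < length qs" using i c by (auto simp: composable_tree tree_operad_simps)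
    have ml: "map (\<lambda>q. length (leaves q)) ?us = map (\<lambda>q. length (leaves q)) qs"
      using c by (intro nth_equalityI)
        (auto simp: composable_tree tree_operad_simps leaves_relabel nth_map_upt)
    have o: "offset ?P ?us i = offset ?P qs i"
      unfolding offset_tree take_map[symmetric] ml ..
    have u: "?us ! (i - 1) = relabel (inv (\<tau> i)) (qs ! (i - 1))"
      using nth_map_upt_one[OF i, of "\<lambda>i. act ?P (qs ! (i - 1)) (\<tau> i)"]
      by (simp add: tree_operad_simps)
    have "offset ?P qs i + inv (\<tau> i) j = inv \<beta> (offset ?P qs i + j)"
      if "j \<in> set (leaves (qs ! (i - 1)))" for j
    proof -
      have ti: "\<tau> i permutes {1..arity ?P (qs ! (i - 1))}" using t i by blast
      have "qs ! (i - 1) \<in> ops ?P" using c l nth_mem by (auto simp: composable_tree)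
      then have "j \<in> {1..arity ?P (qs ! (i - 1))}"
        using that by (auto simp: mem_ops_tree tree_operad_simps)
      then have "inv (\<tau> i) j \<in> {1..arity ?P (qs ! (i - 1))}"
        using permutes_in_image[OF permutes_inv[OF ti]] by blast
      then have "\<beta> (offset ?P qs i + inv (\<tau> i) j) = offset ?P qs i + j"
        using blk i permutes_inverses(1)[OF ti] by metis
      then show ?thesis using permutes_inverses(2)[OF b] by metis
    qed
    then show ?thesis
      unfolding shifted_def u relabel_relabel offset_tree[of S, symmetric] o by (rule relabel_cong)
  qed
  then show "compose ?P p ?us = act ?P (compose ?P p qs) \<beta>"
    unfolding tree_operad_simps relabel_graft by (rule graft_cong)
qed


declare upt_Suc [simp del]

section \<open>Generation by corollas\<close>

lemma relabel_Node: "relabel h (Node s ts) = Node s (map (relabel h) ts)"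
  by (simp add: relabel_def)

lemma leaves_corolla: "leaves (corolla s m) = [1..<m + 1]"
  by (simp add: corolla_def comp_def)

lemma corolla_ops: "(s, m) \<in> S \<Longrightarrow> corolla s m \<in> ops (tree_operad S)"
  by (auto simp: mem_ops_tree leaves_corolla) (simp add: corolla_def)

lemma graft_corolla: "graft f (corolla s m) = Node s (map f [1..<m + 1])"
  by (simp add: corolla_def)

text \<open>A subtree of an operation may have any leaf names, so induction on trees leaves the
  operad. Renumbering the leaves from left to right repairs this, and a tree numbered in this way is
  a composite of corollas alone, without permutations, because the blocks of the composite come in
  planar order.\<close>

lemma standardize:
  assumes over: "over_sig S t"
    and Leaf: "Leaf 1 \<in> Z" and corolla: "\<And>s m. (s, m) \<in> S \<Longrightarrow> corolla s m \<in> Z"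
    and graft: "\<And>t qs. t \<in> Z \<Longrightarrow> set qs \<subseteq> Z \<Longrightarrow> composable (tree_operad S) t qs \<Longrightarrow>
        graft (shifted qs) t \<in> Z"
  obtains u where "u \<in> Z" "u \<in> ops (tree_operad S)" "leaves u = [1..<length (leaves t) + 1]"
    "t = relabel (\<lambda>i. leaves t ! (i - 1)) u"
proof -
  have "\<exists>u\<in>Z. u \<in> ops (tree_operad S) \<and> leaves u = [1..<length (leaves t) + 1] \<and>
      t = relabel (\<lambda>i. leaves t ! (i - 1)) u"
    using over
  proof (induction t rule: leaves.induct)
    case (1 i)
    then show ?case using Leaf by (intro bexI[of _ "Leaf 1"]) (auto simp: relabel_def mem_ops_tree upt_Suc)
  next
    case (2 s ts)
    then have "\<forall>t\<in>set ts. \<exists>u\<in>Z. u \<in> ops (tree_operad S) \<and> leaves u = [1..<length (leaves t) + 1] \<and>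
      t = relabel (\<lambda>i. leaves t ! (i - 1)) u" by simp
    then obtain U where U: "\<And>t. t \<in> set ts \<Longrightarrow> U t \<in> Z" "\<And>t. t \<in> set ts \<Longrightarrow> U t \<in> ops (tree_operad S)"
      "\<And>t. t \<in> set ts \<Longrightarrow> leaves (U t) = [1..<length (leaves t) + 1]"
      "\<And>t. t \<in> set ts \<Longrightarrow> relabel (\<lambda>i. leaves t ! (i - 1)) (U t) = t"
      by metis
    let ?us = "map U ts"
    let ?u = "graft (shifted ?us) (corolla s (length ts))"
    have sm: "(s, length ts) \<in> S" using 2 by simp
    have c: "composable (tree_operad S) (corolla s (length ts)) ?us"
      using U(2) corolla_ops[OF sm] by (auto simp: composable_tree leaves_corolla)
    have uZ: "?u \<in> Z" using corolla[OF sm] U(1) c by (intro graft) auto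
    have uo: "?u \<in> ops (tree_operad S)" by (rule graft_shifted_ops[OF c])
    have lens: "map (\<lambda>q. length (leaves q)) ?us = map (\<lambda>t. length (leaves t)) ts"
      using U(3) by simp
    have "leaves ?u = concat (map (\<lambda>i. map ((+) (\<Sum>q\<leftarrow>take (i - 1) ?us. length (leaves q)))
        [1..<length (leaves (?us ! (i - 1))) + 1]) [1..<length ?us + 1])"
      unfolding leaves_graft leaves_corolla leaves_shifted
      by (intro arg_cong[where f = concat] map_cong) (auto simp: U(3))
    also have "\<dots> = [1..<(\<Sum>q\<leftarrow>?us. length (leaves q)) + 1]" by (rule concat_blocks_upt')
    finally have lu: "leaves ?u = [1..<length (leaves (Node s ts)) + 1]"
      unfolding lens by (simp add: length_concat comp_def)
    have "relabel (\<lambda>i. leaves (Node s ts) ! (i - 1)) (shifted ?us i) = ts ! (i - 1)"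
      if "i \<in> {1..length ts}" for i
    proof -
      have i: "i - 1 < length ts" using that by auto
      have tk: "(\<Sum>q\<leftarrow>take (i - 1) ?us. length (leaves q)) = sum_list (map length (take (i - 1) (map leaves ts)))"
        unfolding take_map[symmetric] lens by (simp add: take_map comp_def)
      have "leaves (Node s ts) ! ((\<Sum>q\<leftarrow>take (i - 1) ?us. length (leaves q)) + j - 1)
          = leaves (ts ! (i - 1)) ! (j - 1)"
        if "j \<in> set (leaves (U (ts ! (i - 1))))" for j
      proof -
        have j: "1 \<le> j" "j - 1 < length (leaves (ts ! (i - 1)))" using that U(3) i by auto
        show ?thesis
          unfolding tk using nth_concat_block[of "i - 1" "map leaves ts" "j - 1"] i j by simp
      qed
      then have "relabel (\<lambda>i. leaves (Node s ts) ! (i - 1)) (shifted ?us i)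
        = relabel (\<lambda>j. leaves (ts ! (i - 1)) ! (j - 1)) (U (ts ! (i - 1)))"
        unfolding shifted_def relabel_relabel using i by (auto intro!: relabel_cong)
      then show ?thesis using U(4) i by simp
    qed
    then have "relabel (\<lambda>i. leaves (Node s ts) ! (i - 1)) ?u = Node s (map (\<lambda>i. ts ! (i - 1)) [1..<length ts + 1])"
      unfolding graft_corolla relabel_Node by (auto simp: less_Suc_eq_le)
    also have "map (\<lambda>i. ts ! (i - 1)) [1..<length ts + 1] = ts"
      by (intro nth_equalityI) (auto simp: nth_map_upt)
    finally show ?case using uZ uo lu by metis
  qed
  then show ?thesis using that by blast
qed

text \<open>Reads a list of input names as the permutation sending the position of an input to its
  name; \<open>inv (lperm xs)\<close> then acts as the renaming.\<close>

definition lperm :: "nat list \<Rightarrow> nat \<Rightarrow> nat" where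
  "lperm xs j = (if j \<in> {1..length xs} then xs ! (j - 1) else j)"

lemma lperm_permutes:
  assumes "distinct xs" "set xs = {1..length xs}"
  shows "lperm xs permutes {1..length xs}"
proof (rule bij_imp_permutes)
  have "bij_betw (\<lambda>j. xs ! (j - 1)) {1..length xs} (set xs)"
  proof (rule bij_betw_imageI)
    show "inj_on (\<lambda>j. xs ! (j - 1)) {1..length xs}"
      using assms(1) by (auto simp: inj_on_def nth_eq_iff_index_eq)
    have "x \<in> (\<lambda>j. xs ! (j - 1)) ` {1..length xs}" if x: "x \<in> set xs" for x
    proof -
      obtain i where "i < length xs" "xs ! i = x" using x by (metis in_set_conv_nth)
      then show ?thesis by (intro image_eqI[of _ _ "Suc i"]) auto
    qed
    then show "(\<lambda>j. xs ! (j - 1)) ` {1..length xs} = set xs" by auto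
  qed
  then show "bij_betw (lperm xs) {1..length xs} {1..length xs}"
    unfolding assms(2) by (rule bij_betw_cong[THEN iffD1, rotated]) (simp add: lperm_def)
qed (auto simp: lperm_def)

lemma lperm_upt: "lperm [1..<n + 1] = id"
  by (auto simp: lperm_def fun_eq_iff)

lemma lperm_concat_block:
  assumes "i \<in> {1..length xss}" "j \<in> {1..length (xss ! (i - 1))}"
  shows "lperm (concat xss) (sum_list (take (i - 1) (map length xss)) + j) = xss ! (i - 1) ! (j - 1)"
proof -
  have i: "i - 1 < length xss" and j: "j - 1 < length (xss ! (i - 1))" using assms by auto
  have "sum_list (take (i - 1) (map length xss)) + (j - 1) < sum_list (map length xss)"
    using sum_list_block_bound[of "i - 1" "map length xss" "j - 1"] i j by simp
  moreover have "concat xss ! (sum_list (take (i - 1) (map length xss)) + j - 1) = xss ! (i - 1) ! (j - 1)"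
    using nth_concat_block[OF i j] assms(2) by (simp add: take_map)
  ultimately show ?thesis using assms(2) unfolding lperm_def length_concat by auto
qed

lemma permutes_tree_leaves:
  "t \<in> ops (tree_operad S) \<Longrightarrow> lperm (leaves t) permutes {1..length (leaves t)}"
  unfolding mem_ops_tree using lperm_permutes[of "leaves t"] by blast

text \<open>\<open>t\<close> is its left-to-right numbered version followed by a single permutation,
  so \<open>act\<close> is applied just once, at the end.\<close>

lemma tree_operad_induct:
  assumes t: "t \<in> ops (tree_operad S)"
    and Leaf: "Leaf 1 \<in> Z" and corolla: "\<And>s m. (s, m) \<in> S \<Longrightarrow> corolla s m \<in> Z"
    and compose: "\<And>t qs. t \<in> Z \<Longrightarrow> set qs \<subseteq> Z \<Longrightarrow> composable (tree_operad S) t qs \<Longrightarrow>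
        compose (tree_operad S) t qs \<in> Z"
    and act: "\<And>t \<sigma>. t \<in> Z \<Longrightarrow> t \<in> ops (tree_operad S) \<Longrightarrow> \<sigma> permutes {1..arity (tree_operad S) t} \<Longrightarrow>
        act (tree_operad S) t \<sigma> \<in> Z"
  shows "t \<in> Z"
proof -
  have over: "over_sig S t" using t by (simp add: mem_ops_tree)
  obtain u where u: "u \<in> Z" "u \<in> ops (tree_operad S)" "leaves u = [1..<length (leaves t) + 1]"
    "t = relabel (\<lambda>i. leaves t ! (i - 1)) u"
    by (rule standardize[OF over Leaf corolla compose[unfolded tree_operad_simps]])
  have p: "lperm (leaves t) permutes {1..length (leaves u)}"
    using permutes_tree_leaves[OF t] u(3) by simp
  have "t = relabel (lperm (leaves t)) u"
    by (subst u(4)) (rule relabel_cong, simp add: u(3) lperm_def)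
  then have "t = act (tree_operad S) u (inv (lperm (leaves t)))"
    using permutes_inv_inv[OF p] by (simp add: tree_operad_simps)
  then show ?thesis
    using act[OF u(1,2), of "inv (lperm (leaves t))"] permutes_inv[OF p] by (simp add: tree_operad_simps)
qed


section \<open>The universal property of tree operads\<close>

text \<open>The value of a tree whose leaves are numbered from left to right. Ignoring the leaf
  names makes the recursion possible on subtrees; \<open>eval\<close> puts the names back by one
  permutation.\<close>

fun shape_value :: "'b operad \<Rightarrow> (('x, 'x tree) sym \<Rightarrow> nat \<Rightarrow> 'b) \<Rightarrow> 'x tree \<Rightarrow> 'b" where
  "shape_value O' \<iota> (Leaf i) = ident O'"
| "shape_value O' \<iota> (Node s ts) = compose O' (\<iota> s (length ts)) (map (shape_value O' \<iota>) ts)"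

text \<open>Trees are permuted by renaming with \<open>inv \<sigma>\<close>, so restoring the names
  of a tree numbered from left to right means acting with the inverse of
  \<open>lperm\<close>.\<close>

definition eval :: "'b operad \<Rightarrow> (('x, 'x tree) sym \<Rightarrow> nat \<Rightarrow> 'b) \<Rightarrow> 'x tree \<Rightarrow> 'b" where
  "eval O' \<iota> t = act O' (shape_value O' \<iota> t) (inv (lperm (leaves t)))"

lemma shape_value_relabel: "shape_value O' \<iota> (relabel h t) = shape_value O' \<iota> t"
proof (induction t rule: leaves.induct)
  case (2 s ts)
  then have "map (shape_value O' \<iota>) (map (relabel h) ts) = map (shape_value O' \<iota>) ts" by simp
  then show ?case by (simp add: relabel_def del: map_map)
qed (simp add: relabel_def)

context
  fixes O' :: "'b operad" and \<iota> :: "('x, 'x tree) sym \<Rightarrow> nat \<Rightarrow> 'b" and S :: "(('x, 'x tree) sym \<times> nat) set"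
  assumes O': "is_operad O'"
    and \<iota>: "\<And>s m. (s, m) \<in> S \<Longrightarrow> \<iota> s m \<in> ops O' \<and> arity O' (\<iota> s m) = m"
begin

lemma shape_value_ops:
  "over_sig S t \<Longrightarrow> shape_value O' \<iota> t \<in> ops O' \<and> arity O' (shape_value O' \<iota> t) = length (leaves t)"
proof (induction t rule: leaves.induct)
  case (1 i)
  then show ?case by (simp add: operad_ident[OF O'] operad_arity_ident[OF O'])
next
  case (2 s ts)
  have c: "composable O' (\<iota> s (length ts)) (map (shape_value O' \<iota>) ts)"
    using 2 \<iota>[of s "length ts"] by (auto simp: composable_def)
  have "map (arity O') (map (shape_value O' \<iota>) ts) = map (\<lambda>t. length (leaves t)) ts"
    using 2 by simp
  then show ?case
    using operad_compose[OF O' c] operad_arity_compose[OF O' c]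
    by (simp add: total_arity_def length_concat comp_def cong: map_cong)
qed

text \<open>The arguments are listed in planar order rather than by name, so that this is
  associativity at a vertex and the left unit law at a leaf.\<close>

lemma shape_value_graft:
  "over_sig S t \<Longrightarrow> (\<And>i. i \<in> set (leaves t) \<Longrightarrow> over_sig S (f i)) \<Longrightarrow>
   shape_value O' \<iota> (graft f t) = compose O' (shape_value O' \<iota> t) (map (\<lambda>i. shape_value O' \<iota> (f i)) (leaves t))"
proof (induction t rule: leaves.induct)
  case (1 i)
  then show ?case using operad_ident_left[OF O', of "shape_value O' \<iota> (f i)"] shape_value_ops by simp
next
  case (2 s ts)
  let ?E = "shape_value O' \<iota>" and ?rss = "map (\<lambda>t. map (\<lambda>i. shape_value O' \<iota> (f i)) (leaves t)) ts"
  have c: "composable O' (\<iota> s (length ts)) (map ?E ts)"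
    using 2(2) \<iota>[of s "length ts"] shape_value_ops by (auto simp: composable_def)
  have over: "over_sig S t" if "t \<in> set ts" for t using 2(2) that by simp
  have fov: "over_sig S (f k)" if "t \<in> set ts" "k \<in> set (leaves t)" for t k
    using 2(3)[of k] that by (simp, blast)
  have "composable O' (?E t) (map (\<lambda>i. ?E (f i)) (leaves t))" if "t \<in> set ts" for t
    using shape_value_ops[OF over[OF that]] shape_value_ops[OF fov[OF that]] by (auto simp: composable_def)
  then have l: "list_all2 (composable O') (map ?E ts) ?rss"
    by (simp add: list_all2_map1 list_all2_map2 list_all2_same)
  have "?E (graft f t) = compose O' (?E t) (map (\<lambda>i. ?E (f i)) (leaves t))" if "t \<in> set ts" for t
    using 2(1)[OF that over[OF that]] fov[OF that] by blast
  then have "map (?E \<circ> graft f) ts = map2 (compose O') (map ?E ts) ?rss"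
    by (intro nth_equalityI) auto
  then show ?case
    using operad_assoc[OF O' c l] by (simp add: map_concat comp_def)
qed

text \<open>Composites are the substance. The permutation that restores the names in a composite
  factors into a permutation of blocks, governed by the leaf names of \<open>t\<close>, and a direct
  sum of permutations, governed by the names inside the arguments; the two equivariance axioms deal
  with one factor each.\<close>

lemma eval_hom: "operad_hom (eval O' \<iota>) (tree_operad S) O'"
  unfolding operad_hom_def
proof (intro conjI ballI allI impI)
  show "eval O' \<iota> (ident (tree_operad S)) = ident O'"
    using lperm_upt[of 1] by (simp add: eval_def tree_operad_simps operad_act_id[OF O'] operad_ident[OF O'] upt_Suc)
next
  fix t assume t: "t \<in> ops (tree_operad S)"
  then have sv: "shape_value O' \<iota> t \<in> ops O'" "arity O' (shape_value O' \<iota> t) = length (leaves t)"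
    using shape_value_ops[of t] by (auto simp: mem_ops_tree)
  have ip: "inv (lperm (leaves t)) permutes {1..length (leaves t)}"
    using permutes_inv[OF permutes_tree_leaves[OF t]] .
  show "eval O' \<iota> t \<in> ops O'" "arity O' (eval O' \<iota> t) = arity (tree_operad S) t"
    using sv ip by (simp_all add: eval_def operad_act[OF O'] operad_arity_act[OF O'] tree_operad_simps)
  fix \<sigma> assume "\<sigma> permutes {1..arity (tree_operad S) t}"
  then have s: "\<sigma> permutes {1..length (leaves t)}" by (simp add: tree_operad_simps)
  have l: "lperm (map (inv \<sigma>) (leaves t)) = inv \<sigma> \<circ> lperm (leaves t)"
    using permutes_not_in[OF permutes_inv[OF s]] by (auto simp: lperm_def fun_eq_iff)
  have "inv (inv \<sigma> \<circ> lperm (leaves t)) = inv (lperm (leaves t)) \<circ> \<sigma>"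
    using o_inv_distrib[OF permutes_bij[OF permutes_inv[OF s]] permutes_bij[OF permutes_tree_leaves[OF t]]]
      permutes_inv_inv[OF s] by simp
  then show "eval O' \<iota> (act (tree_operad S) t \<sigma>) = act O' (eval O' \<iota> t) \<sigma>"
    using operad_act_comp[OF O' sv(1), of "inv (lperm (leaves t))" \<sigma>] ip s sv(2) l
    by (simp add: eval_def tree_operad_simps leaves_relabel shape_value_relabel)
next
  fix t qs assume c: "composable (tree_operad S) t qs"
  then have t: "t \<in> ops (tree_operad S)" and len: "length qs = length (leaves t)"
    by (auto simp: composable_tree)
  let ?n = "length qs" and ?xs = "leaves t" and ?E = "shape_value O' \<iota>"
  have q: "qs ! (i - 1) \<in> ops (tree_operad S)" if "i \<in> {1..?n}" for i
  proof -
    have "qs ! (i - 1) \<in> set qs" using that by (intro nth_mem) auto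
    then show ?thesis using c unfolding composable_tree by blast
  qed
  have xs: "?xs ! (i - 1) \<in> {1..?n}" if "i \<in> {1..?n}" for i
  proof -
    have "?xs ! (i - 1) \<in> set ?xs" using that len by (intro nth_mem) auto
    then show ?thesis using t len by (simp add: mem_ops_tree)
  qed
  let ?q = "\<lambda>i. qs ! (?xs ! (i - 1) - 1)"
  define p where "p = ?E t"
  define off where "off i = (\<Sum>q\<leftarrow>take (i - 1) qs. length (leaves q))" for i
  define ns where "ns = map (\<lambda>i. length (leaves (?q i))) [1..<?n + 1]"
  define R where "R = map (\<lambda>i. ?E (?q i)) [1..<?n + 1]"
  \<comment> \<open>The \<open>i\<close>-th block belongs to the \<open>i\<close>-th leaf of
    \<open>t\<close> in planar order, hence to the argument whose number is the name of this leaf.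
    \<open>A\<close> moves blocks to their place by name, \<open>B\<close> renames inside blocks
    that stay in planar order, and \<open>C\<close> lists the leaves of the composite.\<close>
  define A where "A = map (\<lambda>i. map ((+) (off (?xs ! (i - 1)))) [1..<length (leaves (?q i)) + 1]) [1..<?n + 1]"
  define B where "B = map (\<lambda>i. map ((+) (sum_list (take (i - 1) ns))) (leaves (?q i))) [1..<?n + 1]"
  define C where "C = map (\<lambda>i. map ((+) (off (?xs ! (i - 1)))) (leaves (?q i))) [1..<?n + 1]"
  have lenA: "map length A = ns" and lenB: "map length B = ns" and lenC: "map length C = ns"
    by (simp_all add: A_def B_def C_def ns_def)
  have len3: "length A = ?n" "length B = ?n" "length C = ?n" by (simp_all add: A_def B_def C_def)
  have nthA: "A ! (i - 1) = map ((+) (off (?xs ! (i - 1)))) [1..<length (leaves (?q i)) + 1]"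
    and nthB: "B ! (i - 1) = map ((+) (sum_list (take (i - 1) ns))) (leaves (?q i))"
    and nthC: "C ! (i - 1) = map ((+) (off (?xs ! (i - 1)))) (leaves (?q i))"
    if "i \<in> {1..?n}" for i
    unfolding A_def B_def C_def by (rule nth_map_upt_one[OF that])+
  have xs_eq: "map (\<lambda>i. ?xs ! (i - 1)) [1..<?n + 1] = ?xs"
    by (intro nth_equalityI) (auto simp: nth_map_upt len)
  have leavesC: "leaves (graft (shifted qs) t) = concat C"
  proof -
    have "map (\<lambda>x. leaves (shifted qs x)) (map (\<lambda>i. ?xs ! (i - 1)) [1..<?n + 1]) = C"
      by (simp add: C_def leaves_shifted off_def)
    then show ?thesis unfolding leaves_graft xs_eq by simp
  qed
  have u: "graft (shifted qs) t \<in> ops (tree_operad S)"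
    and total: "length (concat C) = (\<Sum>q\<leftarrow>qs. length (leaves q))"
    using graft_shifted_ops[OF c] leavesC by simp_all
  have totalns: "sum_list ns = (\<Sum>q\<leftarrow>qs. length (leaves q))"
    using total lenC by (simp add: length_concat)
  let ?N = "sum_list ns"
  have pC: "lperm (concat C) permutes {1..?N}"
    using permutes_tree_leaves[OF u] leavesC total totalns by simp
  have setxs: "mset ?xs = mset [1..<?n + 1]" using t len by (simp add: mem_ops_tree_mset)
  have mA: "mset (concat A) = mset [1..<?N + 1]"
  proof -
    have "A = map (\<lambda>x. map ((+) (off x)) [1..<length (leaves (qs ! (x - 1))) + 1]) (map (\<lambda>i. ?xs ! (i - 1)) [1..<?n + 1])"
      by (simp add: A_def)
    then have "mset (concat A) = mset (concat (map (\<lambda>x. map ((+) (off x)) [1..<length (leaves (qs ! (x - 1))) + 1]) ?xs))"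
      unfolding xs_eq by simp
    also have "\<dots> = mset (concat (map (\<lambda>x. map ((+) (off x)) [1..<length (leaves (qs ! (x - 1))) + 1]) [1..<?n + 1]))"
      using setxs by (rule mset_concat_map_cong) simp
    also have "\<dots> = mset [1..<?N + 1]" unfolding off_def concat_blocks_upt' totalns ..
    finally show ?thesis .
  qed
  have mB: "mset (concat B) = mset [1..<?N + 1]"
  proof -
    have "mset (concat B) = mset (concat (map (\<lambda>i. map ((+) (sum_list (take (i - 1) ns))) [1..<length (leaves (?q i)) + 1]) [1..<?n + 1]))"
      unfolding B_def
    proof (rule mset_concat_map_cong)
      fix i assume "i \<in> set [1..<?n + 1]"
      then have "?q i \<in> ops (tree_operad S)" by (intro q xs) auto
      then have "mset (leaves (?q i)) = mset [1..<length (leaves (?q i)) + 1]"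
        unfolding mem_ops_tree_mset by blast
      then show "mset (map ((+) (sum_list (take (i - 1) ns))) (leaves (?q i)))
        = mset (map ((+) (sum_list (take (i - 1) ns))) [1..<length (leaves (?q i)) + 1])"
        unfolding mset_map by simp
    qed simp
    also have "concat (map (\<lambda>i. map ((+) (sum_list (take (i - 1) ns))) [1..<length (leaves (?q i)) + 1]) [1..<?n + 1])
      = concat (map (\<lambda>i. map (\<lambda>j. sum_list (take i ns) + j) [1..<ns ! i + 1]) [0..<length ns])"
    proof -
      have "[1..<?n + 1] = map Suc [0..<length ns]" by (simp add: map_Suc_upt ns_def)
      then show ?thesis
        by (simp only: map_map) (intro arg_cong[where f = concat] map_cong, auto simp: ns_def nth_map_upt)
    qed
    also have "\<dots> = [1..<?N + 1]" by (rule concat_blocks_upt)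
    finally show ?thesis .
  qed
  have perm: "lperm xs permutes {1..?N}" if "mset xs = mset [1..<?N + 1]" for xs
  proof -
    have l: "length xs = ?N" using mset_eq_length[OF that] by simp
    then have "distinct xs \<and> set xs = {1..length xs}" using mset_interval_iff[of xs] that by simp
    then show ?thesis using lperm_permutes[of xs] l by simp
  qed
  note pA = perm[OF mA] and pB = perm[OF mB]
  have block: "lperm (concat A) (sum_list (take (i - 1) ns) + j) = off (?xs ! (i - 1)) + j"
    "lperm (concat B) (sum_list (take (i - 1) ns) + j) = sum_list (take (i - 1) ns) + leaves (?q i) ! (j - 1)"
    "lperm (concat C) (sum_list (take (i - 1) ns) + j) = off (?xs ! (i - 1)) + leaves (?q i) ! (j - 1)"
    if "i \<in> {1..?n}" "j \<in> {1..length (leaves (?q i))}" for i j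
  proof -
    note i = that(1) and j = that(2)
    have j1: "j - 1 < length (leaves (?q i))" using j by auto
    have "j \<in> {1..length (A ! (i - 1))}" "j \<in> {1..length (B ! (i - 1))}" "j \<in> {1..length (C ! (i - 1))}"
      unfolding nthA[OF i] nthB[OF i] nthC[OF i] using j by simp_all
    then show "lperm (concat A) (sum_list (take (i - 1) ns) + j) = off (?xs ! (i - 1)) + j"
      "lperm (concat B) (sum_list (take (i - 1) ns) + j) = sum_list (take (i - 1) ns) + leaves (?q i) ! (j - 1)"
      "lperm (concat C) (sum_list (take (i - 1) ns) + j) = off (?xs ! (i - 1)) + leaves (?q i) ! (j - 1)"
      using lperm_concat_block[of i A j] lperm_concat_block[of i B j] lperm_concat_block[of i C j] i
      unfolding lenA lenB lenC len3 nthA[OF i] nthB[OF i] nthC[OF i] nth_map[OF j1] nth_map_upt_one[OF j]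
      by blast+
  qed
  \<comment> \<open>First the names within each block are restored, then the blocks are
    moved.\<close>
  have comp: "lperm (concat C) = lperm (concat A) \<circ> lperm (concat B)"
  proof
    fix x
    show "lperm (concat C) x = (lperm (concat A) \<circ> lperm (concat B)) x"
    proof (cases "x \<in> {1..?N}")
      case False
      then show ?thesis using permutes_not_in[OF pA] permutes_not_in[OF pB] permutes_not_in[OF pC] by simp
    next
      case True
      then have "x - 1 < sum_list ns" by auto
      then obtain i j where ij: "i < length ns" "j < ns ! i" "x - 1 = sum_list (take i ns) + j"
        by (rule sum_list_block_exists)
      have i: "Suc i \<in> {1..?n}" using ij(1) by (simp add: ns_def)
      have j: "Suc j \<in> {1..length (leaves (?q (Suc i)))}" using ij(1,2) by (simp add: ns_def nth_map_upt)
      have x: "x = sum_list (take (Suc i - 1) ns) + Suc j" using ij(3) True by simp linarith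
      have "leaves (?q (Suc i)) ! (Suc j - 1) \<in> set (leaves (?q (Suc i)))" using j by (intro nth_mem) simp
      then have j': "leaves (?q (Suc i)) ! (Suc j - 1) \<in> {1..length (leaves (?q (Suc i)))}"
        using q[OF xs[OF i]] by (simp add: mem_ops_tree)
      show ?thesis
        unfolding x comp_def block(3)[OF i j] block(2)[OF i j] block(1)[OF i j'] ..
    qed
  qed
  let ?Q = "map (eval O' \<iota>) qs"
  \<comment> \<open>\<open>eval\<close> acts with this \<open>\<sigma>\<close> on the shape value of
    \<open>t\<close>; the list \<open>Q'\<close> that the outer axiom then calls for has the
    arguments in planar order.\<close>
  define \<sigma> where "\<sigma> = inv (lperm ?xs)"
  define Q' where "Q' = map (\<lambda>i. ?Q ! (inv \<sigma> i - 1)) [1..<?n + 1]"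
  define \<tau> where "\<tau> i = inv (lperm (leaves (?q i)))" for i
  have pxs: "lperm ?xs permutes {1..?n}" using permutes_tree_leaves[OF t] len by simp
  have \<sigma>: "\<sigma> permutes {1..?n}" "inv \<sigma> = lperm ?xs"
    unfolding \<sigma>_def using permutes_inv[OF pxs] permutes_inv_inv[OF pxs] by auto
  have over: "over_sig S t" using t by (simp add: mem_ops_tree)
  have Eq: "?E (qs ! (i - 1)) \<in> ops O'" "arity O' (?E (qs ! (i - 1))) = length (leaves (qs ! (i - 1)))"
    and pq: "lperm (leaves (qs ! (i - 1))) permutes {1..length (leaves (qs ! (i - 1)))}"
    if "i \<in> {1..?n}" for i
    using shape_value_ops q[OF that] permutes_tree_leaves[OF q[OF that]] by (auto simp: mem_ops_tree)
  have evq: "eval O' \<iota> (qs ! (i - 1)) \<in> ops O'" "arity O' (eval O' \<iota> (qs ! (i - 1))) = length (leaves (qs ! (i - 1)))"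
    if "i \<in> {1..?n}" for i
    using Eq[OF that] permutes_inv[OF pq[OF that]]
    by (simp_all add: eval_def operad_act[OF O'] operad_arity_act[OF O'])
  have p: "p \<in> ops O'" "arity O' p = ?n" using shape_value_ops[OF over] len by (simp_all add: p_def)
  have setQ: "set ?Q \<subseteq> ops O'"
  proof
    fix y assume "y \<in> set ?Q"
    then obtain i where "i < ?n" "y = eval O' \<iota> (qs ! i)" by (auto simp: in_set_conv_nth)
    then show "y \<in> ops O'" using evq(1)[of "Suc i"] by simp
  qed
  have cQ: "composable O' p ?Q" using p setQ by (simp add: composable_def)
  have nsR: "map (arity O') R = ns"
    using Eq(2) xs by (auto simp: R_def ns_def)
  have Q'R: "Q' = map (\<lambda>i. act O' (R ! (i - 1)) (\<tau> i)) [1..<arity O' p + 1]"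
    unfolding p(2) Q'_def
  proof (rule map_cong[OF refl])
    fix i assume "i \<in> set [1..<?n + 1]"
    then have i: "i \<in> {1..?n}" by auto
    have "inv \<sigma> i = ?xs ! (i - 1)" using i len by (simp add: \<sigma>(2) lperm_def)
    then have "?Q ! (inv \<sigma> i - 1) = eval O' \<iota> (?q i)" using xs[OF i] by (auto simp: nth_map)
    moreover have "R ! (i - 1) = ?E (?q i)" unfolding R_def by (rule nth_map_upt_one[OF i])
    ultimately show "?Q ! (inv \<sigma> i - 1) = act O' (R ! (i - 1)) (\<tau> i)" by (simp add: eval_def \<tau>_def)
  qed
  have setR: "set R \<subseteq> ops O'" using Eq(1) xs by (auto simp: R_def)
  have cR: "composable O' p R" using setR p by (simp add: composable_def R_def)
  have nthR: "R ! (i - 1) = ?E (?q i)" if "i \<in> {1..?n}" for i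
    unfolding R_def by (rule nth_map_upt_one[OF that])
  have arR: "arity O' (R ! (i - 1)) = length (leaves (?q i))" if "i \<in> {1..?n}" for i
    using nthR[OF that] Eq(2)[OF xs[OF that]] by simp
  have \<tau>p: "\<tau> i permutes {1..length (leaves (?q i))}" if "i \<in> {1..?n}" for i
    unfolding \<tau>_def using permutes_inv[OF pq[OF xs[OF that]]] .
  have offR: "offset O' R i = sum_list (take (i - 1) ns)" for i
    by (simp add: offset_def total_arity_def nsR[symmetric] take_map)
  have totR: "total_arity O' R = ?N" by (simp add: total_arity_def nsR)
  have inner: "compose O' p Q' = act O' (compose O' p R) (inv (lperm (concat B)))"
    unfolding Q'R
  proof (rule operad_equivariant_inner[OF O' cR])
    show "inv (lperm (concat B)) permutes {1..total_arity O' R}"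
      unfolding totR by (rule permutes_inv[OF pB])
    fix i assume "i \<in> {1..arity O' p}"
    then have i: "i \<in> {1..?n}" using p by simp
    show "\<tau> i permutes {1..arity O' (R ! (i - 1))}" unfolding arR[OF i] by (rule \<tau>p[OF i])
    fix j assume "j \<in> {1..arity O' (R ! (i - 1))}"
    then have j: "j \<in> {1..length (leaves (?q i))}" using arR[OF i] by simp
    then have j': "\<tau> i j \<in> {1..length (leaves (?q i))}" using permutes_in_image[OF \<tau>p[OF i]] by blast
    have "leaves (?q i) ! (\<tau> i j - 1) = lperm (leaves (?q i)) (\<tau> i j)" using j' by (simp add: lperm_def)
    also have "\<dots> = j" unfolding \<tau>_def using permutes_inverses(1)[OF pq[OF xs[OF i]]] .
    finally have "lperm (concat B) (sum_list (take (i - 1) ns) + \<tau> i j) = sum_list (take (i - 1) ns) + j"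
      using block(2)[OF i j'] by simp
    then show "inv (lperm (concat B)) (offset O' R i + j) = offset O' R i + \<tau> i j"
      unfolding offR using permutes_inverses(2)[OF pB] by metis
  qed
  have arQ: "map (arity O') ?Q = map (\<lambda>q. length (leaves q)) qs"
    using evq(2)[of "Suc _"] by (intro nth_equalityI) auto
  then have offQ: "offset O' ?Q i = off i" for i
    unfolding offset_def total_arity_def off_def by (metis take_map)
  have totQ: "total_arity O' ?Q = ?N" unfolding total_arity_def totalns arQ ..
  have nsQ': "map (arity O') Q' = ns"
  proof -
    have "arity O' (act O' (R ! (i - 1)) (\<tau> i)) = length (leaves (?q i))" if "i \<in> {1..?n}" for i
      using operad_arity_act[OF O', of "R ! (i - 1)" "\<tau> i"] nthR[OF that] Eq(1)[OF xs[OF that]] arR[OF that] \<tau>p[OF that]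
      by simp
    then show ?thesis by (auto simp: Q'R ns_def p(2))
  qed
  have outer: "compose O' (act O' p \<sigma>) ?Q = act O' (compose O' p Q') (inv (lperm (concat A)))"
  proof (rule operad_equivariant_outer[OF O' cQ])
    show "\<sigma> permutes {1..arity O' p}" using \<sigma> p by simp
    show "Q' = map (\<lambda>i. ?Q ! (inv \<sigma> i - 1)) [1..<arity O' p + 1]" by (simp add: Q'_def p(2))
    show "inv (lperm (concat A)) permutes {1..total_arity O' ?Q}" unfolding totQ by (rule permutes_inv[OF pA])
    fix i j assume "i \<in> {1..arity O' p}" and j: "j \<in> {1..arity O' (?Q ! (i - 1))}"
    then have i: "i \<in> {1..?n}" using p by simp
    then have i': "\<sigma> i \<in> {1..?n}" using permutes_in_image[OF \<sigma>(1)] by blast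
    have "?xs ! (\<sigma> i - 1) = lperm ?xs (\<sigma> i)" using i' len by (simp add: lperm_def)
    also have "\<dots> = i" unfolding \<sigma>_def using permutes_inverses(1)[OF pxs] .
    finally have xi: "?xs ! (\<sigma> i - 1) = i" .
    have "?Q ! (i - 1) = eval O' \<iota> (qs ! (i - 1))" using i by auto
    then have "j \<in> {1..length (leaves (?q (\<sigma> i)))}" using j evq(2)[OF i] xi by simp
    then have "lperm (concat A) (sum_list (take (\<sigma> i - 1) ns) + j) = off i + j"
      using block(1)[OF i'] xi by simp
    moreover have "offset O' Q' (\<sigma> i) = sum_list (take (\<sigma> i - 1) ns)"
      by (simp add: offset_def total_arity_def nsQ'[symmetric] take_map)
    ultimately show "inv (lperm (concat A)) (offset O' ?Q i + j) = offset O' Q' (\<sigma> i) + j"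
      unfolding offQ using permutes_inverses(2)[OF pA] by metis
  qed
  have E: "?E (graft (shifted qs) t) = compose O' p R"
  proof -
    have "over_sig S (shifted qs x)" if "x \<in> set ?xs" for x
      using q[of x] that t len by (simp add: mem_ops_tree shifted_def over_sig_relabel)
    then have "?E (graft (shifted qs) t) = compose O' p (map (\<lambda>x. ?E (qs ! (x - 1))) ?xs)"
      using shape_value_graft[OF over] by (simp add: p_def shifted_def shape_value_relabel)
    also have "map (\<lambda>x. ?E (qs ! (x - 1))) ?xs = R"
    proof -
      have "map (\<lambda>x. ?E (qs ! (x - 1))) (map (\<lambda>i. ?xs ! (i - 1)) [1..<?n + 1]) = R" by (simp add: R_def)
      then show ?thesis unfolding xs_eq .
    qed
    finally show ?thesis .
  qed
  have "inv (lperm (concat C)) = inv (lperm (concat B)) \<circ> inv (lperm (concat A))"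
    unfolding comp by (rule o_inv_distrib[OF permutes_bij[OF pA] permutes_bij[OF pB]])
  then have "eval O' \<iota> (graft (shifted qs) t) = act O' (act O' (compose O' p R) (inv (lperm (concat B)))) (inv (lperm (concat A)))"
    unfolding eval_def E leavesC
    using operad_act_comp[OF O' operad_compose[OF O' cR], of "inv (lperm (concat B))" "inv (lperm (concat A))"]
      permutes_inv[OF pA] permutes_inv[OF pB] operad_arity_compose[OF O' cR] totR by simp
  also have "\<dots> = compose O' (eval O' \<iota> t) ?Q"
    unfolding inner[symmetric] outer[symmetric] by (simp add: eval_def p_def \<sigma>_def)
  finally show "eval O' \<iota> (compose (tree_operad S) t qs) = compose O' (eval O' \<iota> t) (map (eval O' \<iota>) qs)"
    by (simp add: tree_operad_simps)
qed

lemma eval_corolla: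
  assumes "(s, m) \<in> S"
  shows "eval O' \<iota> (corolla s m) = \<iota> s m"
proof -
  have "map (shape_value O' \<iota>) (map Leaf [1..<m + 1]) = replicate m (ident O')"
    by (rule nth_equalityI) auto
  then have "shape_value O' \<iota> (corolla s m) = \<iota> s m"
    using operad_ident_right[OF O', of "\<iota> s m"] \<iota>[OF assms] by (simp add: corolla_def del: map_map)
  then show ?thesis
    using \<iota>[OF assms] lperm_upt[of m] by (simp add: eval_def leaves_corolla operad_act_id[OF O'] del: upt_Suc)
qed

end

lemma hom_tree_unique:
  assumes "operad_hom f (tree_operad S) O'" "operad_hom g (tree_operad S) O'"
    and "\<And>s m. (s, m) \<in> S \<Longrightarrow> f (corolla s m) = g (corolla s m)"
    and "t \<in> ops (tree_operad S)"
  shows "f t = g t"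
proof -
  have "t \<in> {t. f t = g t}"
    using assms(4)
  proof (rule tree_operad_induct)
    show "Leaf 1 \<in> {t. f t = g t}"
      using hom_ident[OF assms(1)] hom_ident[OF assms(2)] by (simp add: tree_operad_simps)
  next
    fix t qs assume *: "t \<in> {t. f t = g t}" "set qs \<subseteq> {t. f t = g t}" "composable (tree_operad S) t qs"
    then have "map f qs = map g qs" by auto
    then show "compose (tree_operad S) t qs \<in> {t. f t = g t}"
      using *(1) hom_compose[OF assms(1) *(3)] hom_compose[OF assms(2) *(3)] by (simp del: map_eq_conv)
  next
    fix t \<sigma> assume "t \<in> {t. f t = g t}" "t \<in> ops (tree_operad S)" "\<sigma> permutes {1..arity (tree_operad S) t}"
    then show "act (tree_operad S) t \<sigma> \<in> {t. f t = g t}"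
      using hom_act[OF assms(1)] hom_act[OF assms(2)] by simp
  qed (use assms(3) in simp)
  then show ?thesis by simp
qed


section \<open>Suboperads\<close>

text \<open>\<open>Z\<close> may be any set, not only one of operations of \<open>P\<close>. That
  \<open>P\<close> is generated by some elements is expressed by \<open>ops P \<subseteq> Z\<close>
  for every such \<open>Z\<close> containing them.\<close>

definition suboperad :: "'a set \<Rightarrow> 'a operad \<Rightarrow> bool" where
  "suboperad Z P \<longleftrightarrow> ident P \<in> Z \<and>
     (\<forall>p qs. p \<in> Z \<and> set qs \<subseteq> Z \<and> composable P p qs \<longrightarrow> compose P p qs \<in> Z) \<and>
     (\<forall>p \<sigma>. p \<in> Z \<and> p \<in> ops P \<and> \<sigma> permutes {1..arity P p} \<longrightarrow> act P p \<sigma> \<in> Z)"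

lemma hom_tree_suboperad:
  assumes h: "operad_hom h (tree_operad S) P" and Z: "suboperad Z P"
    and gen: "\<And>s m. (s, m) \<in> S \<Longrightarrow> h (corolla s m) \<in> Z"
    and t: "t \<in> ops (tree_operad S)"
  shows "h t \<in> Z"
proof -
  have "t \<in> {t. h t \<in> Z}"
    using t
  proof (rule tree_operad_induct)
    show "Leaf 1 \<in> {t. h t \<in> Z}"
      using hom_ident[OF h] Z by (simp add: tree_operad_simps suboperad_def)
  next
    fix t qs assume *: "t \<in> {t. h t \<in> Z}" "set qs \<subseteq> {t. h t \<in> Z}" "composable (tree_operad S) t qs"
    then have "set (map h qs) \<subseteq> Z" by auto
    then have "compose P (h t) (map h qs) \<in> Z"
      using Z *(1) hom_composable[OF h *(3)] unfolding suboperad_def by blast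
    then show "compose (tree_operad S) t qs \<in> {t. h t \<in> Z}"
      using hom_compose[OF h *(3)] by simp
  next
    fix t \<sigma> assume *: "t \<in> {t. h t \<in> Z}" "t \<in> ops (tree_operad S)" "\<sigma> permutes {1..arity (tree_operad S) t}"
    then have "act P (h t) \<sigma> \<in> Z"
      using Z hom_ops[OF h *(2)] hom_arity[OF h *(2)] unfolding suboperad_def by simp
    then show "act (tree_operad S) t \<sigma> \<in> {t. h t \<in> Z}" using hom_act[OF h *(2,3)] by simp
  qed (use gen in simp)
  then show ?thesis by simp
qed

text \<open>With this, a map is shown to be onto by checking generators.\<close>

lemma hom_image_suboperad:
  assumes h: "operad_hom h P Q" and P: "is_operad P"
  shows "suboperad (h ` ops P) Q"
  unfolding suboperad_def
proof (intro conjI allI impI; (elim conjE)?)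
  show "ident Q \<in> h ` ops P" using hom_ident[OF h] operad_ident[OF P] by (metis imageI)
next
  fix p' qs' assume *: "p' \<in> h ` ops P" "set qs' \<subseteq> h ` ops P" "composable Q p' qs'"
  obtain p where p: "p \<in> ops P" "h p = p'" using *(1) by blast
  obtain qs where qs: "set qs \<subseteq> ops P" "map h qs = qs'" using list_lift[OF *(2)] by blast
  have c: "composable P p qs" using * p qs hom_arity[OF h p(1)] by (auto simp: composable_def)
  show "compose Q p' qs' \<in> h ` ops P"
    using hom_compose[OF h c] operad_compose[OF P c] p(2) qs(2) by (metis imageI)
next
  fix p' \<sigma> assume *: "p' \<in> h ` ops P" "\<sigma> permutes {1..arity Q p'}"
  obtain p where p: "p \<in> ops P" "h p = p'" using *(1) by blast
  have s: "\<sigma> permutes {1..arity P p}" using *(2) hom_arity[OF h p(1)] p(2) by simp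
  show "act Q p' \<sigma> \<in> h ` ops P"
    using hom_act[OF h p(1) s] operad_act[OF P p(1) s] p(2) by (metis imageI)
qed

lemma suboperad_hom_vimage:
  assumes h: "operad_hom h P Q" and Z: "suboperad Z Q" and P: "is_operad P"
  shows "suboperad {p \<in> ops P. h p \<in> Z} P"
  unfolding suboperad_def
proof (intro conjI allI impI; (elim conjE)?)
  show "ident P \<in> {p \<in> ops P. h p \<in> Z}"
    using hom_ident[OF h] operad_ident[OF P] Z by (simp add: suboperad_def)
next
  fix p qs assume *: "p \<in> {p \<in> ops P. h p \<in> Z}" "set qs \<subseteq> {p \<in> ops P. h p \<in> Z}" and c: "composable P p qs"
  then have "set (map h qs) \<subseteq> Z" by auto
  then have "compose Q (h p) (map h qs) \<in> Z"
    using Z * hom_composable[OF h c] unfolding suboperad_def by blast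
  then show "compose P p qs \<in> {p \<in> ops P. h p \<in> Z}"
    using hom_compose[OF h c] operad_compose[OF P c] by simp
next
  fix p \<sigma> assume *: "p \<in> {p \<in> ops P. h p \<in> Z}" "\<sigma> permutes {1..arity P p}"
  then have p: "p \<in> ops P" by simp
  then have "act Q (h p) \<sigma> \<in> Z"
    using Z * hom_ops[OF h p] hom_arity[OF h p] unfolding suboperad_def by simp
  then show "act P p \<sigma> \<in> {p \<in> ops P. h p \<in> Z}"
    using hom_act[OF h p *(2)] operad_act[OF P p *(2)] by simp
qed


section \<open>Coproducts\<close>

text \<open>Each homomorphism law is one of the three families of \<open>embed_rels\<close>; what
  remains is that both sides are operations of equal arity, as \<open>ideal_base\<close>
  demands.\<close>

lemma embed_hom:
  assumes P: "is_operad P" and T: "is_operad (tree_operad S)"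
    and sig: "\<And>p. p \<in> ops P \<Longrightarrow> (\<iota> p, arity P p) \<in> S"
    and R: "embed_rels (tree_operad S) \<iota> P \<subseteq> R"
  shows "operad_hom (\<lambda>p. rep (tree_operad S) R (corolla (\<iota> p) (arity P p))) P
    (quotient_operad (tree_operad S) R)"
proof -
  let ?T = "tree_operad S" and ?e = "\<lambda>p. corolla (\<iota> p) (arity P p)"
  note r = rep_hom[OF T, of R]
  have e: "?e p \<in> ops ?T" if "p \<in> ops P" for p using corolla_ops[OF sig[OF that]] .
  have ar: "arity ?T (?e p) = arity P p" for p by (simp add: tree_operad_simps leaves_corolla)
  show ?thesis
    unfolding operad_hom_def
  proof (intro conjI ballI allI impI)
    have "rep ?T R (?e (ident P)) = rep ?T R (ident ?T)"
    proof (rule rep_relation)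
      show "(?e (ident P), ident ?T) \<in> R" using R unfolding embed_rels_def Let_def by blast
      show "?e (ident P) \<in> ops ?T" by (rule e[OF operad_ident[OF P]])
      show "ident ?T \<in> ops ?T" by (rule operad_ident[OF T])
      show "arity ?T (?e (ident P)) = arity ?T (ident ?T)"
        by (simp add: tree_operad_simps leaves_corolla operad_arity_ident[OF P])
    qed
    then show "rep ?T R (?e (ident P)) = ident (quotient_operad ?T R)" using hom_ident[OF r] by simp
  next
    fix p assume p: "p \<in> ops P"
    show "rep ?T R (?e p) \<in> ops (quotient_operad ?T R)" using hom_ops[OF r e[OF p]] .
    show "arity (quotient_operad ?T R) (rep ?T R (?e p)) = arity P p" using hom_arity[OF r e[OF p]] ar by simp
    fix \<sigma> assume s: "\<sigma> permutes {1..arity P p}"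
    have s': "\<sigma> permutes {1..arity ?T (?e p)}" using s ar by simp
    have "rep ?T R (?e (act P p \<sigma>)) = rep ?T R (act ?T (?e p) \<sigma>)"
    proof (rule rep_relation)
      show "(?e (act P p \<sigma>), act ?T (?e p) \<sigma>) \<in> R"
        using R p s unfolding embed_rels_def Let_def by blast
      show "?e (act P p \<sigma>) \<in> ops ?T" by (rule e[OF operad_act[OF P p s]])
      show "act ?T (?e p) \<sigma> \<in> ops ?T" by (rule operad_act[OF T e[OF p] s'])
      show "arity ?T (?e (act P p \<sigma>)) = arity ?T (act ?T (?e p) \<sigma>)"
        by (simp only: operad_arity_act[OF T e[OF p] s']) (simp add: tree_operad_simps leaves_corolla operad_arity_act[OF P p s])
    qed
    then show "rep ?T R (?e (act P p \<sigma>)) = act (quotient_operad ?T R) (rep ?T R (?e p)) \<sigma>"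
      using hom_act[OF r e[OF p] s'] by simp
  next
    fix p qs assume c: "composable P p qs"
    have c': "composable ?T (?e p) (map ?e qs)"
      using c e by (auto simp: composable_def ar)
    have "rep ?T R (?e (compose P p qs)) = rep ?T R (compose ?T (?e p) (map ?e qs))"
    proof (rule rep_relation)
      show "(?e (compose P p qs), compose ?T (?e p) (map ?e qs)) \<in> R"
        using R c unfolding embed_rels_def Let_def by blast
      show "?e (compose P p qs) \<in> ops ?T" by (rule e[OF operad_compose[OF P c]])
      show "compose ?T (?e p) (map ?e qs) \<in> ops ?T" by (rule operad_compose[OF T c'])
      show "arity ?T (?e (compose P p qs)) = arity ?T (compose ?T (?e p) (map ?e qs))"
        unfolding operad_arity_compose[OF T c']
        by (simp add: total_arity_def tree_operad_simps leaves_corolla comp_def operad_arity_compose[OF P c])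
    qed
    then show "rep ?T R (?e (compose P p qs))
        = compose (quotient_operad ?T R) (rep ?T R (?e p)) (map (\<lambda>p. rep ?T R (?e p)) qs)"
      using hom_compose[OF r c'] by (simp add: comp_def)
  qed
qed

lemma embed_rels_respected:
  assumes P: "is_operad P" and sig: "\<And>p. p \<in> ops P \<Longrightarrow> (\<iota> p, arity P p) \<in> S"
    and h: "operad_hom h (tree_operad S) Q" and f: "operad_hom f P Q"
    and hf: "\<And>p. p \<in> ops P \<Longrightarrow> h (corolla (\<iota> p) (arity P p)) = f p"
    and R: "(a, b) \<in> embed_rels (tree_operad S) \<iota> P"
  shows "h a = h b"
proof -
  let ?T = "tree_operad S" and ?e = "\<lambda>p. corolla (\<iota> p) (arity P p)"
  have e: "?e p \<in> ops ?T" if "p \<in> ops P" for p using corolla_ops[OF sig[OF that]] .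
  have ar: "arity ?T (?e p) = arity P p" for p by (simp add: tree_operad_simps leaves_corolla)
  consider "a = ?e (ident P)" "b = ident ?T"
    | p \<sigma> where "p \<in> ops P" "\<sigma> permutes {1..arity P p}" "a = ?e (act P p \<sigma>)" "b = act ?T (?e p) \<sigma>"
    | p qs where "composable P p qs" "a = ?e (compose P p qs)" "b = compose ?T (?e p) (map ?e qs)"
    using R unfolding embed_rels_def Let_def by blast
  then show ?thesis
  proof cases
    case 1
    then show ?thesis using hf[OF operad_ident[OF P]] hom_ident[OF f] hom_ident[OF h] by simp
  next
    case 2
    have "\<sigma> permutes {1..arity ?T (?e p)}" using 2 ar by simp
    then have "h b = act Q (f p) \<sigma>" using hom_act[OF h e[OF 2(1)]] hf[OF 2(1)] 2(4) by simp
    moreover have "h a = act Q (f p) \<sigma>"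
      using hf[OF operad_act[OF P 2(1,2)]] hom_act[OF f 2(1,2)] 2(3) by simp
    ultimately show ?thesis by simp
  next
    case 3
    have sub: "set qs \<subseteq> ops P" "p \<in> ops P" using 3(1) by (auto simp: composable_def)
    have c': "composable ?T (?e p) (map ?e qs)" using 3(1) e by (auto simp: composable_def ar)
    have "map h (map ?e qs) = map f qs" using sub(1) hf by auto
    then have "h b = compose Q (f p) (map f qs)" using hom_compose[OF h c'] hf[OF sub(2)] 3(3) by (simp del: map_map)
    moreover have "h a = compose Q (f p) (map f qs)"
      using hf[OF operad_compose[OF P 3(1)]] hom_compose[OF f 3(1)] 3(2) by simp
    ultimately show ?thesis by simp
  qed
qed

section \<open>The exchange of rows and columns and the interchange relation\<close>

lemma exchange_perm_apply:
  assumes "i < k" "j < l"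
  shows "exchange_perm k l (i * l + j + 1) = j * k + i + 1"
proof -
  have "Suc i * l \<le> k * l" using assms by (intro mult_le_mono1) simp
  then have "i * l + j + 1 \<le> k * l" using assms by simp
  then show ?thesis using assms by (simp add: exchange_perm_def)
qed

lemma product_index_exists:
  fixes k l x :: nat
  assumes "x \<in> {1..k * l}"
  obtains i j where "i < k" "j < l" "x = i * l + j + 1"
proof
  have l: "0 < l" using assms by (cases l) auto
  have "x - 1 < k * l" using assms by auto
  then show "(x - 1) div l < k" using l by (simp add: div_less_iff_less_mult)
  show "(x - 1) mod l < l" using l by simp
  show "x = (x - 1) div l * l + (x - 1) mod l + 1" using assms by simp
qed

lemma exchange_perm_exchange_perm: "x \<in> {1..k * l} \<Longrightarrow> exchange_perm l k (exchange_perm k l x) = x"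
  by (metis exchange_perm_apply product_index_exists)

lemma exchange_perm_permutes: "exchange_perm k l permutes {1..k * l}"
proof (rule bij_imp_permutes)
  have im: "exchange_perm k l ` {1..k * l} \<subseteq> {1..l * k}" for k l
  proof
    fix y assume "y \<in> exchange_perm k l ` {1..k * l}"
    then obtain x where x: "x \<in> {1..k * l}" "y = exchange_perm k l x" by blast
    obtain i j where ij: "i < k" "j < l" "x = i * l + j + 1" using product_index_exists[OF x(1)] .
    have "Suc j * k \<le> l * k" using ij by (intro mult_le_mono1) simp
    then show "y \<in> {1..l * k}" using exchange_perm_apply[OF ij(1,2)] ij x(2) by simp
  qed
  show "bij_betw (exchange_perm k l) {1..k * l} {1..k * l}"
    using im[of k l] im[of l k] exchange_perm_exchange_perm[of _ k l] exchange_perm_exchange_perm[of _ l k]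
    by (intro bij_betw_byWitness[where f' = "exchange_perm l k"]) (auto simp: mult.commute)
qed (auto simp: exchange_perm_def)

text \<open>The interchange relation inside a single operad. In this form it is carried along
  homomorphisms, in particular from one tensor product to the next.\<close>

definition interchanges :: "'a operad \<Rightarrow> 'a \<Rightarrow> 'a \<Rightarrow> bool" where
  "interchanges P p q \<longleftrightarrow>
     compose P p (replicate (arity P p) q)
     = act P (compose P q (replicate (arity P q) p)) (exchange_perm (arity P p) (arity P q))"

lemma composable_replicate:
  "p \<in> ops P \<Longrightarrow> q \<in> ops P \<Longrightarrow> composable P p (replicate (arity P p) q)"
  by (auto simp: composable_def)

lemma interchange_sides:
  assumes P: "is_operad P" and p: "p \<in> ops P" and q: "q \<in> ops P"
  shows "compose P p (replicate (arity P p) q) \<in> ops P"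
    and "exchange_perm (arity P p) (arity P q) permutes {1..arity P (compose P q (replicate (arity P q) p))}"
    and "act P (compose P q (replicate (arity P q) p)) (exchange_perm (arity P p) (arity P q)) \<in> ops P"
    and "arity P (compose P p (replicate (arity P p) q))
      = arity P (act P (compose P q (replicate (arity P q) p)) (exchange_perm (arity P p) (arity P q)))"
proof -
  note pq = operad_compose[OF P composable_replicate[OF p q]] operad_arity_compose[OF P composable_replicate[OF p q]]
  note qp = operad_compose[OF P composable_replicate[OF q p]] operad_arity_compose[OF P composable_replicate[OF q p]]
  have tot: "total_arity P (replicate n r) = n * arity P r" for n r
    by (simp add: total_arity_def sum_list_replicate)
  show "compose P p (replicate (arity P p) q) \<in> ops P" by (rule pq)
  show e: "exchange_perm (arity P p) (arity P q) permutes {1..arity P (compose P q (replicate (arity P q) p))}"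
    unfolding qp(2) tot using exchange_perm_permutes[of "arity P p" "arity P q"] by (simp add: mult.commute)
  show "act P (compose P q (replicate (arity P q) p)) (exchange_perm (arity P p) (arity P q)) \<in> ops P"
    by (rule operad_act[OF P qp(1) e])
  show "arity P (compose P p (replicate (arity P p) q))
      = arity P (act P (compose P q (replicate (arity P q) p)) (exchange_perm (arity P p) (arity P q)))"
    unfolding operad_arity_act[OF P qp(1) e] pq(2) qp(2) tot by simp
qed

text \<open>The arities of \<open>p\<close> and \<open>q\<close> are replaced by those of their
  images, so that the right-hand sides are literally the two sides of
  \<open>interchanges Q (f p) (f q)\<close>.\<close>

lemma hom_interchange_sides:
  assumes P: "is_operad P" and f: "operad_hom f P Q" and p: "p \<in> ops P" and q: "q \<in> ops P"
  shows "f (compose P p (replicate (arity P p) q)) = compose Q (f p) (replicate (arity Q (f p)) (f q))"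
    and "f (act P (compose P q (replicate (arity P q) p)) (exchange_perm (arity P p) (arity P q)))
      = act Q (compose Q (f q) (replicate (arity Q (f q)) (f p))) (exchange_perm (arity Q (f p)) (arity Q (f q)))"
  using hom_act[OF f operad_compose[OF P composable_replicate[OF q p]] interchange_sides(2)[OF P p q]]
    hom_compose[OF f composable_replicate[OF p q]] hom_compose[OF f composable_replicate[OF q p]]
    hom_arity[OF f p] hom_arity[OF f q] by simp_all

lemma hom_interchanges:
  assumes "is_operad P" "operad_hom f P Q" "p \<in> ops P" "q \<in> ops P" "interchanges P p q"
  shows "interchanges Q (f p) (f q)"
  using hom_interchange_sides[OF assms(1-4)] assms(5) unfolding interchanges_def by simp


context
  fixes P Q :: "'x tree operad"
  assumes P: "is_operad P" and Q: "is_operad Q"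
begin

lemma coprod_tree_is_operad: "is_operad (tree_operad (coprod_sig P Q))"
  by (rule tree_operad_is_operad) (auto simp: coprod_sig_def operad_arity_pos[OF P, simplified] operad_arity_pos[OF Q, simplified])

lemma coproduct_is_operad: "is_operad (coproduct P Q)"
  unfolding coproduct_def by (rule quotient_is_operad[OF coprod_tree_is_operad])

lemma inj_left_hom: "operad_hom (inj_left P Q) P (coproduct P Q)"
  unfolding coproduct_def inj_left_def[abs_def]
  by (rule embed_hom[OF P coprod_tree_is_operad]) (auto simp: coprod_sig_def coprod_rels_def)

lemma inj_right_hom: "operad_hom (inj_right P Q) Q (coproduct P Q)"
  unfolding coproduct_def inj_right_def[abs_def]
  by (rule embed_hom[OF Q coprod_tree_is_operad]) (auto simp: coprod_sig_def coprod_rels_def)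

lemma coproduct_universal:
  assumes O': "is_operad O'" and f: "operad_hom f P O'" and g: "operad_hom g Q O'"
  obtains h where "operad_hom h (coproduct P Q) O'"
    "\<And>p. p \<in> ops P \<Longrightarrow> h (inj_left P Q p) = f p" "\<And>q. q \<in> ops Q \<Longrightarrow> h (inj_right P Q q) = g q"
proof -
  let ?S = "coprod_sig P Q"
  \<comment> \<open>\<open>Gen\<close> does not occur in \<open>coprod_sig\<close>; its value is a
    default.\<close>
  define \<iota> where "\<iota> s m = (case s of FromL p \<Rightarrow> f p | FromR q \<Rightarrow> g q | Gen x \<Rightarrow> ident O')"
    for s :: "('x, 'x tree) sym" and m :: nat
  let ?h = "eval O' \<iota>"
  have \<iota>: "\<iota> s m \<in> ops O' \<and> arity O' (\<iota> s m) = m" if "(s, m) \<in> ?S" for s m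
    using that hom_ops[OF f] hom_ops[OF g] hom_arity[OF f] hom_arity[OF g]
    by (auto simp: coprod_sig_def \<iota>_def)
  have h: "operad_hom ?h (tree_operad ?S) O'" by (rule eval_hom[OF O' \<iota>])
  have sL: "(FromL p, arity P p) \<in> ?S" if "p \<in> ops P" for p using that by (auto simp: coprod_sig_def)
  have sR: "(FromR q, arity Q q) \<in> ?S" if "q \<in> ops Q" for q using that by (auto simp: coprod_sig_def)
  have hL: "?h (corolla (FromL p) (arity P p)) = f p" if "p \<in> ops P" for p
    using eval_corolla[where \<iota> = \<iota>, OF O' \<iota> sL[OF that]] by (simp add: \<iota>_def)
  have hR: "?h (corolla (FromR q) (arity Q q)) = g q" if "q \<in> ops Q" for q
    using eval_corolla[where \<iota> = \<iota>, OF O' \<iota> sR[OF that]] by (simp add: \<iota>_def)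
  have rels: "?h a = ?h b" if "(a, b) \<in> coprod_rels P Q" for a b
    using that embed_rels_respected[OF P sL h f hL] embed_rels_respected[OF Q sR h g hR]
    unfolding coprod_rels_def by blast
  show ?thesis
  proof
    show "operad_hom ?h (coproduct P Q) O'"
      unfolding coproduct_def by (rule hom_quotient[OF coprod_tree_is_operad h rels])
    show "?h (inj_left P Q p) = f p" if "p \<in> ops P" for p
      unfolding inj_left_def
      using hom_rep[OF coprod_tree_is_operad h rels corolla_ops[OF sL[OF that]]] hL[OF that] by simp
    show "?h (inj_right P Q q) = g q" if "q \<in> ops Q" for q
      unfolding inj_right_def
      using hom_rep[OF coprod_tree_is_operad h rels corolla_ops[OF sR[OF that]]] hR[OF that] by simp
  qed
qed

lemma coproduct_suboperad:
  assumes Z: "suboperad Z (coproduct P Q)" and "\<And>p. p \<in> ops P \<Longrightarrow> inj_left P Q p \<in> Z"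
    and "\<And>q. q \<in> ops Q \<Longrightarrow> inj_right P Q q \<in> Z"
  shows "ops (coproduct P Q) \<subseteq> Z"
proof
  let ?T = "tree_operad (coprod_sig P Q)"
  fix x assume "x \<in> ops (coproduct P Q)"
  then obtain t where t: "t \<in> ops ?T" "x = rep ?T (coprod_rels P Q) t"
    unfolding coproduct_def ops_quotient by blast
  have r: "operad_hom (rep ?T (coprod_rels P Q)) ?T (coproduct P Q)"
    unfolding coproduct_def by (rule rep_hom[OF coprod_tree_is_operad])
  show "x \<in> Z"
    unfolding t(2) using assms(2,3)
    by (intro hom_tree_suboperad[OF r Z _ t(1)]) (auto simp: coprod_sig_def inj_left_def inj_right_def)
qed


section \<open>Boardman--Vogt tensor products\<close>

definition tensor_left :: "'x tree \<Rightarrow> 'x tree" where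
  "tensor_left p = rep (coproduct P Q) (interchange_rels P Q) (inj_left P Q p)"

definition tensor_right :: "'x tree \<Rightarrow> 'x tree" where
  "tensor_right q = rep (coproduct P Q) (interchange_rels P Q) (inj_right P Q q)"

lemma tensor_is_operad: "is_operad (P \<otimes>\<^sub>B\<^sub>V Q)"
  unfolding bv_tensor_def by (rule quotient_is_operad[OF coproduct_is_operad])

lemma rep_tensor_hom:
  "operad_hom (rep (coproduct P Q) (interchange_rels P Q)) (coproduct P Q) (P \<otimes>\<^sub>B\<^sub>V Q)"
  unfolding bv_tensor_def by (rule rep_hom[OF coproduct_is_operad])

lemma tensor_left_hom: "operad_hom tensor_left P (P \<otimes>\<^sub>B\<^sub>V Q)"
  unfolding tensor_left_def[abs_def] using hom_trans[OF inj_left_hom rep_tensor_hom] by (simp add: comp_def)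

lemma tensor_right_hom: "operad_hom tensor_right Q (P \<otimes>\<^sub>B\<^sub>V Q)"
  unfolding tensor_right_def[abs_def] using hom_trans[OF inj_right_hom rep_tensor_hom] by (simp add: comp_def)

text \<open>\<open>interchange_rels\<close> speaks of the arities of \<open>p\<close> and
  \<open>q\<close> in the factors. With the arities of their images the two sides take the form
  treated in \<open>interchange_sides\<close> and \<open>hom_interchange_sides\<close>.\<close>

lemma interchange_rels_iff:
  "(a, b) \<in> interchange_rels P Q \<longleftrightarrow> (\<exists>p\<in>ops P. \<exists>q\<in>ops Q.
     a = compose (coproduct P Q) (inj_left P Q p)
       (replicate (arity (coproduct P Q) (inj_left P Q p)) (inj_right P Q q)) \<and>
     b = act (coproduct P Q) (compose (coproduct P Q) (inj_right P Q q)
         (replicate (arity (coproduct P Q) (inj_right P Q q)) (inj_left P Q p)))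
       (exchange_perm (arity (coproduct P Q) (inj_left P Q p)) (arity (coproduct P Q) (inj_right P Q q))))"
  using hom_arity[OF inj_left_hom] hom_arity[OF inj_right_hom]
  unfolding interchange_rels_def Let_def by auto

lemma tensor_interchanges:
  assumes "p \<in> ops P" "q \<in> ops Q"
  shows "interchanges (P \<otimes>\<^sub>B\<^sub>V Q) (tensor_left p) (tensor_right q)"
proof -
  note l = hom_ops[OF inj_left_hom assms(1)] and r = hom_ops[OF inj_right_hom assms(2)]
  note s = hom_interchange_sides[OF coproduct_is_operad rep_tensor_hom l r]
  note t = interchange_sides[OF coproduct_is_operad l r]
  show ?thesis
    unfolding interchanges_def tensor_left_def tensor_right_def s[symmetric]
    using assms t by (intro rep_relation) (auto simp: interchange_rels_iff)
qed

lemma tensor_universal: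
  assumes O': "is_operad O'" and f: "operad_hom f P O'" and g: "operad_hom g Q O'"
    and fg: "\<And>p q. p \<in> ops P \<Longrightarrow> q \<in> ops Q \<Longrightarrow> interchanges O' (f p) (g q)"
  obtains h where "operad_hom h (P \<otimes>\<^sub>B\<^sub>V Q) O'"
    "\<And>p. p \<in> ops P \<Longrightarrow> h (tensor_left p) = f p" "\<And>q. q \<in> ops Q \<Longrightarrow> h (tensor_right q) = g q"
proof -
  obtain h where h: "operad_hom h (coproduct P Q) O'"
    and hL: "\<And>p. p \<in> ops P \<Longrightarrow> h (inj_left P Q p) = f p" and hR: "\<And>q. q \<in> ops Q \<Longrightarrow> h (inj_right P Q q) = g q"
    using coproduct_universal[OF O' f g] by metis
  have rels: "h a = h b" if "(a, b) \<in> interchange_rels P Q" for a b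
  proof -
    obtain p q where pq: "p \<in> ops P" "q \<in> ops Q"
      and a: "a = compose (coproduct P Q) (inj_left P Q p)
       (replicate (arity (coproduct P Q) (inj_left P Q p)) (inj_right P Q q))"
      and b: "b = act (coproduct P Q) (compose (coproduct P Q) (inj_right P Q q)
         (replicate (arity (coproduct P Q) (inj_right P Q q)) (inj_left P Q p)))
       (exchange_perm (arity (coproduct P Q) (inj_left P Q p)) (arity (coproduct P Q) (inj_right P Q q)))"
      using \<open>(a, b) \<in> _\<close> unfolding interchange_rels_iff by blast
    note l = hom_ops[OF inj_left_hom pq(1)] and r = hom_ops[OF inj_right_hom pq(2)]
    show ?thesis
      unfolding a b hom_interchange_sides[OF coproduct_is_operad h l r] hL[OF pq(1)] hR[OF pq(2)]
      using fg[OF pq] unfolding interchanges_def .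
  qed
  show ?thesis
  proof
    show "operad_hom h (P \<otimes>\<^sub>B\<^sub>V Q) O'"
      unfolding bv_tensor_def by (rule hom_quotient[OF coproduct_is_operad h rels])
    show "h (tensor_left p) = f p" if "p \<in> ops P" for p
      unfolding tensor_left_def
      using hom_rep[OF coproduct_is_operad h rels hom_ops[OF inj_left_hom that]] hL[OF that] by simp
    show "h (tensor_right q) = g q" if "q \<in> ops Q" for q
      unfolding tensor_right_def
      using hom_rep[OF coproduct_is_operad h rels hom_ops[OF inj_right_hom that]] hR[OF that] by simp
  qed
qed

lemma tensor_suboperad:
  assumes Z: "suboperad Z (P \<otimes>\<^sub>B\<^sub>V Q)" and L: "\<And>p. p \<in> ops P \<Longrightarrow> tensor_left p \<in> Z"
    and R: "\<And>q. q \<in> ops Q \<Longrightarrow> tensor_right q \<in> Z"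
  shows "ops (P \<otimes>\<^sub>B\<^sub>V Q) \<subseteq> Z"
proof -
  let ?r = "rep (coproduct P Q) (interchange_rels P Q)"
  have "ops (coproduct P Q) \<subseteq> {x \<in> ops (coproduct P Q). ?r x \<in> Z}"
    using L R hom_ops[OF inj_left_hom] hom_ops[OF inj_right_hom]
    by (intro coproduct_suboperad suboperad_hom_vimage[OF rep_tensor_hom Z coproduct_is_operad])
      (auto simp: tensor_left_def tensor_right_def)
  then show ?thesis unfolding bv_tensor_def ops_quotient by blast
qed

end


section \<open>Subdivisions as trees\<close>

text \<open>A vertex \<open>Gen (k, m, w)\<close> stands for a cut into \<open>m\<close> parts in direction \<open>k\<close>, labelled by
  \<open>w\<close>.\<close>

definition cut_sig :: "nat set \<Rightarrow> (nat \<Rightarrow> nat \<Rightarrow> 'l set) \<Rightarrow>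
    ((nat \<times> nat \<times> 'l, (nat \<times> nat \<times> 'l) tree) sym \<times> nat) set" where
  "cut_sig K L = {(Gen (k, m, w), m) |k m w. k \<in> K \<and> 2 \<le> m \<and> w \<in> L k m}"

lemma over_sig_cut_Node:
  assumes "over_sig (cut_sig K L) (Node s ts)" "K \<subseteq> {1..d}"
  obtains k w where "s = Gen (k, length ts, w)" "k \<in> {1..d}" "k \<in> K" "2 \<le> length ts" "w \<in> L k (length ts)"
  using assms by (auto simp: cut_sig_def)

lemma cut_sig_mono: "K \<subseteq> K' \<Longrightarrow> cut_sig K L \<subseteq> cut_sig K' L"
  by (auto simp: cut_sig_def)

text \<open>Only \<open>Gen\<close> occurs in trees over \<open>cut_sig\<close>; the other values
  are defaults. As in \<open>box_part\<close>, parts are counted from 1, whereas the children of a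
  vertex are counted from 0; this accounts for the \<open>Suc\<close> in the functions
  below.\<close>

fun part :: "box \<Rightarrow> (nat \<times> nat \<times> 'l, 't) sym \<Rightarrow> nat \<Rightarrow> box" where
  "part R (Gen (k, m, w)) l = box_part R k m l"
| "part R (FromL t) l = R"
| "part R (FromR t) l = R"

fun own_cuts :: "nat \<Rightarrow> box \<Rightarrow> (nat \<times> nat \<times> 'l, 't) sym \<Rightarrow> (point \<times> nat \<times> nat \<times> 'l) set" where
  "own_cuts d R (Gen (k, m, w)) =
     (\<Union>l\<in>{1..m - 1}. {x \<in> box_pts d R. x k = cut_pos R k m l} \<times> {(k, m, w)})"
| "own_cuts d R (FromL t) = {}"
| "own_cuts d R (FromR t) = {}"

lemma size_nth_less [termination_simp]: "l < length ts \<Longrightarrow> size (ts ! l) < Suc (n + size_list size ts)"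
  using size_list_estimation'[of "ts ! l" ts "size (ts ! l)" size] by simp

text \<open>A set of pairs rather than a list: grafting becomes a union, renaming an image, and the
  order of two cuts in different directions leaves no trace.\<close>

fun named_boxes :: "box \<Rightarrow> (nat \<times> nat \<times> 'l) tree \<Rightarrow> (nat \<times> box) set" where
  "named_boxes R (Leaf i) = {(i, R)}"
| "named_boxes R (Node s ts) = (\<Union>l\<in>{..<length ts}. named_boxes (part R s (Suc l)) (ts ! l))"

fun cuts :: "nat \<Rightarrow> box \<Rightarrow> (nat \<times> nat \<times> 'l) tree \<Rightarrow> (point \<times> nat \<times> nat \<times> 'l) set" where
  "cuts d R (Leaf i) = {}"
| "cuts d R (Node s ts) = own_cuts d R s \<union> (\<Union>l\<in>{..<length ts}. cuts d (part R s (Suc l)) (ts ! l))"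

lemma named_boxes_graft:
  "named_boxes R (graft f t) = (\<Union>(i, Q)\<in>named_boxes R t. named_boxes Q (f i))"
  by (induction R t rule: named_boxes.induct) simp_all

lemma cuts_graft:
  "cuts d R (graft f t) = cuts d R t \<union> (\<Union>(i, Q)\<in>named_boxes R t. cuts d Q (f i))"
  by (induction R t rule: named_boxes.induct) (simp_all, blast)

lemma named_boxes_relabel: "named_boxes R (relabel h t) = map_prod h id ` named_boxes R t"
  unfolding relabel_def named_boxes_graft by force

lemma cuts_relabel: "cuts d R (relabel h t) = cuts d R t"
  unfolding relabel_def cuts_graft by auto

lemma fst_named_boxes: "fst ` named_boxes R t = set (leaves t)"
proof (induction R t rule: named_boxes.induct)
  case (2 R s ts)
  have ts: "set ts = (!) ts ` {..<length ts}" by (auto simp: set_conv_nth)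
  have "fst ` named_boxes R (Node s ts) = (\<Union>l\<in>{..<length ts}. set (leaves (ts ! l)))"
    using 2 by (simp add: image_UN)
  also have "\<dots> = set (leaves (Node s ts))" by (simp add: ts image_image)
  finally show ?case .
qed simp

lemma distinct_concat_nth:
  assumes "distinct (concat xss)" "i < length xss" "j < length xss" "x \<in> set (xss ! i)" "x \<in> set (xss ! j)"
  shows "i = j"
  using assms
proof (induction xss arbitrary: i j)
  case (Cons xs xss)
  have "x \<in> set (concat xss)" if "k < length xss" "x \<in> set (xss ! k)" for k
    using that nth_mem by fastforce
  with Cons show ?case by (cases i; cases j) auto
qed simp

lemma distinct_nth_concat: "distinct (concat xss) \<Longrightarrow> i < length xss \<Longrightarrow> distinct (xss ! i)"
  by (induction xss arbitrary: i) (auto simp: nth_Cons split: nat.split)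

lemma named_boxes_functional:
  "distinct (leaves t) \<Longrightarrow> (i, Q) \<in> named_boxes R t \<Longrightarrow> (i, Q') \<in> named_boxes R t \<Longrightarrow> Q = Q'"
proof (induction R t rule: named_boxes.induct)
  case (2 R s ts)
  obtain l l' where l: "l < length ts" "(i, Q) \<in> named_boxes (part R s (Suc l)) (ts ! l)"
    and l': "l' < length ts" "(i, Q') \<in> named_boxes (part R s (Suc l')) (ts ! l')"
    using 2(3,4) by auto
  have "i \<in> set (leaves (ts ! l))" "i \<in> set (leaves (ts ! l'))"
    using fst_named_boxes[of "part R s (Suc l)" "ts ! l"] fst_named_boxes[of "part R s (Suc l')" "ts ! l'"]
      l(2) l'(2) by force+
  then have eq: "l' = l"
    using distinct_concat_nth[of "map leaves ts" l l' i] 2(2) l(1) l'(1) by simp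
  have "distinct (leaves (ts ! l))"
    using distinct_nth_concat[of "map leaves ts" l] 2(2) l(1) by simp
  from 2(1)[OF _ this l(2) l'(2)[unfolded eq]] show ?case using l(1) by simp
qed simp


section \<open>Rectangles\<close>

text \<open>\<open>cut_pos\<close> depends only on the two ends of one side of the rectangle; this
  form applies to intervals on a line as well.\<close>

definition cut_coord :: "real \<Rightarrow> real \<Rightarrow> nat \<Rightarrow> nat \<Rightarrow> real" where
  "cut_coord a b m l = ((real m - real l) * a + real l * b) / real m"

lemma cut_pos_eq: "cut_pos R k m l = cut_coord (fst R k) (snd R k) m l"
  by (simp add: cut_pos_def cut_coord_def)

lemma cut_coord_eq: "0 < m \<Longrightarrow> cut_coord a b m l = a + real l * (b - a) / real m"
  by (simp add: cut_coord_def field_simps)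

lemma cut_coord_0: "0 < m \<Longrightarrow> cut_coord a b m 0 = a"
  and cut_coord_last: "0 < m \<Longrightarrow> cut_coord a b m m = b"
  by (simp_all add: cut_coord_def)

lemma cut_coord_less_iff: "0 < m \<Longrightarrow> a < b \<Longrightarrow> cut_coord a b m l < cut_coord a b m l' \<longleftrightarrow> l < l'"
  by (simp add: cut_coord_eq divide_less_cancel)

lemma cut_coord_le_iff: "0 < m \<Longrightarrow> a < b \<Longrightarrow> cut_coord a b m l \<le> cut_coord a b m l' \<longleftrightarrow> l \<le> l'"
  by (simp add: cut_coord_eq divide_le_cancel)

lemma cut_coord_Rats: "a \<in> \<rat> \<Longrightarrow> b \<in> \<rat> \<Longrightarrow> cut_coord a b m l \<in> \<rat>"
  by (simp add: cut_coord_def)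

text \<open>The rectangles of a subdivision of the unit cube have rational corners; hence no cut passes
  through an irrational coordinate, and lines with irrational coordinates meet cuts only
  transversally.\<close>

definition rational_box :: "nat \<Rightarrow> box \<Rightarrow> bool" where
  "rational_box d R \<longleftrightarrow> fst R \<in> extensional {1..d} \<and> snd R \<in> extensional {1..d} \<and>
     (\<forall>i\<in>{1..d}. fst R i \<in> \<rat> \<and> snd R i \<in> \<rat> \<and> fst R i < snd R i)"

definition subbox :: "nat \<Rightarrow> box \<Rightarrow> box \<Rightarrow> bool" where
  "subbox d Q R \<longleftrightarrow> (\<forall>i\<in>{1..d}. fst R i \<le> fst Q i \<and> snd Q i \<le> snd R i)"

lemma rational_unit_box: "rational_box d (unit_box d)"
  by (simp add: rational_box_def unit_box_def)

lemma fst_box_part: "fst (box_part R k m l) i = (if i = k then cut_coord (fst R k) (snd R k) m (l - 1) else fst R i)"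
  and snd_box_part: "snd (box_part R k m l) i = (if i = k then cut_coord (fst R k) (snd R k) m l else snd R i)"
  by (simp_all add: box_part_def cut_pos_eq)

lemma
  assumes R: "rational_box d R" and k: "k \<in> {1..d}" and l: "l < m"
  shows rational_box_part: "rational_box d (box_part R k m (Suc l))"
    and subbox_part: "subbox d (box_part R k m (Suc l)) R"
proof -
  have m: "0 < m" using l by simp
  have ab: "fst R k \<in> \<rat>" "snd R k \<in> \<rat>" "fst R k < snd R k" using R k by (auto simp: rational_box_def)
  have "cut_coord (fst R k) (snd R k) m l < cut_coord (fst R k) (snd R k) m (Suc l)"
    using cut_coord_less_iff[OF m ab(3)] by simp
  then show "rational_box d (box_part R k m (Suc l))"
    using R k cut_coord_Rats[OF ab(1,2)]
    by (auto simp: rational_box_def fst_box_part snd_box_part) (auto simp: box_part_def extensional_def)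
  have "cut_coord (fst R k) (snd R k) m 0 \<le> cut_coord (fst R k) (snd R k) m l"
    "cut_coord (fst R k) (snd R k) m (Suc l) \<le> cut_coord (fst R k) (snd R k) m m"
    using cut_coord_le_iff[OF m ab(3)] l by simp_all
  then show "subbox d (box_part R k m (Suc l)) R"
    by (auto simp: subbox_def fst_box_part snd_box_part cut_coord_0[OF m] cut_coord_last[OF m])
qed

lemma subbox_trans: "subbox d P Q \<Longrightarrow> subbox d Q R \<Longrightarrow> subbox d P R"
  unfolding subbox_def by (meson order_trans)

lemma named_boxes_rational:
  assumes "over_sig (cut_sig K L) t" "K \<subseteq> {1..d}" "rational_box d R" "(i, Q) \<in> named_boxes R t"
  shows "rational_box d Q \<and> subbox d Q R"
  using assms(1,3,4)
proof (induction R t rule: named_boxes.induct)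
  case (1 R i)
  then show ?case by (simp add: subbox_def)
next
  case (2 R s ts)
  obtain k w where s: "s = Gen (k, length ts, w)" "k \<in> {1..d}"
    using over_sig_cut_Node[OF 2(2) assms(2)] by metis
  obtain l where l: "l < length ts" "(i, Q) \<in> named_boxes (part R s (Suc l)) (ts ! l)"
    using 2(4) by auto
  have "rational_box d Q \<and> subbox d Q (part R s (Suc l))"
    using 2(1)[of l] l 2(2) rational_box_part[OF 2(3) s(2) l(1)] s(1) by simp
  then show ?case using subbox_trans[OF _ subbox_part[OF 2(3) s(2) l(1)]] s(1) by simp
qed

text \<open>A rectangle of positive width fits into just one of the parts of a cut. This yields the
  distinctness of the rectangles that \<open>cut_operad\<close> demands.\<close>

lemma named_boxes_inj:
  assumes "over_sig (cut_sig K L) t" "K \<subseteq> {1..d}" "rational_box d R"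
    "(i, Q) \<in> named_boxes R t" "(j, Q) \<in> named_boxes R t"
  shows "i = j"
  using assms(1,3-5)
proof (induction R t rule: named_boxes.induct)
  case (2 R s ts)
  obtain k w where s: "s = Gen (k, length ts, w)" "k \<in> {1..d}"
    using over_sig_cut_Node[OF 2(2) assms(2)] by metis
  obtain l l' where l: "l < length ts" "(i, Q) \<in> named_boxes (part R s (Suc l)) (ts ! l)"
    and l': "l' < length ts" "(j, Q) \<in> named_boxes (part R s (Suc l')) (ts ! l')"
    using 2(4,5) by auto
  have over: "over_sig (cut_sig K L) (ts ! l)" "over_sig (cut_sig K L) (ts ! l')" using 2(2) l l' by auto
  have r: "rational_box d (part R s (Suc l))" "rational_box d (part R s (Suc l'))"
    using rational_box_part[OF 2(3) s(2)] l(1) l'(1) s(1) by simp_all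
  note q = named_boxes_rational[OF over(1) assms(2) r(1) l(2)] named_boxes_rational[OF over(2) assms(2) r(2) l'(2)]
  have m: "0 < length ts" and ab: "fst R k < snd R k" using l(1) 2(3) s(2) by (auto simp: rational_box_def)
  have "fst Q k < snd Q k" using q(1) s(2) by (simp add: rational_box_def)
  then have "cut_coord (fst R k) (snd R k) (length ts) l < cut_coord (fst R k) (snd R k) (length ts) (Suc l')"
    "cut_coord (fst R k) (snd R k) (length ts) l' < cut_coord (fst R k) (snd R k) (length ts) (Suc l)"
    using q s by (force simp: subbox_def fst_box_part snd_box_part)+
  then have "l = l'" unfolding cut_coord_less_iff[OF m ab] by simp
  then show ?case using 2(1)[of l] over(1) r(1) l l' by simp
qed simp

section \<open>Rescaling of rectangles and cuts\<close>

definition scale :: "nat \<Rightarrow> box \<Rightarrow> box \<Rightarrow> box" where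
  "scale d R = map_prod (rescale d R) (rescale d R)"

text \<open>The coordinate maps of \<open>rescale\<close> are affine, and affine maps preserve equal
  division. Drawing a tree in a smaller rectangle therefore means rescaling its picture in the cube,
  which is how \<open>cut_operad\<close> composes.\<close>

lemma box_part_scale:
  assumes "k \<in> {1..d}" "0 < m"
  shows "box_part (scale d R Q) k m l = scale d R (box_part Q k m l)"
proof -
  have "cut_pos (scale d R Q) k m l = fst R k + (snd R k - fst R k) * cut_pos Q k m l" for l
    using assms by (simp add: cut_pos_eq cut_coord_eq scale_def rescale_def field_simps)
  then show ?thesis using assms(1)
    by (auto simp: box_part_def scale_def rescale_def fun_eq_iff)
qed

lemma named_boxes_scale:
  assumes "over_sig (cut_sig K L) t" "K \<subseteq> {1..d}"
  shows "named_boxes (scale d R Q) t = map_prod id (scale d R) ` named_boxes Q t"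
  using assms(1)
proof (induction Q t rule: named_boxes.induct)
  case (2 Q s ts)
  obtain k w where s: "s = Gen (k, length ts, w)" "k \<in> {1..d}" "2 \<le> length ts"
    using over_sig_cut_Node[OF 2(2) assms(2)] by metis
  have len: "0 < length ts" using s(3) by linarith
  have "part (scale d R Q) s (Suc l) = scale d R (part Q s (Suc l))" for l
    using box_part_scale[OF s(2) len] s(1) by simp
  then show ?case using 2 by (simp add: image_UN)
qed simp

lemma box_pts_scale:
  assumes R: "rational_box d R"
  shows "box_pts d (scale d R Q) = rescale d R ` box_pts d Q"
proof (intro equalityI subsetI)
  fix y assume y: "y \<in> box_pts d (scale d R Q)"
  define x where "x = restrict (\<lambda>i. (y i - fst R i) / (snd R i - fst R i)) {1..d}"
  have pos: "0 < snd R i - fst R i" if "i \<in> {1..d}" for i using R that by (simp add: rational_box_def)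
  have "fst Q i \<le> x i \<and> x i \<le> snd Q i" if i: "i \<in> {1..d}" for i
    using y i pos[OF i]
    by (simp add: box_pts_def PiE_iff scale_def rescale_def x_def field_simps)
  then have "x \<in> box_pts d Q" by (auto simp: box_pts_def x_def)
  moreover have "rescale d R x = y"
  proof
    fix i
    show "rescale d R x i = y i"
      using y pos[of i] by (auto simp: box_pts_def rescale_def x_def PiE_iff extensional_def)
  qed
  ultimately show "y \<in> rescale d R ` box_pts d Q" by blast
next
  fix y assume "y \<in> rescale d R ` box_pts d Q"
  then obtain x where x: "x \<in> box_pts d Q" "y = rescale d R x" by blast
  have pos: "0 \<le> snd R i - fst R i" if "i \<in> {1..d}" for i using R that by (auto simp: rational_box_def intro: less_imp_le)
  show "y \<in> box_pts d (scale d R Q)"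
    using x pos by (auto simp: box_pts_def rescale_def scale_def PiE_iff intro!: mult_left_mono)
qed

lemma own_cuts_scale:
  assumes R: "rational_box d R" and k: "k \<in> {1..d}" and m: "0 < m"
  shows "own_cuts d (scale d R Q) (Gen (k, m, w)) = map_prod (rescale d R) id ` own_cuts d Q (Gen (k, m, w))"
proof -
  have pos: "0 < snd R k - fst R k" using R k by (simp add: rational_box_def)
  have cp: "cut_pos (scale d R Q) k m l = fst R k + (snd R k - fst R k) * cut_pos Q k m l" for l
    using k m by (simp add: cut_pos_eq cut_coord_eq scale_def rescale_def field_simps)
  have "rescale d R x k = cut_pos (scale d R Q) k m l \<longleftrightarrow> x k = cut_pos Q k m l" for x l
    unfolding cp using k pos by (simp add: rescale_def)
  then have "{y \<in> box_pts d (scale d R Q). y k = cut_pos (scale d R Q) k m l}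
      = rescale d R ` {x \<in> box_pts d Q. x k = cut_pos Q k m l}" for l
    unfolding box_pts_scale[OF R] by auto
  moreover have "map_prod f id ` (A \<times> {c}) = (f ` A) \<times> {c}" for f :: "point \<Rightarrow> point" and A and c :: "nat \<times> nat \<times> 'a"
    by force
  ultimately show ?thesis by (simp only: own_cuts.simps image_UN)
qed

lemma cuts_scale:
  assumes "over_sig (cut_sig K L) t" "K \<subseteq> {1..d}" "rational_box d R"
  shows "cuts d (scale d R Q) t = map_prod (rescale d R) id ` cuts d Q t"
  using assms(1)
proof (induction Q t rule: named_boxes.induct)
  case (2 Q s ts)
  obtain k w where s: "s = Gen (k, length ts, w)" "k \<in> {1..d}" "2 \<le> length ts"
    using over_sig_cut_Node[OF 2(2) assms(2)] by metis
  have len: "0 < length ts" using s(3) by linarith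
  have "part (scale d R Q) s (Suc l) = scale d R (part Q s (Suc l))" for l
    using box_part_scale[OF s(2) len] s(1) by simp
  moreover have "own_cuts d (scale d R Q) s = map_prod (rescale d R) id ` own_cuts d Q s"
    using own_cuts_scale[OF assms(3) s(2) len] s(1) by simp
  ultimately show ?case using 2 by (simp add: image_UN image_Un id_def)
qed simp

text \<open>Extensionality of the corners makes this an equality of functions and not merely of
  their values on \<open>{1..d}\<close>.\<close>

lemma scale_unit_box: "rational_box d R \<Longrightarrow> scale d R (unit_box d) = R"
  by (cases R) (auto simp: scale_def unit_box_def rescale_def rational_box_def fun_eq_iff extensional_def)


section \<open>The cut operad as an image of a tree operad\<close>

lemma tree_subdivision:
  assumes "over_sig (cut_sig {1..d} L) t"
  shows "subdivision d L R (length (leaves t)) (snd ` named_boxes R t) (cuts d R t)"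
  using assms
proof (induction R t rule: named_boxes.induct)
  case (1 R i)
  then show ?case using subdivision.trivial by simp
next
  case (2 R s ts)
  let ?m = "length ts"
  obtain k w where s: "s = Gen (k, ?m, w)" "k \<in> {1..d}" "2 \<le> ?m" "w \<in> L k ?m"
    using over_sig_cut_Node[OF 2(2) order_refl] by metis
  let ?n = "\<lambda>l. length (leaves (ts ! (l - 1)))"
    and ?B = "\<lambda>l. snd ` named_boxes (box_part R k ?m l) (ts ! (l - 1))"
    and ?C = "\<lambda>l. cuts d (box_part R k ?m l) (ts ! (l - 1))"
  have "\<forall>l\<in>{1..?m}. subdivision d L (box_part R k ?m l) (?n l) (?B l) (?C l)"
  proof
    fix l assume "l \<in> {1..?m}"
    then have "l - 1 < ?m" "Suc (l - 1) = l" by auto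
    then show "subdivision d L (box_part R k ?m l) (?n l) (?B l) (?C l)"
      using 2(1)[of "l - 1"] 2(2) s(1) by simp
  qed
  from subdivision.cut[OF s(2-4) this]
  have *: "subdivision d L R (\<Sum>l=1..?m. ?n l) (\<Union>l\<in>{1..?m}. ?B l)
      (own_cuts d R s \<union> (\<Union>l\<in>{1..?m}. ?C l))" by (simp add: s(1))
  have im: "{1..?m} = Suc ` {..<?m}" by (rule image_Suc_lessThan[symmetric])
  have "(\<Sum>l=1..?m. ?n l) = (\<Sum>l<?m. length (leaves (ts ! l)))"
    unfolding im by (simp add: sum.reindex)
  also have "\<dots> = length (leaves (Node s ts))"
    by (simp add: length_concat sum_list_sum_nth comp_def atLeast0LessThan)
  finally have n: "(\<Sum>l=1..?m. ?n l) = length (leaves (Node s ts))" .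
  have B: "(\<Union>l\<in>{1..?m}. ?B l) = snd ` named_boxes R (Node s ts)"
    unfolding im by (simp add: s(1) image_UN)
  have C: "own_cuts d R s \<union> (\<Union>l\<in>{1..?m}. ?C l) = cuts d R (Node s ts)"
    unfolding im by (simp add: s(1))
  show ?case using * unfolding n B C .
qed

lemma subdivision_tree:
  assumes "subdivision d L R n B C"
  shows "\<exists>t. over_sig (cut_sig {1..d} L) t \<and> length (leaves t) = n \<and>
    snd ` named_boxes R t = B \<and> cuts d R t = C"
  using assms
proof (induction rule: subdivision.induct)
  case (trivial R)
  \<comment> \<open>Only the shape of the tree matters here, so all leaves may be named 1;
    \<open>cut_value_surj\<close> chooses proper names.\<close>
  then show ?case by (intro exI[of _ "Leaf 1"]) simp
next
  case (cut k m w R n B C)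
  then obtain t where t: "\<And>l. l \<in> {1..m} \<Longrightarrow> over_sig (cut_sig {1..d} L) (t l)"
    "\<And>l. l \<in> {1..m} \<Longrightarrow> length (leaves (t l)) = n l"
    "\<And>l. l \<in> {1..m} \<Longrightarrow> snd ` named_boxes (box_part R k m l) (t l) = B l"
    "\<And>l. l \<in> {1..m} \<Longrightarrow> cuts d (box_part R k m l) (t l) = C l"
    by metis
  let ?ts = "map t [1..<m + 1]" and ?s = "Gen (k, m, w)"
  have im: "{1..m} = Suc ` {..<m}" by (rule image_Suc_lessThan[symmetric])
  have nth: "?ts ! l = t (Suc l)" if "l < m" for l using that by (simp add: nth_map_upt)
  have "over_sig (cut_sig {1..d} L) (Node ?s ?ts)"
    using cut(1-3) t(1) by (auto simp: cut_sig_def)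
  moreover have "length (leaves (Node ?s ?ts)) = (\<Sum>l=1..m. n l)"
  proof -
    have "length (leaves (Node ?s ?ts)) = sum_list (map (\<lambda>l. length (leaves (t l))) [1..<m + 1])"
      by (simp add: length_concat comp_def)
    also have "\<dots> = (\<Sum>l\<in>set [1..<m + 1]. length (leaves (t l)))"
      by (rule sum_list_distinct_conv_sum_set) simp
    also have "\<dots> = (\<Sum>l=1..m. n l)" using t(2) by (intro sum.cong) auto
    finally show ?thesis .
  qed
  moreover have "snd ` named_boxes R (Node ?s ?ts) = (\<Union>l\<in>{1..m}. B l)"
    using t(3) unfolding im by (auto simp: nth image_UN)
  moreover have "cuts d R (Node ?s ?ts) = (\<Union>l\<in>{1..m - 1}. {x \<in> box_pts d R. x k = cut_pos R k m l} \<times> {(k, m, w)})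
        \<union> (\<Union>l\<in>{1..m}. C l)"
    using t(4) unfolding im by (auto simp: nth)
  ultimately show ?case by blast
qed

text \<open>\<open>THE\<close> is justified for operations, whose leaf names are distinct
  (\<open>named_boxes_functional\<close>). It turns the set of named rectangles into the numbered
  list that \<open>cut_operad\<close> asks for.\<close>

definition cut_value :: "nat \<Rightarrow> (nat \<times> nat \<times> 'l) tree \<Rightarrow> box list \<times> (point \<times> nat \<times> nat \<times> 'l) set" where
  "cut_value d t = (map (\<lambda>i. THE Q. (i, Q) \<in> named_boxes (unit_box d) t) [1..<length (leaves t) + 1],
     cuts d (unit_box d) t)"

lemma cut_value_eqI:
  assumes t: "distinct (leaves t)" and len: "length rs = length (leaves t)"
    and rs: "\<And>i. i < length rs \<Longrightarrow> (Suc i, rs ! i) \<in> named_boxes (unit_box d) t"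
    and C: "C = cuts d (unit_box d) t"
  shows "cut_value d t = (rs, C)"
proof -
  have "(THE Q. (Suc i, Q) \<in> named_boxes (unit_box d) t) = rs ! i" if "i < length rs" for i
    using rs[OF that] named_boxes_functional[OF t] by blast
  then have "map (\<lambda>i. THE Q. (i, Q) \<in> named_boxes (unit_box d) t) [1..<length (leaves t) + 1] = rs"
    by (intro nth_equalityI) (auto simp: len nth_map_upt)
  then show ?thesis using C by (simp add: cut_value_def)
qed

lemma cut_value_nth:
  assumes t: "t \<in> ops (tree_operad S)" and i: "i < length (leaves t)"
  shows "(Suc i, fst (cut_value d t) ! i) \<in> named_boxes (unit_box d) t"
proof -
  have "Suc i \<in> set (leaves t)" using t i by (auto simp: mem_ops_tree)
  then obtain Q where Q: "(Suc i, Q) \<in> named_boxes (unit_box d) t"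
    unfolding fst_named_boxes[of "unit_box d", symmetric] by auto
  have "distinct (leaves t)" using t by (simp add: mem_ops_tree)
  then have "(THE Q. (Suc i, Q) \<in> named_boxes (unit_box d) t) = Q"
    using Q named_boxes_functional by blast
  then show ?thesis using Q i by (simp add: cut_value_def nth_map_upt)
qed

lemma length_cut_value: "length (fst (cut_value d t)) = length (leaves t)"
  by (simp add: cut_value_def)

lemma snd_cut_value: "snd (cut_value d t) = cuts d (unit_box d) t"
  by (simp add: cut_value_def)

lemma named_boxes_cut_value:
  assumes t: "t \<in> ops (tree_operad S)"
  shows "named_boxes (unit_box d) t = (\<lambda>i. (Suc i, fst (cut_value d t) ! i)) ` {..<length (leaves t)}"
proof (intro equalityI subsetI)
  fix y assume y: "y \<in> named_boxes (unit_box d) t"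
  obtain i Q where iQ: "y = (i, Q)" by (cases y)
  have "i \<in> set (leaves t)" unfolding fst_named_boxes[of "unit_box d", symmetric] using y iQ by force
  then have i: "i \<in> {1..length (leaves t)}" using t by (simp add: mem_ops_tree)
  have d: "distinct (leaves t)" using t by (simp add: mem_ops_tree)
  have i1: "i - 1 < length (leaves t)" "Suc (i - 1) = i" using i by auto
  have "Q = fst (cut_value d t) ! (i - 1)"
    using named_boxes_functional[OF d] y iQ cut_value_nth[OF t i1(1)] i1(2) by metis
  then show "y \<in> (\<lambda>i. (Suc i, fst (cut_value d t) ! i)) ` {..<length (leaves t)}"
    using i1 iQ by (intro image_eqI[of _ _ "i - 1"]) auto
qed (use cut_value_nth[OF t] in auto)

text \<open>With the converse \<open>cut_value_cong\<close>, equality in the cut operad becomes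
  equality of named rectangles and of cuts; these two, unlike \<open>cut_value\<close>, can be
  followed through subtrees.\<close>

lemma cut_value_inject:
  assumes "s \<in> ops (tree_operad S)" "t \<in> ops (tree_operad S)" "cut_value d s = cut_value d t"
  shows "named_boxes (unit_box d) s = named_boxes (unit_box d) t" "cuts d (unit_box d) s = cuts d (unit_box d) t"
proof -
  have "length (leaves s) = length (leaves t)" using length_cut_value assms(3) by metis
  then show "named_boxes (unit_box d) s = named_boxes (unit_box d) t"
    using named_boxes_cut_value[OF assms(1), of d] named_boxes_cut_value[OF assms(2), of d] assms(3) by simp
  show "cuts d (unit_box d) s = cuts d (unit_box d) t" using snd_cut_value assms(3) by metis
qed

lemma cut_value_cong:
  assumes s: "s \<in> ops (tree_operad S)" and t: "t \<in> ops (tree_operad S)"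
    and nb: "named_boxes (unit_box d) s = named_boxes (unit_box d) t"
    and c: "cuts d (unit_box d) s = cuts d (unit_box d) t"
  shows "cut_value d s = cut_value d t"
proof -
  have "{1..length (leaves s)} = {1..length (leaves t)}"
    using nb fst_named_boxes s t unfolding mem_ops_tree by metis
  then have "length (leaves s) = length (leaves t)" by (metis card_atLeastAtMost diff_Suc_1)
  then show ?thesis using nb c by (simp add: cut_value_def)
qed


lemma cut_operad_simps:
  "arity (cut_operad d L) c = length (fst c)"
  "ident (cut_operad d L) = ([unit_box d], {})"
  "act (cut_operad d L) c \<sigma> = (map (\<lambda>i. fst c ! (\<sigma> i - 1)) [1..<length (fst c) + 1], snd c)"
  "compose (cut_operad d L) c cs =
     (concat (map2 (\<lambda>R c'. map (scale d R) (fst c')) (fst c) cs),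
      snd c \<union> (\<Union>(R, c')\<in>set (zip (fst c) cs). map_prod (rescale d R) id ` snd c'))"
  by (simp_all add: cut_operad_def split_beta scale_def)

lemma mem_ops_cut_operad:
  "c \<in> ops (cut_operad d L) \<longleftrightarrow>
     distinct (fst c) \<and> subdivision d L (unit_box d) (length (fst c)) (set (fst c)) (snd c)"
  by (simp add: cut_operad_def split_beta)

text \<open>In a composite, the tree grafted at a leaf is drawn in the rectangle of this leaf, which
  by scaling is the shrunken copy prescribed by the cut operad.\<close>

lemma cut_value_hom:
  shows "operad_hom (cut_value d) (tree_operad (cut_sig {1..d} L)) (cut_operad d L)"
  unfolding operad_hom_def
proof (intro conjI ballI allI impI)
  show "cut_value d (ident (tree_operad (cut_sig {1..d} L))) = ident (cut_operad d L)"
    by (simp add: tree_operad_simps cut_operad_simps) (rule cut_value_eqI, auto)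
next
  let ?U = "unit_box d" and ?S = "cut_sig {1..d} L"
  fix t assume t: "t \<in> ops (tree_operad ?S)"
  then have over: "over_sig ?S t" and dist: "distinct (leaves t)" by (auto simp: mem_ops_tree)
  let ?rs = "fst (cut_value d t)"
  note nth = cut_value_nth[OF t, where d = d] and len = length_cut_value[of d t]
  show "arity (cut_operad d L) (cut_value d t) = arity (tree_operad ?S) t"
    by (simp add: cut_operad_simps tree_operad_simps len)
  have "distinct ?rs"
    unfolding distinct_conv_nth len
  proof (intro allI impI)
    fix i j assume ij: "i < length (leaves t)" "j < length (leaves t)" "i \<noteq> j"
    show "?rs ! i \<noteq> ?rs ! j"
    proof
      assume eq: "?rs ! i = ?rs ! j"
      show False
        using named_boxes_inj[OF over order_refl rational_unit_box nth[OF ij(1)] nth[OF ij(2), folded eq]] ij(3)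
        by simp
    qed
  qed
  moreover have "set ?rs = snd ` named_boxes ?U t"
    unfolding named_boxes_cut_value[OF t] by (auto simp: set_conv_nth len image_image)
  ultimately show "cut_value d t \<in> ops (cut_operad d L)"
    using tree_subdivision[OF over, of ?U] by (simp add: mem_ops_cut_operad len snd_cut_value)
  fix \<sigma> assume "\<sigma> permutes {1..arity (tree_operad ?S) t}"
  then have s: "\<sigma> permutes {1..length (leaves t)}" by (simp add: tree_operad_simps)
  show "cut_value d (act (tree_operad ?S) t \<sigma>) = act (cut_operad d L) (cut_value d t) \<sigma>"
    unfolding tree_operad_simps cut_operad_simps
  proof (rule cut_value_eqI)
    show "distinct (leaves (relabel (inv \<sigma>) t))"
      using dist permutes_inj[OF permutes_inv[OF s]] by (auto simp: leaves_relabel distinct_map intro: inj_on_subset)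
    show "length (map (\<lambda>i. ?rs ! (\<sigma> i - 1)) [1..<length ?rs + 1]) = length (leaves (relabel (inv \<sigma>) t))"
      by (simp add: len leaves_relabel)
    show "snd (cut_value d t) = cuts d ?U (relabel (inv \<sigma>) t)" by (simp add: snd_cut_value cuts_relabel)
    fix i assume "i < length (map (\<lambda>i. ?rs ! (\<sigma> i - 1)) [1..<length ?rs + 1])"
    then have i: "Suc i \<in> {1..length (leaves t)}" by (simp add: len)
    have si: "\<sigma> (Suc i) \<in> {1..length (leaves t)}" using permutes_in_image[OF s] i by blast
    then have b: "\<sigma> (Suc i) - 1 < length (leaves t)" "Suc (\<sigma> (Suc i) - 1) = \<sigma> (Suc i)" by auto
    \<comment> \<open>The leaf named \<open>\<sigma> (Suc i)\<close> is renamed to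
      \<open>Suc i\<close>, which is the new number of its rectangle after
      \<open>act\<close>.\<close>
    have "(\<sigma> (Suc i), ?rs ! (\<sigma> (Suc i) - 1)) \<in> named_boxes ?U t" using nth[OF b(1)] b(2) by simp
    then have "(inv \<sigma> (\<sigma> (Suc i)), ?rs ! (\<sigma> (Suc i) - 1)) \<in> named_boxes ?U (relabel (inv \<sigma>) t)"
      unfolding named_boxes_relabel by (metis (no_types, lifting) image_eqI map_prod_simp id_apply)
    then show "(Suc i, map (\<lambda>i. ?rs ! (\<sigma> i - 1)) [1..<length ?rs + 1] ! i) \<in> named_boxes ?U (relabel (inv \<sigma>) t)"
      using i by (simp add: permutes_inverses(2)[OF s] nth_map_upt len)
  qed
next
  let ?U = "unit_box d" and ?S = "cut_sig {1..d} L"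
  fix t qs assume c: "composable (tree_operad ?S) t qs"
  then have t: "t \<in> ops (tree_operad ?S)" and lq: "length qs = length (leaves t)" by (auto simp: composable_tree)
  then have over: "over_sig ?S t" by (simp add: mem_ops_tree)
  let ?rs = "fst (cut_value d t)" and ?n = "length qs"
  have len: "length ?rs = ?n" by (simp add: length_cut_value lq)
  have q: "qs ! l \<in> ops (tree_operad ?S)" if "l < ?n" for l
    using c nth_mem[OF that] unfolding composable_tree by blast
  have overq: "over_sig ?S (qs ! l)" if "l < ?n" for l using q[OF that] by (simp add: mem_ops_tree)
  have rs: "(Suc l, ?rs ! l) \<in> named_boxes ?U t" if "l < ?n" for l using cut_value_nth[OF t] that lq by simp
  have rat: "rational_box d (?rs ! l)" if "l < ?n" for l
    using named_boxes_rational[OF over order_refl rational_unit_box rs[OF that]] by blast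
  have nbt: "named_boxes ?U t = (\<lambda>l. (Suc l, ?rs ! l)) ` {..<?n}" using named_boxes_cut_value[OF t] lq by simp
  note gr = graft_shifted_ops[OF c]
  let ?xss = "map2 (\<lambda>R c'. map (scale d R) (fst c')) ?rs (map (cut_value d) qs)"
  have lx: "length ?xss = ?n" by (simp add: len)
  have nthx: "?xss ! l = map (scale d (?rs ! l)) (fst (cut_value d (qs ! l)))" if "l < ?n" for l
    using that by (simp add: len)
  have lens: "map length ?xss = map (\<lambda>q. length (leaves q)) qs"
    by (intro nth_equalityI) (auto simp: lq length_cut_value)
  show "cut_value d (compose (tree_operad ?S) t qs) = compose (cut_operad d L) (cut_value d t) (map (cut_value d) qs)"
    unfolding tree_operad_simps cut_operad_simps
  proof (rule cut_value_eqI)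
    show "distinct (leaves (graft (shifted qs) t))" using gr(1) by (simp add: mem_ops_tree)
    show "length (concat ?xss) = length (leaves (graft (shifted qs) t))"
      unfolding gr(2) length_concat lens ..
    fix x assume "x < length (concat ?xss)"
    then have "x < sum_list (map length ?xss)" by (simp only: length_concat)
    \<comment> \<open>The number of a rectangle in the composite splits into the index
      \<open>i\<close> of an argument and the index \<open>j\<close> of a rectangle inside it, both
      counted from 0.\<close>
    then obtain i j where ij: "i < length (map length ?xss)" "j < map length ?xss ! i"
      "x = sum_list (take i (map length ?xss)) + j"
      by (rule sum_list_block_exists)
    have i: "i < ?n" using ij(1) len by simp
    have j: "j < length (leaves (qs ! i))" using ij(2) i unfolding lens by simp
    have jx: "j < length (?xss ! i)" using j by (simp only: nthx[OF i] length_map length_cut_value)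
    have x: "x = sum_list (map length (take i ?xss)) + j" using ij(3) by (simp only: take_map)
    have tk: "sum_list (map length (take i ?xss)) = (\<Sum>q\<leftarrow>take (Suc i - 1) qs. length (leaves q))"
      unfolding take_map[symmetric] lens by simp
    have e: "concat ?xss ! x = scale d (?rs ! i) (fst (cut_value d (qs ! i)) ! j)"
      unfolding x using nth_concat_block[of i ?xss j] i jx lx j by (simp only: nthx[OF i]) (simp add: length_cut_value)
    have "(Suc j, fst (cut_value d (qs ! i)) ! j) \<in> named_boxes ?U (qs ! i)"
      by (rule cut_value_nth[OF q[OF i] j])
    then have "(Suc j, concat ?xss ! x) \<in> named_boxes (?rs ! i) (qs ! i)"
      using named_boxes_scale[OF overq[OF i] order_refl, of "?rs ! i" ?U]
      unfolding scale_unit_box[OF rat[OF i]] e by force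
    then have "(Suc x, concat ?xss ! x) \<in> named_boxes (?rs ! i) (shifted qs (Suc i))"
      unfolding shifted_def named_boxes_relabel tk[symmetric] by (force simp: x)
    then show "(Suc x, concat ?xss ! x) \<in> named_boxes ?U (graft (shifted qs) t)"
      unfolding named_boxes_graft using rs[OF i] by blast
  next
    have "set (zip ?rs (map (cut_value d) qs)) = (\<lambda>l. (?rs ! l, cut_value d (qs ! l))) ` {..<?n}"
      by (auto simp: set_zip len)
    then have "(\<Union>(R, c')\<in>set (zip ?rs (map (cut_value d) qs)). map_prod (rescale d R) id ` snd c')
      = (\<Union>l<?n. map_prod (rescale d (?rs ! l)) id ` cuts d ?U (qs ! l))"
      by (simp add: snd_cut_value)
    also have "\<dots> = (\<Union>l<?n. cuts d (?rs ! l) (shifted qs (Suc l)))"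
      using cuts_scale[OF overq order_refl rat, of _ _ ?U] scale_unit_box[OF rat]
      by (intro SUP_cong) (auto simp: shifted_def cuts_relabel)
    finally show "snd (cut_value d t) \<union> (\<Union>(R, c')\<in>set (zip ?rs (map (cut_value d) qs)). map_prod (rescale d R) id ` snd c')
      = cuts d ?U (graft (shifted qs) t)"
      unfolding cuts_graft nbt snd_cut_value by simp
  qed
qed

lemma cut_value_surj:
  shows "ops (cut_operad d L) = cut_value d ` ops (tree_operad (cut_sig {1..d} L))"
proof
  let ?S = "cut_sig {1..d} L" and ?U = "unit_box d"
  show "cut_value d ` ops (tree_operad ?S) \<subseteq> ops (cut_operad d L)"
    using hom_ops[OF cut_value_hom] by blast
  show "ops (cut_operad d L) \<subseteq> cut_value d ` ops (tree_operad ?S)"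
  proof
    fix c assume "c \<in> ops (cut_operad d L)"
    then obtain rs C where c: "c = (rs, C)" "distinct rs" "subdivision d L ?U (length rs) (set rs) C"
      by (cases c) (auto simp: mem_ops_cut_operad)
    obtain t0 where t0: "over_sig ?S t0" "length (leaves t0) = length rs"
      "snd ` named_boxes ?U t0 = set rs" "cuts d ?U t0 = C"
      using subdivision_tree[OF c(3)] by blast
    obtain u where u: "u \<in> ops (tree_operad ?S)" "leaves u = [1..<length (leaves t0) + 1]"
      "t0 = relabel (\<lambda>i. leaves t0 ! (i - 1)) u"
      by (rule standardize[OF t0(1), of UNIV]) auto
    have over: "over_sig ?S u" using u(1) by (simp add: mem_ops_tree)
    let ?b = "fst (cut_value d u)"
    have lb: "length ?b = length rs" using u(2) t0(2) by (simp add: length_cut_value)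
    have "snd ` named_boxes ?U u = set rs"
      using t0(3) by (subst (asm) u(3)) (simp add: named_boxes_relabel image_image)
    then have sb: "set ?b = set rs"
      unfolding named_boxes_cut_value[OF u(1)] by (auto simp: image_image set_conv_nth length_cut_value)
    have cu: "cuts d ?U u = C" using t0(4) by (subst (asm) u(3)) (simp add: cuts_relabel)
    \<comment> \<open>The order of \<open>rs\<close> dictates the names: the leaf of
      \<open>u\<close> numbered \<open>i + 1\<close> gets the position of its rectangle in
      \<open>rs\<close>, here counted from 0.\<close>
    define f where "f i = (SOME j. j < length rs \<and> rs ! j = ?b ! i)" for i
    have f: "f i < length rs" "rs ! f i = ?b ! i" if "i < length rs" for i
    proof -
      have "?b ! i \<in> set rs" using that lb sb nth_mem by metis
      then have "\<exists>j. j < length rs \<and> rs ! j = ?b ! i" by (simp add: in_set_conv_nth)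
      from someI_ex[OF this] show "f i < length rs" "rs ! f i = ?b ! i" by (auto simp: f_def)
    qed
    let ?h = "\<lambda>i. Suc (f (i - 1))"
    let ?t = "relabel ?h u"
    have nbt: "named_boxes ?U ?t = (\<lambda>i. (Suc (f i), ?b ! i)) ` {..<length rs}"
      unfolding named_boxes_relabel named_boxes_cut_value[OF u(1)] image_image
      using u(2) t0(2) by simp
    have b: "distinct ?b" using sb c(2) lb by (metis card_distinct distinct_card)
    have inj: "inj_on f {..<length rs}"
      using f(2) b lb by (intro inj_onI) (metis lessThan_iff nth_eq_iff_index_eq)
    have fim: "f ` {..<length rs} = {..<length rs}"
      using inj f(1) by (intro card_subset_eq) (auto simp: card_image)
    have lt: "leaves ?t = map (\<lambda>i. Suc (f i)) [0..<length rs]"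
    proof -
      have "[1..<length rs + 1] = map Suc [0..<length rs]" by (simp add: map_Suc_upt)
      then show ?thesis using u(2) t0(2) by (simp add: leaves_relabel)
    qed
    have "distinct (leaves ?t)" using inj unfolding lt by (simp add: distinct_map inj_on_def)
    moreover have "set (leaves ?t) = {1..length (leaves ?t)}"
    proof -
      have "set (leaves ?t) = Suc ` f ` {..<length rs}" unfolding lt by (simp add: image_image lessThan_atLeast0)
      then show ?thesis unfolding lt fim by (simp add: image_Suc_lessThan)
    qed
    ultimately have to: "?t \<in> ops (tree_operad ?S)" using over by (simp add: mem_ops_tree over_sig_relabel)
    have "cut_value d ?t = (rs, C)"
    proof (rule cut_value_eqI)
      show "distinct (leaves ?t)" by fact
      show "length rs = length (leaves ?t)" unfolding lt by simp
      show "C = cuts d ?U ?t" by (simp add: cuts_relabel cu)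
      fix j assume "j < length rs"
      then obtain i where "i < length rs" "f i = j" using fim by (metis imageE lessThan_iff)
      then show "(Suc j, rs ! j) \<in> named_boxes ?U ?t" unfolding nbt using f(2) by force
    qed
    then show "c \<in> cut_value d ` ops (tree_operad ?S)" using to c(1) by (metis imageI)
  qed
qed

lemma cut_sig_pos: "(s, m) \<in> cut_sig K L \<Longrightarrow> 1 \<le> m"
  by (auto simp: cut_sig_def)

lemma cut_tree_is_operad: "is_operad (tree_operad (cut_sig K L))"
  by (rule tree_operad_is_operad) (rule cut_sig_pos)

lemma cut_operad_is_operad: "is_operad (cut_operad d L)"
  by (rule hom_image_operad[OF cut_tree_is_operad cut_value_hom cut_value_surj])

text \<open>The structure maps of \<open>tree_operad S\<close> are independent of \<open>S\<close>;
  a smaller signature only restricts the set of operations.\<close>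

lemma hom_tree_mono:
  assumes "S \<subseteq> S'" and h: "operad_hom h (tree_operad S') P"
  shows "operad_hom h (tree_operad S) P"
proof -
  have over: "over_sig S t \<Longrightarrow> over_sig S' t" for t
    by (induction t rule: leaves.induct) (use assms(1) in auto)
  then have sub: "ops (tree_operad S) \<subseteq> ops (tree_operad S')" by (auto simp: mem_ops_tree)
  then have "composable (tree_operad S) t qs \<Longrightarrow> composable (tree_operad S') t qs" for t qs
    by (auto simp: composable_tree)
  then show ?thesis
    using h sub unfolding operad_hom_def tree_operad_simps by blast
qed


section \<open>Exchange of consecutive cuts\<close>

text \<open>The subtrees form a grid \<open>f i j\<close>, read by rows on one side and by columns
  on the other. With \<open>m\<close> and \<open>m'\<close> positive, both symbols occur on both
  sides, so an exchange does not leave the trees over a given signature. Leaf names are arbitrary,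
  as exchanges take place inside subtrees.\<close>

inductive cut_eq :: "(nat \<times> nat \<times> 'l) tree \<Rightarrow> (nat \<times> nat \<times> 'l) tree \<Rightarrow> bool" where
  cut_eq_refl: "cut_eq t t"
| cut_eq_sym: "cut_eq s t \<Longrightarrow> cut_eq t s"
| cut_eq_trans: "cut_eq s t \<Longrightarrow> cut_eq t u \<Longrightarrow> cut_eq s u"
| cut_eq_Node: "list_all2 cut_eq ts us \<Longrightarrow> cut_eq (Node s ts) (Node s us)"
| cut_eq_swap: "k \<noteq> k' \<Longrightarrow> 0 < m \<Longrightarrow> 0 < m' \<Longrightarrow>
    cut_eq (Node (Gen (k, m, w)) (map (\<lambda>i. Node (Gen (k', m', w')) (map (\<lambda>j. f i j) [0..<m'])) [0..<m]))
      (Node (Gen (k', m', w')) (map (\<lambda>j. Node (Gen (k, m, w)) (map (\<lambda>i. f i j) [0..<m])) [0..<m']))"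

lemma cut_eq_over_sig: "cut_eq s t \<Longrightarrow> over_sig S s \<longleftrightarrow> over_sig S t"
proof (induction rule: cut_eq.induct)
  case (cut_eq_Node ts us s)
  have "length ts = length us \<and> ((\<forall>t\<in>set ts. over_sig S t) \<longleftrightarrow> (\<forall>t\<in>set us. over_sig S t))"
    using cut_eq_Node by (induction rule: list_all2_induct) auto
  then show ?case by simp
next
  case (cut_eq_swap k k' m m' w w' f)
  then show ?case by force
qed auto

lemma mset_concat_upt: "mset (concat (map g [0..<m])) = (\<Sum>i<m. mset (g i))"
  by (induction m) (simp_all add: upt_Suc)

lemma cut_eq_leaves: "cut_eq s t \<Longrightarrow> mset (leaves s) = mset (leaves t)"
proof (induction rule: cut_eq.induct)
  case (cut_eq_Node ts us s)
  then show ?case by (induction rule: list_all2_induct) auto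
next
  case (cut_eq_swap k k' m m' w w' f)
  have "(\<Sum>i<m. \<Sum>j<m'. mset (leaves (f i j))) = (\<Sum>j<m'. \<Sum>i<m. mset (leaves (f i j)))"
    by (rule sum.swap)
  then show ?case by (simp add: comp_def mset_concat_upt del: mset_concat)
qed auto

text \<open>Cuts in different directions change different coordinates of the corners, and the
  position of a cut depends on its own coordinate alone.\<close>

lemma box_part_commute:
  "k \<noteq> k' \<Longrightarrow> box_part (box_part R k m l) k' m' l' = box_part (box_part R k' m' l') k m l"
  by (auto simp: box_part_def cut_pos_eq fun_upd_twist)

lemma cut_eq_named_boxes: "cut_eq s t \<Longrightarrow> named_boxes R s = named_boxes R t"
proof (induction arbitrary: R rule: cut_eq.induct)
  case (cut_eq_Node ts us s)
  have "named_boxes (part R s (Suc l)) (ts ! l) = named_boxes (part R s (Suc l)) (us ! l)"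
    if "l < length ts" for l
    using list_all2_nthD[OF cut_eq_Node that] by blast
  then show ?case using list_all2_lengthD[OF cut_eq_Node] by simp
next
  case (cut_eq_swap k k' m m' w w' f)
  then show ?case by (auto simp: box_part_commute[of k k'])
qed auto

section \<open>Cuts running through all parts of another cut\<close>

lemma cut_coord_locate:
  assumes "0 < m" "a \<le> y" "y \<le> b"
  obtains l where "l < m" "cut_coord a b m l \<le> y" "y \<le> cut_coord a b m (Suc l)"
proof -
  define l where "l = (LEAST l. y \<le> cut_coord a b m l)"
  have ex: "y \<le> cut_coord a b m m" using assms by (simp add: cut_coord_last)
  then have l: "y \<le> cut_coord a b m l" "l \<le> m" unfolding l_def by (rule LeastI, rule Least_le)
  show ?thesis
  proof (cases l)
    case 0
    then have "y = a" using l(1) assms by (simp add: cut_coord_0)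
    moreover have "a \<le> cut_coord a b m 1" using assms by (simp add: cut_coord_eq)
    ultimately show ?thesis using that[of 0] assms by (simp add: cut_coord_0)
  next
    case (Suc n)
    have "\<not> y \<le> cut_coord a b m n" using not_less_Least[of n "\<lambda>l. y \<le> cut_coord a b m l"] Suc l_def by simp
    then show ?thesis using that[of n] l Suc by simp
  qed
qed

lemma box_pts_parts:
  assumes R: "rational_box d R" and k: "k \<in> {1..d}" and m: "0 < m"
  shows "(\<Union>l<m. box_pts d (box_part R k m (Suc l))) = box_pts d R"
proof (intro equalityI subsetI)
  fix x assume "x \<in> (\<Union>l<m. box_pts d (box_part R k m (Suc l)))"
  then obtain l where l: "l < m" "x \<in> box_pts d (box_part R k m (Suc l))" by blast
  have "subbox d (box_part R k m (Suc l)) R" by (rule subbox_part[OF R k l(1)])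
  then show "x \<in> box_pts d R"
    using l(2) unfolding box_pts_def subbox_def by (auto simp: PiE_iff intro: order_trans)
next
  fix x assume x: "x \<in> box_pts d R"
  then have "fst R k \<le> x k" "x k \<le> snd R k" using k by (auto simp: box_pts_def PiE_iff)
  then obtain l where "l < m" "cut_coord (fst R k) (snd R k) m l \<le> x k"
    "x k \<le> cut_coord (fst R k) (snd R k) m (Suc l)" using cut_coord_locate[OF m] by metis
  then show "x \<in> (\<Union>l<m. box_pts d (box_part R k m (Suc l)))"
    using x by (auto simp: box_pts_def PiE_iff fst_box_part snd_box_part intro!: bexI[of _ l])
qed

text \<open>This is why an exchange leaves the picture unchanged: a cut in direction
  \<open>k'\<close> repeated in all parts of a cut in direction \<open>k\<close> has the same
  positions everywhere, and the closed parts cover \<open>R\<close>.\<close>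

lemma own_cuts_parts:
  fixes s :: "(nat \<times> nat \<times> 'l, 't) sym"
  assumes R: "rational_box d R" and k: "k \<in> {1..d}" and m: "0 < m" and kk: "k \<noteq> k'"
    and s: "s = Gen (k', m', w')"
  shows "(\<Union>l<m. own_cuts d (box_part R k m (Suc l)) s) = own_cuts d R s"
proof -
  have "cut_pos (box_part R k m l) k' m' l' = cut_pos R k' m' l'" for l l'
    using kk by (simp add: box_part_def cut_pos_eq)
  then show ?thesis unfolding s own_cuts.simps box_pts_parts[OF R k m, symmetric] by auto
qed

lemma cut_eq_cuts:
  assumes "cut_eq s t" "K \<subseteq> {1..d}" "over_sig (cut_sig K L) s" "rational_box d R"
  shows "cuts d R s = cuts d R t"
  using assms(1,3,4)
proof (induction arbitrary: R rule: cut_eq.induct)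
  case (cut_eq_sym s t)
  then show ?case using cut_eq_over_sig by metis
next
  case (cut_eq_trans s t u)
  then show ?case using cut_eq_over_sig by metis
next
  case (cut_eq_Node ts us s)
  obtain k w where s: "s = Gen (k, length ts, w)" "k \<in> {1..d}"
    using over_sig_cut_Node[OF cut_eq_Node(2) assms(2)] by metis
  have "cuts d (part R s (Suc l)) (ts ! l) = cuts d (part R s (Suc l)) (us ! l)" if "l < length ts" for l
  proof -
    have "rational_box d (part R s (Suc l))" using rational_box_part[OF cut_eq_Node(3) s(2) that] s(1) by simp
    moreover have "over_sig (cut_sig K L) (ts ! l)" using cut_eq_Node(2) that by simp
    ultimately show ?thesis using list_all2_nthD[OF cut_eq_Node(1) that] by blast
  qed
  then show ?case using list_all2_lengthD[OF cut_eq_Node(1)] by simp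
next
  case (cut_eq_swap k k' m m' w w' f)
  \<comment> \<open>The first row of the grid exists because \<open>m\<close> is positive; it shows
    that \<open>k'\<close> is an admissible direction.\<close>
  have "over_sig (cut_sig K L) (Node (Gen (k', m', w')) (map (\<lambda>j. f 0 j) [0..<m']))"
    using cut_eq_swap(2,4) by auto
  then have k: "k \<in> {1..d}" "k' \<in> {1..d}"
    using cut_eq_swap(4) assms(2) by (auto simp: cut_sig_def)
  let ?g = "Gen (k, m, w) :: (nat \<times> nat \<times> 'a, (nat \<times> nat \<times> 'a) tree) sym"
    and ?g' = "Gen (k', m', w') :: (nat \<times> nat \<times> 'a, (nat \<times> nat \<times> 'a) tree) sym"
  let ?Q = "\<lambda>i j. box_part (box_part R k m (Suc i)) k' m' (Suc j)"
  have "cuts d R (Node ?g (map (\<lambda>i. Node ?g' (map (\<lambda>j. f i j) [0..<m'])) [0..<m]))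
    = own_cuts d R ?g \<union> ((\<Union>i<m. own_cuts d (box_part R k m (Suc i)) ?g') \<union> (\<Union>i<m. \<Union>j<m'. cuts d (?Q i j) (f i j)))"
    unfolding UN_Un_distrib[symmetric] by (simp del: own_cuts.simps)
  also have "\<dots> = own_cuts d R ?g \<union> (own_cuts d R ?g' \<union> (\<Union>i<m. \<Union>j<m'. cuts d (?Q i j) (f i j)))"
    unfolding own_cuts_parts[OF cut_eq_swap(5) k(1) cut_eq_swap(2,1) refl] ..
  also have "\<dots> = own_cuts d R ?g' \<union> (own_cuts d R ?g \<union> (\<Union>j<m'. \<Union>i<m. cuts d (?Q i j) (f i j)))"
    by blast
  also have "\<dots> = own_cuts d R ?g' \<union> ((\<Union>j<m'. own_cuts d (box_part R k' m' (Suc j)) ?g) \<union> (\<Union>j<m'. \<Union>i<m. cuts d (?Q i j) (f i j)))"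
    unfolding own_cuts_parts[OF cut_eq_swap(5) k(2) cut_eq_swap(3) cut_eq_swap(1)[symmetric] refl] ..
  also have "\<dots> = cuts d R (Node ?g' (map (\<lambda>j. Node ?g (map (\<lambda>i. f i j) [0..<m])) [0..<m']))"
    unfolding UN_Un_distrib[symmetric] box_part_commute[OF cut_eq_swap(1)] by (simp del: own_cuts.simps)
  finally show ?case .
qed simp

text \<open>The cut in direction \<open>k\<close> sinks through \<open>s\<close> vertex by vertex.
  It never meets a cut in its own direction, and the trees below it are copies of \<open>s\<close>
  that differ only in what is grafted at the leaves, which provides the grids for the
  exchanges.\<close>

lemma cut_eq_graft_Node:
  assumes "over_sig (cut_sig K L) s" "k \<notin> K" "0 < m"
  shows "cut_eq (Node (Gen (k, m, w)) (map (\<lambda>a. graft (G a) s) [0..<m]))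
    (graft (\<lambda>j. Node (Gen (k, m, w)) (map (\<lambda>a. G a j) [0..<m])) s)"
  using assms(1)
proof (induction s rule: leaves.induct)
  case (1 j)
  then show ?case by (simp add: cut_eq_refl)
next
  case (2 g ss)
  then obtain k' w' where g: "g = Gen (k', length ss, w')" "k' \<in> K" "2 \<le> length ss"
    by (auto simp: cut_sig_def)
  have len: "0 < length ss" using g(3) by linarith
  have mp: "map h ss = map (\<lambda>b. h (ss ! b)) [0..<length ss]" for h :: "_ \<Rightarrow> (nat \<times> nat \<times> 'a) tree"
    by (intro nth_equalityI) auto
  have "cut_eq (Node (Gen (k, m, w)) (map (\<lambda>a. Node g (map (\<lambda>b. graft (G a) (ss ! b)) [0..<length ss])) [0..<m]))
    (Node g (map (\<lambda>b. Node (Gen (k, m, w)) (map (\<lambda>a. graft (G a) (ss ! b)) [0..<m])) [0..<length ss]))"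
    unfolding g(1) using g(2) len assms by (intro cut_eq_swap) auto
  moreover have "cut_eq (Node g (map (\<lambda>b. Node (Gen (k, m, w)) (map (\<lambda>a. graft (G a) (ss ! b)) [0..<m])) [0..<length ss]))
    (Node g (map (\<lambda>b. graft (\<lambda>j. Node (Gen (k, m, w)) (map (\<lambda>a. G a j) [0..<m])) (ss ! b)) [0..<length ss]))"
    using 2 by (intro cut_eq_Node) (auto simp: list_all2_conv_all_nth)
  ultimately show ?case unfolding graft.simps mp by (rule cut_eq_trans)
qed

text \<open>By induction \<open>s\<close> rises above each child of the root of \<open>t\<close>;
  then this root sinks through the copies of \<open>s\<close> by
  \<open>cut_eq_graft_Node\<close>.\<close>

lemma cut_eq_product:
  assumes "over_sig (cut_sig K L) t" "over_sig (cut_sig K' L') s" "K \<inter> K' = {}"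
  shows "cut_eq (graft (\<lambda>i. graft (F i) s) t) (graft (\<lambda>j. graft (\<lambda>i. F i j) t) s)"
  using assms(1)
proof (induction t rule: leaves.induct)
  case (1 i)
  then show ?case by (simp add: cut_eq_refl)
next
  case (2 g ts)
  then obtain k w where g: "g = Gen (k, length ts, w)" "k \<in> K" "2 \<le> length ts"
    by (auto simp: cut_sig_def)
  have len: "0 < length ts" using g(3) by linarith
  have mp: "map h ts = map (\<lambda>b. h (ts ! b)) [0..<length ts]" for h :: "_ \<Rightarrow> (nat \<times> nat \<times> 'a) tree"
    by (intro nth_equalityI) auto
  have "cut_eq (Node g (map (graft (\<lambda>i. graft (F i) s)) ts)) (Node g (map (\<lambda>t. graft (\<lambda>j. graft (\<lambda>i. F i j) t) s) ts))"
    using 2 by (intro cut_eq_Node) (auto simp: list_all2_conv_all_nth)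
  moreover have "cut_eq (Node g (map (\<lambda>t. graft (\<lambda>j. graft (\<lambda>i. F i j) t) s) ts))
      (graft (\<lambda>j. Node g (map (\<lambda>t. graft (\<lambda>i. F i j) t) ts)) s)"
    unfolding mp g(1) using g(2) assms(3) by (intro cut_eq_graft_Node[OF assms(2) _ len]) auto
  ultimately show ?case unfolding graft.simps by (rule cut_eq_trans)
qed

text \<open>On both sides of the interchange relation the leaf at \<open>i\<close> in
  \<open>t\<close> and \<open>j\<close> in \<open>s\<close> is named by its place in one table read
  by rows. So the sides are the two arrangements of a single grid, and \<open>cut_eq_product\<close>
  relates them.\<close>

lemma cut_value_interchanges:
  assumes t: "t \<in> ops (tree_operad (cut_sig K L))" and s: "s \<in> ops (tree_operad (cut_sig K' L))"
    and K: "K \<subseteq> {1..d}" "K' \<subseteq> {1..d}" "K \<inter> K' = {}"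
  shows "interchanges (cut_operad d L) (cut_value d t) (cut_value d s)"
proof -
  let ?S = "cut_sig {1..d} L" and ?T = "tree_operad (cut_sig {1..d} L)"
  have over: "over_sig S' u \<Longrightarrow> S' \<subseteq> S'' \<Longrightarrow> over_sig S'' u"
    for S' S'' :: "((nat \<times> nat \<times> 'a, (nat \<times> nat \<times> 'a) tree) sym \<times> nat) set" and u
    by (induction u rule: leaves.induct) auto
  have t': "t \<in> ops ?T" and s': "s \<in> ops ?T"
    using t s over cut_sig_mono[OF K(1), of L] cut_sig_mono[OF K(2), of L] by (auto simp: mem_ops_tree)
  note T = cut_tree_is_operad[of "{1..d}" L] and h = cut_value_hom[of d L]
  note sides = interchange_sides[OF T t' s'] and hs = hom_interchange_sides[OF T h t' s']
  let ?k = "length (leaves t)" and ?l = "length (leaves s)"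
  let ?lhs = "compose ?T t (replicate (arity ?T t) s)"
    and ?rhs = "act ?T (compose ?T s (replicate (arity ?T s) t)) (exchange_perm (arity ?T t) (arity ?T s))"
  have lhs: "?lhs = graft (\<lambda>i. graft (\<lambda>j. Leaf ((i - 1) * ?l + j)) s) t"
  proof -
    have "shifted (replicate ?k s) i = graft (\<lambda>j. Leaf ((i - 1) * ?l + j)) s" if "i \<in> set (leaves t)" for i
      using that t by (auto simp: mem_ops_tree shifted_def relabel_def take_replicate sum_list_replicate min_def)
    then show ?thesis unfolding tree_operad_simps by (rule graft_cong)
  qed
  \<comment> \<open>Before the action the table is numbered by columns; the exchange permutation
    converts this to rows.\<close>
  have rhs: "?rhs = graft (\<lambda>j. graft (\<lambda>i. Leaf ((i - 1) * ?l + j)) t) s"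
  proof -
    have e: "inv (exchange_perm ?k ?l) ((j - 1) * ?k + i) = (i - 1) * ?l + j"
      if "i \<in> set (leaves t)" "j \<in> set (leaves s)" for i j
    proof -
      have ij: "i - 1 < ?k" "1 \<le> i" "j - 1 < ?l" "1 \<le> j" using that t s by (auto simp: mem_ops_tree)
      have "exchange_perm ?k ?l ((i - 1) * ?l + (j - 1) + 1) = (j - 1) * ?k + (i - 1) + 1"
        by (rule exchange_perm_apply[OF ij(1,3)])
      then have "exchange_perm ?k ?l ((i - 1) * ?l + j) = (j - 1) * ?k + i" using ij by simp
      then show ?thesis using permutes_inverses(2)[OF exchange_perm_permutes[of ?k ?l]] by metis
    qed
    have "relabel (inv (exchange_perm ?k ?l)) (shifted (replicate ?l t) j) = graft (\<lambda>i. Leaf ((i - 1) * ?l + j)) t"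
      if j: "j \<in> set (leaves s)" for j
    proof -
      have "shifted (replicate ?l t) j = relabel (\<lambda>i. (j - 1) * ?k + i) t"
        using j s by (auto simp: mem_ops_tree shifted_def take_replicate sum_list_replicate min_def)
      then show ?thesis
        unfolding relabel_def[of "\<lambda>i. (i - 1) * ?l + j", symmetric] using e j
        by (simp add: relabel_relabel) (rule relabel_cong, simp)
    qed
    then show ?thesis unfolding tree_operad_simps relabel_graft by (rule graft_cong)
  qed
  have over': "over_sig (cut_sig K L) t" "over_sig (cut_sig K' L) s" using t s by (auto simp: mem_ops_tree)
  have eq: "cut_eq ?lhs ?rhs" unfolding lhs rhs by (rule cut_eq_product[OF over' K(3)])
  have "over_sig ?S ?lhs" using sides(1) by (simp add: mem_ops_tree)
  then have "cut_value d ?lhs = cut_value d ?rhs"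
    using cut_eq_named_boxes[OF eq] cut_eq_cuts[OF eq order_refl _ rational_unit_box]
    by (intro cut_value_cong[OF sides(1,3)]) blast+
  then show ?thesis unfolding interchanges_def hs .
qed


section \<open>Exchange in operads with interchanging generators\<close>

context
  fixes h :: "(nat \<times> nat \<times> 'l) tree \<Rightarrow> 'b" and A :: "'b operad" and K :: "nat set"
    and L :: "nat \<Rightarrow> nat \<Rightarrow> 'l set"
  assumes h: "operad_hom h (tree_operad (cut_sig K L)) A"
    and inter: "\<And>k k' m m' w w'. (Gen (k, m, w), m) \<in> cut_sig K L \<Longrightarrow> (Gen (k', m', w'), m') \<in> cut_sig K L \<Longrightarrow>
      k < k' \<Longrightarrow> interchanges A (h (corolla (Gen (k, m, w)) m)) (h (corolla (Gen (k', m', w')) m'))"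
begin

text \<open>The kernel of \<open>h\<close>, extended to trees whose leaves carry arbitrary names.\<close>

definition kernel :: "(nat \<times> nat \<times> 'l) tree \<Rightarrow> (nat \<times> nat \<times> 'l) tree \<Rightarrow> bool" where
  "kernel s t \<longleftrightarrow> (\<exists>u u' \<rho>. u \<in> ops (tree_operad (cut_sig K L)) \<and> u' \<in> ops (tree_operad (cut_sig K L)) \<and>
     h u = h u' \<and> s = relabel \<rho> u \<and> t = relabel \<rho> u')"

lemma kernel_refl:
  assumes "over_sig (cut_sig K L) t"
  shows "kernel t t"
proof -
  obtain u where "u \<in> ops (tree_operad (cut_sig K L))" "t = relabel (\<lambda>i. leaves t ! (i - 1)) u"
    by (rule standardize[OF assms, of UNIV]) auto
  then show ?thesis unfolding kernel_def by metis
qed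

lemma kernel_sym: "kernel s t \<Longrightarrow> kernel t s"
  unfolding kernel_def by metis

lemma kernel_act:
  assumes u: "u \<in> ops (tree_operad (cut_sig K L))" "u' \<in> ops (tree_operad (cut_sig K L))" "h u = h u'"
    and \<pi>: "\<pi> permutes {1..length (leaves u)}"
  shows "relabel \<pi> u \<in> ops (tree_operad (cut_sig K L))" "relabel \<pi> u' \<in> ops (tree_operad (cut_sig K L))"
    "h (relabel \<pi> u) = h (relabel \<pi> u')"
proof -
  let ?T = "tree_operad (cut_sig K L)"
  have ar: "arity ?T u = arity ?T u'" using hom_arity[OF h] u by metis
  have p: "inv \<pi> permutes {1..arity ?T u}" "inv \<pi> permutes {1..arity ?T u'}"
    using permutes_inv[OF \<pi>] ar by (simp_all add: tree_operad_simps)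
  have r: "relabel \<pi> u = act ?T u (inv \<pi>)" "relabel \<pi> u' = act ?T u' (inv \<pi>)"
    using permutes_inv_inv[OF \<pi>] by (simp_all add: tree_operad_simps)
  show "relabel \<pi> u \<in> ops ?T" "relabel \<pi> u' \<in> ops ?T"
    unfolding r by (rule operad_act[OF cut_tree_is_operad] u p)+
  show "h (relabel \<pi> u) = h (relabel \<pi> u')"
    unfolding r hom_act[OF h u(1) p(1)] hom_act[OF h u(2) p(2)] u(3) ..
qed

text \<open>The two assumptions describe \<open>t\<close> by operations \<open>u'\<close> and
  \<open>v\<close> with different renamings. As the leaf names of \<open>t\<close> are distinct,
  both renamings are injective on the names in use and differ by a permutation \<open>\<pi>\<close>,
  which \<open>h\<close> respects.\<close>

lemma kernel_trans:
  assumes "kernel s t" "kernel t w" and dist: "distinct (leaves t)"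
  shows "kernel s w"
proof -
  let ?T = "tree_operad (cut_sig K L)"
  obtain u u' \<rho> where u: "u \<in> ops ?T" "u' \<in> ops ?T" "h u = h u'" "s = relabel \<rho> u" "t = relabel \<rho> u'"
    using assms(1) unfolding kernel_def by blast
  obtain v v' \<tau> where v: "v \<in> ops ?T" "v' \<in> ops ?T" "h v = h v'" "t = relabel \<tau> v" "w = relabel \<tau> v'"
    using assms(2) unfolding kernel_def by blast
  define n where "n = length (leaves t)"
  have lens: "length (leaves u') = n" "length (leaves v) = n" unfolding n_def
    using u(5) v(4) by (metis leaves_relabel length_map)+
  have "length (leaves u) = n" using hom_arity[OF h u(1)] hom_arity[OF h u(2)] u(3) lens by (simp add: tree_operad_simps)
  note lens = lens this
  have sets: "set (leaves u) = {1..n}" "set (leaves u') = {1..n}" "set (leaves v) = {1..n}"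
    using u(1,2) v(1) lens by (auto simp: mem_ops_tree)
  have \<rho>: "inj_on \<rho> {1..n}" and \<tau>: "inj_on \<tau> {1..n}" and im: "\<rho> ` {1..n} = \<tau> ` {1..n}"
    using dist u(5) v(4) sets by (metis leaves_relabel distinct_map set_map)+
  define \<pi> where "\<pi> x = (if x \<in> {1..n} then inv_into {1..n} \<tau> (\<rho> x) else x)" for x
  have \<tau>\<pi>: "\<tau> (\<pi> x) = \<rho> x" "\<pi> x \<in> {1..n}" if "x \<in> {1..n}" for x
    using that im unfolding \<pi>_def by (auto intro!: f_inv_into_f inv_into_into simp del: atLeastAtMost_iff)
  have "inj_on \<pi> {1..n}"
    using \<tau>\<pi>(1) \<rho> by (metis inj_on_def)
  then have "bij_betw \<pi> {1..n} {1..n}"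
    using \<tau>\<pi>(2) by (simp add: bij_betw_def endo_inj_surj image_subset_iff)
  then have \<pi>: "\<pi> permutes {1..n}" by (rule bij_imp_permutes) (auto simp: \<pi>_def)
  have "relabel \<tau> (relabel \<pi> u') = relabel \<tau> v"
    using u(5) v(4) \<tau>\<pi>(1) sets by (metis (no_types, lifting) relabel_cong relabel_relabel)
  then have "relabel (inv_into {1..n} \<tau>) (relabel \<tau> (relabel \<pi> u')) = relabel (inv_into {1..n} \<tau>) (relabel \<tau> v)"
    by simp
  moreover have "relabel (inv_into {1..n} \<tau>) (relabel \<tau> x) = x" if "set (leaves x) = {1..n}" for x :: "(nat \<times> nat \<times> 'l) tree"
    unfolding relabel_relabel using \<tau> that by (intro relabel_id) simp
  moreover have "set (leaves (relabel \<pi> u')) = {1..n}"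
    using permutes_image[OF \<pi>] sets by (simp add: leaves_relabel)
  ultimately have \<pi>u': "relabel \<pi> u' = v" using sets by simp
  have \<pi>': "\<pi> permutes {1..length (leaves u)}" using \<pi> lens by simp
  note ka = kernel_act[OF u(1-3) \<pi>']
  have "s = relabel \<tau> (relabel \<pi> u)"
    unfolding u(4) relabel_relabel using \<tau>\<pi>(1) sets by (intro relabel_cong) simp
  moreover have "h (relabel \<pi> u) = h v'" using ka(3) \<pi>u' v(3) by simp
  ultimately show ?thesis unfolding kernel_def using ka(1) v(2,5) by blast
qed

text \<open>Every argument comes with its own renaming \<open>\<rho> i\<close>. In the composite
  operation the arguments have disjoint blocks of names, so these renamings combine to a single
  one.\<close>

lemma kernel_graft:
  assumes p: "p \<in> ops (tree_operad (cut_sig K L))" "p' \<in> ops (tree_operad (cut_sig K L))" "h p = h p'"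
    and n: "n = length (leaves p)"
    and v: "\<And>i. i \<in> {1..n} \<Longrightarrow> v i \<in> ops (tree_operad (cut_sig K L))"
      "\<And>i. i \<in> {1..n} \<Longrightarrow> v' i \<in> ops (tree_operad (cut_sig K L))"
      "\<And>i. i \<in> {1..n} \<Longrightarrow> h (v i) = h (v' i)"
  shows "kernel (graft (\<lambda>i. relabel (\<rho> i) (v i)) p) (graft (\<lambda>i. relabel (\<rho> i) (v' i)) p')"
proof -
  let ?T = "tree_operad (cut_sig K L)"
  let ?vs = "map v [1..<n + 1]" and ?vs' = "map v' [1..<n + 1]"
  have n': "length (leaves p') = n"
    using hom_arity[OF h p(1)] hom_arity[OF h p(2)] p(3) n by (simp add: tree_operad_simps)
  have c: "composable ?T p ?vs" "composable ?T p' ?vs'"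
    using p v n n' by (auto simp: composable_tree)
  have ar: "length (leaves (v i)) = length (leaves (v' i))" if "i \<in> {1..n}" for i
    using hom_arity[OF h v(1)[OF that]] hom_arity[OF h v(2)[OF that]] v(3)[OF that] by (simp add: tree_operad_simps)
  let ?xss = "map (\<lambda>i. map (\<rho> i) [1..<length (leaves (v i)) + 1]) [1..<n + 1]"
  \<comment> \<open>\<open>lperm\<close> serves as a lookup in the list of new names;
    \<open>\<sigma>\<close> is in general no permutation.\<close>
  define \<sigma> where "\<sigma> = lperm (concat ?xss)"
  have lens: "map length ?xss = map (\<lambda>q. length (leaves q)) ?vs" "map length ?xss = map (\<lambda>q. length (leaves q)) ?vs'"
    using ar by auto
  have \<sigma>: "\<sigma> (sum_list (take (i - 1) (map length ?xss)) + j) = \<rho> i j"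
    if i: "i \<in> {1..n}" and j: "j \<in> {1..length (leaves (v i))}" for i j
  proof -
    have x: "?xss ! (i - 1) = map (\<rho> i) [1..<length (leaves (v i)) + 1]" by (rule nth_map_upt_one[OF i])
    have "\<sigma> (sum_list (take (i - 1) (map length ?xss)) + j) = ?xss ! (i - 1) ! (j - 1)"
      unfolding \<sigma>_def using i j by (intro lperm_concat_block) (simp_all only: x, simp_all)
    also have "\<dots> = \<rho> i j" unfolding x by (rule nth_map_upt_one[OF j])
    finally show ?thesis .
  qed
  have key: "relabel \<sigma> (graft (shifted (map y [1..<n + 1])) q) = graft (\<lambda>i. relabel (\<rho> i) (y i)) q"
    if q: "q \<in> ops ?T" "length (leaves q) = n" and y: "\<And>i. i \<in> {1..n} \<Longrightarrow> y i \<in> ops ?T"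
      "\<And>i. i \<in> {1..n} \<Longrightarrow> length (leaves (y i)) = length (leaves (v i))"
      and ys: "map length ?xss = map (\<lambda>q. length (leaves q)) (map y [1..<n + 1])" for y q
    unfolding relabel_graft
  proof (rule graft_cong)
    fix i assume "i \<in> set (leaves q)"
    then have i: "i \<in> {1..n}" using q by (simp add: mem_ops_tree)
    have yi: "map y [1..<n + 1] ! (i - 1) = y i" by (rule nth_map_upt_one[OF i])
    have "\<sigma> ((\<Sum>q\<leftarrow>take (i - 1) (map y [1..<n + 1]). length (leaves q)) + j) = \<rho> i j" if "j \<in> set (leaves (y i))" for j
    proof -
      have "j \<in> {1..length (leaves (v i))}" using y[OF i] that by (simp add: mem_ops_tree)
      from \<sigma>[OF i this] show ?thesis unfolding ys take_map .
    qed
    then show "relabel \<sigma> (shifted (map y [1..<n + 1]) i) = relabel (\<rho> i) (y i)"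
      unfolding shifted_def yi relabel_relabel by (rule relabel_cong)
  qed
  have "h (graft (shifted ?vs) p) = h (graft (shifted ?vs') p')"
  proof -
    have "map h ?vs = map h ?vs'" using v(3) by auto
    then show ?thesis
      using hom_compose[OF h c(1)] hom_compose[OF h c(2)] p(3) by (simp add: tree_operad_simps del: map_map map_eq_conv)
  qed
  then show ?thesis
    unfolding kernel_def
    using graft_shifted_ops(1)[OF c(1)] graft_shifted_ops(1)[OF c(2)]
      key[OF p(1) n[symmetric] v(1) refl lens(1)] key[OF p(2) n' v(2) ar[symmetric] lens(2)] by metis
qed

text \<open>Interchange of two corollas is an equation between two grids of leaves. Grafting the
  trees \<open>f i j\<close> onto both sides gives the exchange above arbitrary subtrees.\<close>

lemma kernel_swap:
  assumes g: "(Gen (k, m, w), m) \<in> cut_sig K L" "(Gen (k', m', w'), m') \<in> cut_sig K L" and kk: "k < k'"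
    and f: "\<And>i j. i < m \<Longrightarrow> j < m' \<Longrightarrow> over_sig (cut_sig K L) (f i j)"
  shows "kernel (Node (Gen (k, m, w)) (map (\<lambda>i. Node (Gen (k', m', w')) (map (\<lambda>j. f i j) [0..<m'])) [0..<m]))
      (Node (Gen (k', m', w')) (map (\<lambda>j. Node (Gen (k, m, w)) (map (\<lambda>i. f i j) [0..<m])) [0..<m']))"
proof -
  let ?T = "tree_operad (cut_sig K L)" and ?g = "Gen (k, m, w)" and ?g' = "Gen (k', m', w')"
  let ?c = "corolla ?g m" and ?c' = "corolla ?g' m'"
  note cc = corolla_ops[OF g(1)] corolla_ops[OF g(2)]
  note sides = interchange_sides[OF cut_tree_is_operad cc]
  let ?p = "compose ?T ?c (replicate (arity ?T ?c) ?c')"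
    and ?p' = "act ?T (compose ?T ?c' (replicate (arity ?T ?c') ?c)) (exchange_perm (arity ?T ?c) (arity ?T ?c'))"
  have ar: "arity ?T ?c = m" "arity ?T ?c' = m'" by (simp_all add: tree_operad_simps leaves_corolla)
  have hp: "h ?p = h ?p'"
    using inter[OF g kk] unfolding hom_interchange_sides[OF cut_tree_is_operad h cc] interchanges_def .
  have u: "[1..<n + 1] = map Suc [0..<n]" for n by (simp add: map_Suc_upt)
  have rc: "relabel r (corolla x n) = Node x (map (\<lambda>i. Leaf (r (i + 1))) [0..<n])"
    for r n and x :: "(nat \<times> nat \<times> 'l, (nat \<times> nat \<times> 'l) tree) sym"
    by (simp add: corolla_def relabel_def u[simplified])
  have sh: "shifted (replicate n (corolla x n')) (Suc i) = Node x (map (\<lambda>j. Leaf (i * n' + j + 1)) [0..<n'])"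
    if "i < n" for n n' i and x :: "(nat \<times> nat \<times> 'l, (nat \<times> nat \<times> 'l) tree) sym"
    using that by (simp add: shifted_def take_replicate sum_list_replicate min_def leaves_corolla rc)
  have p: "?p = Node ?g (map (\<lambda>i. Node ?g' (map (\<lambda>j. Leaf (i * m' + j + 1)) [0..<m'])) [0..<m])"
    unfolding ar tree_operad_simps graft_corolla u by (simp add: sh leaves_corolla)
  have p': "?p' = Node ?g' (map (\<lambda>j. Node ?g (map (\<lambda>i. Leaf (i * m' + j + 1)) [0..<m])) [0..<m'])"
  proof -
    have "inv (exchange_perm m m') (j * m + i + 1) = i * m' + j + 1" if "i < m" "j < m'" for i j
      using exchange_perm_apply[OF that] permutes_inverses(2)[OF exchange_perm_permutes[of m m']] by metis
    then show ?thesis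
      unfolding ar tree_operad_simps graft_corolla u relabel_Node by (simp add: sh leaves_corolla relabel_Node relabel_def)
  qed
  \<comment> \<open>Decodes the leaf number \<open>i * m' + j + 1\<close> into row \<open>i\<close>
    and column \<open>j\<close>.\<close>
  let ?\<phi> = "\<lambda>x. f ((x - 1) div m') ((x - 1) mod m')"
  have np: "length (leaves ?p) = m * m'"
    using operad_arity_compose[OF cut_tree_is_operad composable_replicate[OF cc]]
    unfolding ar by (simp add: total_arity_def sum_list_replicate tree_operad_simps leaves_corolla)
  have "\<exists>u. u \<in> ops ?T \<and> ?\<phi> x = relabel (\<lambda>i. leaves (?\<phi> x) ! (i - 1)) u" if x: "x \<in> {1..m * m'}" for x
  proof -
    obtain i j where ij: "i < m" "j < m'" "x = i * m' + j + 1" using product_index_exists[OF x] .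
    then have "over_sig (cut_sig K L) (?\<phi> x)" using f by simp
    then show ?thesis by (rule standardize[of _ _ UNIV]) auto
  qed
  then obtain v where v: "\<And>x. x \<in> {1..m * m'} \<Longrightarrow> v x \<in> ops ?T"
    "\<And>x. x \<in> {1..m * m'} \<Longrightarrow> relabel (\<lambda>i. leaves (?\<phi> x) ! (i - 1)) (v x) = ?\<phi> x" by metis
  have "kernel (graft (\<lambda>x. relabel (\<lambda>i. leaves (?\<phi> x) ! (i - 1)) (v x)) ?p) (graft (\<lambda>x. relabel (\<lambda>i. leaves (?\<phi> x) ! (i - 1)) (v x)) ?p')"
    by (rule kernel_graft[OF sides(1,3) hp np[symmetric] v(1) v(1) refl])
  moreover have "graft (\<lambda>x. relabel (\<lambda>i. leaves (?\<phi> x) ! (i - 1)) (v x)) q = graft ?\<phi> q"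
    if "set (leaves q) = {1..m * m'}" for q :: "(nat \<times> nat \<times> 'l) tree"
    using v(2) that by (intro graft_cong) simp
  moreover have "set (leaves ?p) = {1..m * m'}" using sides(1) np by (simp add: mem_ops_tree)
  moreover have "set (leaves ?p') = {1..m * m'}" using sides(3,4) np by (simp add: mem_ops_tree tree_operad_simps(1))
  ultimately have "kernel (graft ?\<phi> ?p) (graft ?\<phi> ?p')" by simp
  moreover have "graft ?\<phi> ?p = Node ?g (map (\<lambda>i. Node ?g' (map (\<lambda>j. f i j) [0..<m'])) [0..<m])"
    unfolding p by auto
  moreover have "graft ?\<phi> ?p' = Node ?g' (map (\<lambda>j. Node ?g (map (\<lambda>i. f i j) [0..<m])) [0..<m'])"
    unfolding p' by auto
  ultimately show ?thesis by simp
qed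

text \<open>Distinctness of the names is carried along for \<open>kernel_trans\<close>. It passes to
  all trees in a chain of exchanges, which have the same multiset of leaf names, and to
  subtrees.\<close>

lemma cut_eq_kernel:
  "cut_eq s t \<Longrightarrow> over_sig (cut_sig K L) s \<Longrightarrow> distinct (leaves s) \<Longrightarrow> kernel s t"
proof (induction rule: cut_eq.induct)
  case (cut_eq_refl t)
  then show ?case by (simp add: kernel_refl)
next
  case (cut_eq_sym s t)
  then show ?case using cut_eq_over_sig cut_eq_leaves mset_eq_imp_distinct_iff kernel_sym by metis
next
  case (cut_eq_trans s t u)
  then have "over_sig (cut_sig K L) t" "distinct (leaves t)"
    using cut_eq_over_sig cut_eq_leaves mset_eq_imp_distinct_iff by metis+
  then show ?case using cut_eq_trans kernel_trans by blast
next
  case (cut_eq_Node ts us s)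
  let ?T = "tree_operad (cut_sig K L)" and ?m = "length ts"
  have s: "(s, ?m) \<in> cut_sig K L" using cut_eq_Node(2) by simp
  have len: "length us = ?m" using list_all2_lengthD[OF cut_eq_Node(1)] by simp
  have "\<exists>u u' \<rho>. u \<in> ops ?T \<and> u' \<in> ops ?T \<and> h u = h u' \<and> ts ! (i - 1) = relabel \<rho> u \<and> us ! (i - 1) = relabel \<rho> u'"
    if "i \<in> {1..?m}" for i
  proof -
    have i: "i - 1 < ?m" using that by auto
    have "over_sig (cut_sig K L) (ts ! (i - 1))" using cut_eq_Node(2) i by simp
    moreover have "distinct (leaves (ts ! (i - 1)))"
      using distinct_nth_concat[of "map leaves ts" "i - 1"] cut_eq_Node(3) i by simp
    ultimately have "kernel (ts ! (i - 1)) (us ! (i - 1))" using list_all2_nthD[OF cut_eq_Node(1) i] by blast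
    then show ?thesis unfolding kernel_def .
  qed
  then obtain u u' \<rho> where u: "\<And>i. i \<in> {1..?m} \<Longrightarrow> u i \<in> ops ?T" "\<And>i. i \<in> {1..?m} \<Longrightarrow> u' i \<in> ops ?T"
    "\<And>i. i \<in> {1..?m} \<Longrightarrow> h (u i) = h (u' i)" "\<And>i. i \<in> {1..?m} \<Longrightarrow> relabel (\<rho> i) (u i) = ts ! (i - 1)"
    "\<And>i. i \<in> {1..?m} \<Longrightarrow> relabel (\<rho> i) (u' i) = us ! (i - 1)" by metis
  have n: "?m = length (leaves (corolla s ?m))" by (simp add: leaves_corolla)
  have "kernel (graft (\<lambda>i. relabel (\<rho> i) (u i)) (corolla s ?m)) (graft (\<lambda>i. relabel (\<rho> i) (u' i)) (corolla s ?m))"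
    by (rule kernel_graft[OF corolla_ops[OF s] corolla_ops[OF s] refl n u(1-3)])
  moreover have "map (\<lambda>i. relabel (\<rho> i) (u i)) [1..<?m + 1] = ts" "map (\<lambda>i. relabel (\<rho> i) (u' i)) [1..<?m + 1] = us"
    using u(4,5)[of "Suc _"] len by (auto intro!: nth_equalityI simp: nth_map_upt)
  ultimately show ?case unfolding graft_corolla by simp
next
  case (cut_eq_swap k k' m m' w w' f)
  have g: "(Gen (k, m, w), m) \<in> cut_sig K L" "(Gen (k', m', w'), m') \<in> cut_sig K L"
    and f: "\<And>i j. i < m \<Longrightarrow> j < m' \<Longrightarrow> over_sig (cut_sig K L) (f i j)"
    using cut_eq_swap(2-4) by auto
  show ?case
  proof (cases "k < k'")
    case True
    show ?thesis by (rule kernel_swap[OF g True f])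
  next
    case False
    then have "k' < k" using cut_eq_swap(1) by simp
    \<comment> \<open>\<open>kernel_swap\<close> is stated for the smaller direction at the root, so
      the grid is read here with rows and columns exchanged.\<close>
    show ?thesis by (rule kernel_sym, rule kernel_swap[OF g(2,1) \<open>k' < k\<close>, of "\<lambda>j i. f i j"]) (rule f)
  qed
qed

text \<open>When \<open>s\<close> is itself an operation, its renaming restricts to a permutation of
  the names, so that the extended kernel is the actual one.\<close>

lemma kernel_ops:
  assumes "kernel s t" and s: "s \<in> ops (tree_operad (cut_sig K L))"
  shows "h s = h t"
proof -
  let ?T = "tree_operad (cut_sig K L)"
  obtain u u' \<rho> where u: "u \<in> ops ?T" "u' \<in> ops ?T" "h u = h u'" "s = relabel \<rho> u" "t = relabel \<rho> u'"
    using assms(1) unfolding kernel_def by blast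
  let ?n = "length (leaves s)"
  have lu: "length (leaves u) = ?n" using u(4) by (metis leaves_relabel length_map)
  have lu': "length (leaves u') = ?n"
    using hom_arity[OF h u(1)] hom_arity[OF h u(2)] u(3) lu by (simp add: tree_operad_simps)
  have sets: "set (leaves u) = {1..?n}" "set (leaves u') = {1..?n}" "set (leaves s) = {1..?n}"
    using u(1,2) s lu lu' by (auto simp: mem_ops_tree)
  define \<pi> where "\<pi> x = (if x \<in> {1..?n} then \<rho> x else x)" for x
  have "distinct (map \<rho> (leaves u))" "set (map \<rho> (leaves u)) = {1..?n}"
    using s sets(3) unfolding u(4) leaves_relabel[symmetric] by (simp_all add: mem_ops_tree)
  then have "bij_betw \<rho> {1..?n} {1..?n}" using sets(1) by (simp add: bij_betw_def distinct_map)
  then have "bij_betw \<pi> {1..?n} {1..?n}"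
    by (rule bij_betw_cong[THEN iffD1, rotated]) (simp add: \<pi>_def)
  then have \<pi>: "\<pi> permutes {1..length (leaves u)}" unfolding lu by (rule bij_imp_permutes) (auto simp: \<pi>_def)
  have "relabel \<rho> x = relabel \<pi> x" if "set (leaves x) = {1..?n}" for x :: "(nat \<times> nat \<times> 'l) tree"
    using that by (intro relabel_cong) (simp add: \<pi>_def)
  then have "s = relabel \<pi> u" "t = relabel \<pi> u'" using u(4,5) sets by metis+
  then show ?thesis using kernel_act(3)[OF u(1-3) \<pi>] by simp
qed

lemma cut_eq_hom:
  assumes "cut_eq s t" "s \<in> ops (tree_operad (cut_sig K L))"
  shows "h s = h t"
  using kernel_ops[OF cut_eq_kernel[OF assms(1)] assms(2)] assms(2) by (simp add: mem_ops_tree)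

end


section \<open>One-dimensional traces\<close>

text \<open>A tree with cuts in one direction only. Leaf names are dropped, since a line shows cuts
  and not the numbers of rectangles.\<close>

datatype 'a line = Uncut | Cut "nat \<times> 'a" "'a line list"

fun valid_line :: "'a line \<Rightarrow> bool" where
  "valid_line Uncut \<longleftrightarrow> True"
| "valid_line (Cut c ls) \<longleftrightarrow> 2 \<le> fst c \<and> length ls = fst c \<and> (\<forall>l\<in>set ls. valid_line l)"

lemma size_nth_less_plain [termination_simp]: "l < length ts \<Longrightarrow> size (ts ! l) < Suc (size_list size ts)"
  using size_list_estimation'[of "ts ! l" ts "size (ts ! l)" size] by simp

fun trace :: "real \<Rightarrow> real \<Rightarrow> 'a line \<Rightarrow> (real \<times> nat \<times> 'a) set" where
  "trace a b Uncut = {}"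
| "trace a b (Cut c ls) = (\<lambda>l. (cut_coord a b (fst c) l, c)) ` {1..<fst c} \<union>
     (\<Union>l\<in>{..<length ls}. trace (cut_coord a b (fst c) l) (cut_coord a b (fst c) (Suc l)) (ls ! l))"

lemma trace_bounds:
  "valid_line s \<Longrightarrow> a < b \<Longrightarrow> (p, c) \<in> trace a b s \<Longrightarrow> a < p \<and> p < b"
proof (induction a b s rule: trace.induct)
  case (2 a b c' ls)
  let ?m = "fst c'" and ?cc = "cut_coord a b (fst c')"
  have m: "0 < ?m" using 2(2) by auto
  note lt = cut_coord_less_iff[OF m 2(3)]
  consider (own) l where "l \<in> {1..<?m}" "p = ?cc l"
    | (child) l where "l < ?m" "(p, c) \<in> trace (?cc l) (?cc (Suc l)) (ls ! l)"
    using 2(2,4) by auto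
  then show ?case
  proof cases
    case own
    have "?cc 0 < ?cc l" "?cc l < ?cc ?m" unfolding lt using own(1) by auto
    then show ?thesis using own(2) by (simp add: cut_coord_0[OF m] cut_coord_last[OF m])
  next
    case child
    have "valid_line (ls ! l)" using 2(2) child by simp
    then have "?cc l < p \<and> p < ?cc (Suc l)" using 2(1)[of l] 2(2) child lt by simp
    moreover have "?cc 0 \<le> ?cc l" "?cc (Suc l) \<le> ?cc ?m"
      unfolding cut_coord_le_iff[OF m 2(3)] using child by auto
    ultimately show ?thesis by (simp add: cut_coord_0[OF m] cut_coord_last[OF m])
  qed
qed simp

text \<open>Root cuts sit at the ends of these open intervals, and every other child contributes
  only inside its own interval.\<close>

lemma trace_child:
  assumes v: "valid_line (Cut c ls)" and ab: "a < b" and l: "l < fst c"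
    and p: "cut_coord a b (fst c) l < p" "p < cut_coord a b (fst c) (Suc l)"
  shows "(p, c') \<in> trace a b (Cut c ls) \<longleftrightarrow>
    (p, c') \<in> trace (cut_coord a b (fst c) l) (cut_coord a b (fst c) (Suc l)) (ls ! l)"
proof
  let ?m = "fst c" and ?cc = "cut_coord a b (fst c)"
  have m: "0 < ?m" using l by simp
  note lt = cut_coord_less_iff[OF m ab]
  assume "(p, c') \<in> trace a b (Cut c ls)"
  then consider l' where "l' \<in> {1..<?m}" "p = ?cc l'"
    | l' where "l' < ?m" "(p, c') \<in> trace (?cc l') (?cc (Suc l')) (ls ! l')"
    using v by auto
  then show "(p, c') \<in> trace (?cc l) (?cc (Suc l)) (ls ! l)"
  proof cases
    case 1
    then show ?thesis using p unfolding 1(2) lt by simp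
  next
    case 2
    have "?cc l' < p \<and> p < ?cc (Suc l')"
      using trace_bounds[OF _ _ 2(2)] v 2(1) lt by simp
    then have "?cc l' < ?cc (Suc l)" "?cc l < ?cc (Suc l')" using p by linarith+
    then have "l' = l" unfolding lt by simp
    then show ?thesis using 2(2) by simp
  qed
next
  assume "(p, c') \<in> trace (cut_coord a b (fst c) l) (cut_coord a b (fst c) (Suc l)) (ls ! l)"
  then show "(p, c') \<in> trace a b (Cut c ls)" using v l by auto
qed

text \<open>The fourth statement is the lever for reconstruction: the label of the first cut tells
  how far the enclosing interval extends.\<close>

lemma trace_first:
  assumes v: "valid_line (Cut c ls)" and ab: "a < b"
  shows "a < cut_coord a b (fst c) 1" "cut_coord a b (fst c) 1 < b"
    "(cut_coord a b (fst c) 1, c) \<in> trace a b (Cut c ls)"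
    "real (fst c) * (cut_coord a b (fst c) 1 - a) = b - a"
    "p < cut_coord a b (fst c) 1 \<Longrightarrow> (p, c') \<in> trace a b (Cut c ls) \<longleftrightarrow>
      (p, c') \<in> trace a (cut_coord a b (fst c) 1) (ls ! 0)"
    "valid_line (ls ! 0)"
proof -
  let ?m = "fst c" and ?cc = "cut_coord a b (fst c)"
  have m: "0 < ?m" "1 < ?m" using v by auto
  have "?cc 0 < ?cc 1" "?cc 1 < ?cc ?m" unfolding cut_coord_less_iff[OF m(1) ab] using m(2) by auto
  then show b1: "a < ?cc 1" "?cc 1 < b" by (simp_all add: cut_coord_0[OF m(1)] cut_coord_last[OF m(1)])
  show "(?cc 1, c) \<in> trace a b (Cut c ls)" using m(2) by auto
  show "real ?m * (?cc 1 - a) = b - a" using m(1) by (simp add: cut_coord_eq)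
  show v0: "valid_line (ls ! 0)" using v m by simp
  show "(p, c') \<in> trace a b (Cut c ls) \<longleftrightarrow> (p, c') \<in> trace a (?cc 1) (ls ! 0)" if "p < ?cc 1"
  proof (cases "a < p")
    case True
    then show ?thesis using trace_child[OF v ab m(1), of p c'] that by (simp add: cut_coord_0[OF m(1)])
  next
    case False
    then show ?thesis using trace_bounds[OF v ab, of p c'] trace_bounds[OF v0 b1(1), of p c'] by blast
  qed
qed

text \<open>A child shows only interior points of its interval. So no child contributes at a root
  cut, and elsewhere only one child can.\<close>

lemma trace_functional:
  "valid_line s \<Longrightarrow> a < b \<Longrightarrow> (p, c) \<in> trace a b s \<Longrightarrow> (p, c') \<in> trace a b s \<Longrightarrow> c = c'"
proof (induction a b s rule: trace.induct)
  case (2 a b c0 ls)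
  let ?m = "fst c0" and ?cc = "cut_coord a b (fst c0)"
  have m: "0 < ?m" using 2(2) by auto
  note lt = cut_coord_less_iff[OF m 2(3)]
  have at_cut: "c1 = c0" if p: "p = ?cc l" and c1: "(p, c1) \<in> trace a b (Cut c0 ls)" for l c1
  proof -
    consider (own) "c1 = c0" | (child) l' where "l' < ?m" "(p, c1) \<in> trace (?cc l') (?cc (Suc l')) (ls ! l')"
      using c1 2(2) by auto
    then show ?thesis
    proof cases
      case child
      have "?cc l' < p \<and> p < ?cc (Suc l')" using trace_bounds[OF _ _ child(2)] 2(2) child(1) lt by simp
      then show ?thesis unfolding p lt by arith
    qed
  qed
  consider (own) l where "p = ?cc l"
    | (child) l where "l < ?m" "(p, c) \<in> trace (?cc l) (?cc (Suc l)) (ls ! l)"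
    using 2(2,4) by auto
  then show ?case
  proof cases
    case own
    show ?thesis using at_cut[OF own 2(4)] at_cut[OF own 2(5)] by simp
  next
    case child
    have v: "valid_line (ls ! l)" using 2(2) child(1) by simp
    have ll: "?cc l < ?cc (Suc l)" unfolding lt by simp
    have "?cc l < p" "p < ?cc (Suc l)" using trace_bounds[OF v ll child(2)] by auto
    then have "(p, c') \<in> trace (?cc l) (?cc (Suc l)) (ls ! l)" using trace_child[OF 2(2,3) child(1)] 2(5) by blast
    then show ?thesis using 2(1)[of l] 2(2) child v ll by simp
  qed
qed simp

declare trace.simps(2) [simp del]

lemma mem_trace_Cut:
  "(p, c') \<in> trace a b (Cut c ls) \<longleftrightarrow> (\<exists>l\<in>{1..<fst c}. p = cut_coord a b (fst c) l \<and> c' = c) \<or>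
     (\<exists>l<length ls. (p, c') \<in> trace (cut_coord a b (fst c) l) (cut_coord a b (fst c) (Suc l)) (ls ! l))"
  by (auto simp: trace.simps)

lemma mem_cuts_Node:
  fixes ts :: "(nat \<times> nat \<times> 'l) tree list"
  shows "c \<in> cuts d R (Node (Gen (k, m, w)) ts) \<longleftrightarrow>
     c \<in> own_cuts d R (Gen (k, m, w) :: (nat \<times> nat \<times> 'l, (nat \<times> nat \<times> 'l) tree) sym) \<or>
     (\<exists>l<length ts. c \<in> cuts d (box_part R k m (Suc l)) (ts ! l))"
  by (auto simp del: own_cuts.simps)

text \<open>The label at a cut tells by which factor the leftmost interval ending there has to be
  stretched. Hence the leftmost intervals of a line are recovered from the inside to the outside: no
  interval \<open>[a, b]\<close> whose interior looks like a line can end strictly between two of them.\<close>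

lemma trace_initial_interval:
  "valid_line s \<Longrightarrow> valid_line s' \<Longrightarrow> a < b \<Longrightarrow> b < b' \<Longrightarrow>
   (\<And>p c. p < b \<Longrightarrow> (p, c) \<in> trace a b s \<longleftrightarrow> (p, c) \<in> trace a b' s') \<Longrightarrow>
   (b, c0) \<in> trace a b' s' \<Longrightarrow>
   \<exists>c. (b, c) \<in> trace a b' s' \<and> real (fst c) * (b - a) \<le> b' - a"
proof (induction "size s + size s'" arbitrary: s s' b b' c0 rule: less_induct)
  case less
  show ?case
  proof (cases s')
    case Uncut
    then show ?thesis using less(7) by simp
  next
    case (Cut c' ls')
    have v': "valid_line (Cut c' ls')" using less(3) Cut by simp
    have ab': "a < b'" using less(4,5) by simp
    define b1 where "b1 = cut_coord a b' (fst c') 1"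
    note first = trace_first[OF v' ab', folded b1_def]
    have "0 < length ls'" using v' by auto
    then have sz: "size (ls' ! 0) < size s'" using size_nth_less_plain[of 0 ls'] Cut by simp
    consider "b < b1" | "b = b1" | "b1 < b" by linarith
    then show ?thesis
    proof cases
      case 1
      have "\<exists>c. (b, c) \<in> trace a b1 (ls' ! 0) \<and> real (fst c) * (b - a) \<le> b1 - a"
      proof (rule less(1)[OF _ less(2) first(6) less(4) 1])
        show "size s + size (ls' ! 0) < size s + size s'" using sz by simp
        show "(p, c) \<in> trace a b s \<longleftrightarrow> (p, c) \<in> trace a b1 (ls' ! 0)" if "p < b" for p c
          using less(6)[OF that] first(5)[of p c] that 1 Cut by simp
        show "(b, c0) \<in> trace a b1 (ls' ! 0)" using less(7) first(5)[OF 1] Cut by simp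
      qed
      then show ?thesis using first(2) first(5)[OF 1] Cut by fastforce
    next
      case 2
      then show ?thesis using first(3,4) Cut by (intro exI[of _ c']) simp
    next
      \<comment> \<open>The first cut of \<open>s'\<close> lies inside \<open>[a, b]\<close> and is
        therefore visible in \<open>s\<close>. The induction hypothesis with the two lines in
        exchanged roles says that stretching \<open>[a, b1]\<close> by its label stays within
        \<open>[a, b]\<close>, whereas it reaches \<open>b'\<close>. The exchange of roles is the
        reason to induct on the sum of the sizes.\<close>
      case 3
      have "(b1, c') \<in> trace a b s" using less(6)[OF 3] first(3) Cut by simp
      have "\<exists>c. (b1, c) \<in> trace a b s \<and> real (fst c) * (b1 - a) \<le> b - a"
      proof (rule less(1)[OF _ first(6) less(2) first(1) 3])
        show "size (ls' ! 0) + size s < size s + size s'" using sz by simp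
        show "(p, c) \<in> trace a b1 (ls' ! 0) \<longleftrightarrow> (p, c) \<in> trace a b s" if "p < b1" for p c
          using less(6)[of p c] first(5)[OF that] that 3 Cut by simp
        show "(b1, c') \<in> trace a b s" by fact
      qed
      then obtain c where c: "(b1, c) \<in> trace a b s" "real (fst c) * (b1 - a) \<le> b - a" by blast
      have "(b1, c) \<in> trace a b' (Cut c' ls')" using less(6)[OF 3] c(1) Cut by simp
      then have "c = c'" using trace_functional[OF v' ab' _ first(3)] by blast
      then show ?thesis using c(2) first(4) less(5) by simp
    qed
  qed
qed

text \<open>The first cuts at the left end agree in position, by
  \<open>trace_initial_interval\<close>, and so in label; then corresponding children have equal
  traces.\<close>

lemma trace_inj:
  "valid_line s \<Longrightarrow> valid_line s' \<Longrightarrow> a < b \<Longrightarrow> trace a b s = trace a b s' \<Longrightarrow> s = s'"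
proof (induction a b s arbitrary: s' rule: trace.induct)
  case (1 a b)
  show ?case
  proof (cases s')
    case (Cut c ls)
    then show ?thesis using trace_first(3)[of c ls a b] 1 by simp
  qed simp
next
  case (2 a b c ls)
  show ?case
  proof (cases s')
    case Uncut
    then show ?thesis using trace_first(3)[OF 2(2,4)] 2(5) by simp
  next
    case (Cut c' ls')
    have v': "valid_line (Cut c' ls')" and eq: "trace a b (Cut c ls) = trace a b (Cut c' ls')"
      using 2(3,5) Cut by simp_all
    \<comment> \<open>If the first interval of one line were shorter, its end would be a cut inside
      the first interval of the other. Stretching it by its label would have to stay there, but the
      label stretches it to all of \<open>[a, b]\<close>.\<close>
    have no_less: False
      if v: "valid_line (Cut c ls)" and v': "valid_line (Cut c' ls')"
        and eq: "trace a b (Cut c ls) = trace a b (Cut c' ls')"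
        and lt: "cut_coord a b (fst c) 1 < cut_coord a b (fst c') 1" for c c' ls ls'
    proof -
      note f = trace_first[OF v 2(4)] and f' = trace_first[OF v' 2(4)]
      let ?b = "cut_coord a b (fst c) 1" and ?b' = "cut_coord a b (fst c') 1"
      have "\<exists>c1. (?b, c1) \<in> trace a ?b' (ls' ! 0) \<and> real (fst c1) * (?b - a) \<le> ?b' - a"
      proof (rule trace_initial_interval[OF f(6) f'(6) f(1) lt])
        show "(p, c1) \<in> trace a ?b (ls ! 0) \<longleftrightarrow> (p, c1) \<in> trace a ?b' (ls' ! 0)" if "p < ?b" for p c1
          using f(5)[OF that, of c1] f'(5)[of p c1] that lt eq by simp
        show "(?b, c) \<in> trace a ?b' (ls' ! 0)" using f(3) f'(5)[OF lt] eq by simp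
      qed
      then obtain c1 where c1: "(?b, c1) \<in> trace a b (Cut c ls)" "real (fst c1) * (?b - a) \<le> ?b' - a"
        using f'(5)[OF lt] eq by blast
      have "c1 = c" using trace_functional[OF v 2(4) c1(1) f(3)] .
      then show False using c1(2) f(4) f'(2) by simp
    qed
    have b1: "cut_coord a b (fst c) 1 = cut_coord a b (fst c') 1"
    proof -
      have "\<not> cut_coord a b (fst c) 1 < cut_coord a b (fst c') 1" by (rule notI) (rule no_less[OF 2(2) v' eq])
      moreover have "\<not> cut_coord a b (fst c') 1 < cut_coord a b (fst c) 1"
        by (rule notI) (rule no_less[OF v' 2(2) eq[symmetric]])
      ultimately show ?thesis by linarith
    qed
    have c: "c = c'"
      using trace_functional[OF v' 2(4), of "cut_coord a b (fst c') 1"] trace_first(3)[OF 2(2,4)]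
        trace_first(3)[OF v' 2(4)] b1 eq by simp
    have "ls = ls'"
    proof (rule nth_equalityI)
      show len: "length ls = length ls'" using 2(2) v' c by simp
      fix l assume l: "l < length ls"
      let ?a = "cut_coord a b (fst c) l" and ?b = "cut_coord a b (fst c) (Suc l)"
      have lm: "l < fst c" "0 < fst c" using l 2(2) by auto
      have ab: "?a < ?b" unfolding cut_coord_less_iff[OF lm(2) 2(4)] by simp
      have v1: "valid_line (ls ! l)" "valid_line (ls' ! l)" using 2(2) v' l len by simp_all
      have "(p, c1) \<in> trace ?a ?b (ls ! l) \<longleftrightarrow> (p, c1) \<in> trace ?a ?b (ls' ! l)" for p c1
      proof (cases "?a < p \<and> p < ?b")
        case True
        then show ?thesis
          using trace_child[OF 2(2,4) lm(1), of p c1] trace_child[OF v' 2(4), of l p c1] lm(1) c eq by simp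
      next
        case False
        then show ?thesis using trace_bounds[OF v1(1) ab] trace_bounds[OF v1(2) ab] by blast
      qed
      then have "trace ?a ?b (ls ! l) = trace ?a ?b (ls' ! l)" by auto
      then show "ls ! l = ls' ! l" using 2(1)[of l] l v1 ab by simp
    qed
    then show ?thesis using c Cut by simp
  qed
qed


section \<open>Traces of subdivisions along generic lines\<close>

text \<open>Counted from 0. The index is that of the part containing \<open>y\<close> whenever
  \<open>y\<close> lies strictly between two consecutive cuts
  (\<open>part_index_eq\<close>).\<close>

definition part_index :: "box \<Rightarrow> nat \<Rightarrow> nat \<Rightarrow> real \<Rightarrow> nat" where
  "part_index R k m y = (LEAST l. y < cut_coord (fst R k) (snd R k) m (Suc l))"

lemma part_index_eq:
  assumes "0 < m" "fst R k < snd R k" "cut_coord (fst R k) (snd R k) m l < y"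
    "y < cut_coord (fst R k) (snd R k) m (Suc l)"
  shows "part_index R k m y = l"
  unfolding part_index_def
proof (rule Least_equality)
  fix n assume "y < cut_coord (fst R k) (snd R k) m (Suc n)"
  then have "cut_coord (fst R k) (snd R k) m l < cut_coord (fst R k) (snd R k) m (Suc n)" using assms(3) by linarith
  then show "l \<le> n" unfolding cut_coord_less_iff[OF assms(1,2)] by simp
qed (rule assms(4))

text \<open>At a cut in another direction the line continues in the one part that it meets. For an
  index out of range and for symbols other than \<open>Gen\<close>, \<open>Uncut\<close> is a
  default that generic lines in trees over \<open>cut_sig\<close> never reach.\<close>

fun line_through :: "nat \<Rightarrow> point \<Rightarrow> box \<Rightarrow> (nat \<times> nat \<times> 'l) tree \<Rightarrow> 'l line" where
  "line_through k x R (Leaf i) = Uncut"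
| "line_through k x R (Node (Gen (k', m, w)) ts) =
     (if k' = k then Cut (m, w) (map (\<lambda>l. line_through k x (box_part R k m (Suc l)) (ts ! l)) [0..<length ts])
      else if part_index R k' m (x k') < length ts
      then line_through k x (box_part R k' m (Suc (part_index R k' m (x k')))) (ts ! part_index R k' m (x k'))
      else Uncut)"
| "line_through k x R (Node (FromL t) ts) = Uncut"
| "line_through k x R (Node (FromR t) ts) = Uncut"

text \<open>The coordinate \<open>x k\<close> is free, since the line consists of all points
  \<open>x(k := y)\<close>. Extensionality lets these points be elements of
  \<open>box_pts\<close>.\<close>

definition generic :: "nat \<Rightarrow> nat \<Rightarrow> box \<Rightarrow> point \<Rightarrow> bool" where
  "generic d k R x \<longleftrightarrow> x \<in> extensional {1..d} \<and>
     (\<forall>i\<in>{1..d} - {k}. x i \<notin> \<rat> \<and> fst R i < x i \<and> x i < snd R i)"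

lemma sqrt_2_irrational: "sqrt 2 \<notin> \<rat>"
proof
  assume "sqrt 2 \<in> \<rat>"
  then obtain m n :: nat where n: "n \<noteq> 0" and "\<bar>sqrt 2\<bar> = real m / real n" and co: "coprime m n"
    by (rule Rats_abs_nat_div_natE)
  then have "real m = sqrt 2 * real n" by simp
  then have "(real m)\<^sup>2 = 2 * (real n)\<^sup>2" by (simp add: power_mult_distrib)
  then have eq: "m\<^sup>2 = 2 * n\<^sup>2" using of_nat_eq_iff[where 'a = real, of "m\<^sup>2" "2 * n\<^sup>2"] by simp
  then have "even (m\<^sup>2)" by simp
  then have em: "even m" by simp
  then obtain j where "m = 2 * j" by blast
  then have "n\<^sup>2 = 2 * j\<^sup>2" using eq by (simp add: power_mult_distrib)
  then have "even (n\<^sup>2)" by simp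
  then have "even n" by simp
  then show False using co em by (auto dest: coprime_common_divisor_nat)
qed

lemma irrational_between:
  fixes a b :: real
  assumes "a < b"
  obtains x where "x \<notin> \<rat>" "a < x" "x < b"
proof -
  have "a - sqrt 2 < b - sqrt 2" using assms by simp
  then obtain r where r: "r \<in> \<rat>" "a - sqrt 2 < r" "r < b - sqrt 2" using Rats_dense_in_real by blast
  have "r + sqrt 2 \<notin> \<rat>" using r(1) sqrt_2_irrational Rats_diff[of "r + sqrt 2" r] by auto
  then show ?thesis using that[of "r + sqrt 2"] r by simp
qed

lemma generic_exists:
  assumes "rational_box d R"
  obtains x where "generic d k R x"
proof -
  have "\<exists>y. y \<notin> \<rat> \<and> fst R i < y \<and> y < snd R i" if "i \<in> {1..d}" for i
    using assms that irrational_between unfolding rational_box_def by metis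
  then obtain y where "\<And>i. i \<in> {1..d} \<Longrightarrow> y i \<notin> \<rat> \<and> fst R i < y i \<and> y i < snd R i" by metis
  then have "generic d k R (restrict y {1..d})" by (simp add: generic_def)
  then show ?thesis using that by blast
qed

text \<open>Cut positions are rational and \<open>x k'\<close> is not, so the line runs strictly
  inside one part.\<close>

lemma part_index_locate:
  assumes R: "rational_box d R" and k': "k' \<in> {1..d}" "k' \<noteq> k" and x: "generic d k R x" and m: "0 < m"
  shows "part_index R k' m (x k') < m" "generic d k (box_part R k' m (Suc (part_index R k' m (x k')))) x"
proof -
  let ?cc = "cut_coord (fst R k') (snd R k') m"
  have xk: "x k' \<notin> \<rat>" "fst R k' < x k'" "x k' < snd R k'" using x k' by (auto simp: generic_def)
  have r: "fst R k' \<in> \<rat>" "snd R k' \<in> \<rat>" "fst R k' < snd R k'" using R k' by (auto simp: rational_box_def)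
  obtain l where l: "l < m" "?cc l \<le> x k'" "x k' \<le> ?cc (Suc l)"
    using cut_coord_locate[OF m less_imp_le[OF xk(2)] less_imp_le[OF xk(3)]] by metis
  have "?cc l \<in> \<rat>" "?cc (Suc l) \<in> \<rat>" using r cut_coord_Rats by auto
  then have "?cc l \<noteq> x k'" "x k' \<noteq> ?cc (Suc l)" using xk(1) by auto
  then have l': "?cc l < x k'" "x k' < ?cc (Suc l)" using l by auto
  have i: "part_index R k' m (x k') = l" by (rule part_index_eq[OF m r(3) l'])
  show "part_index R k' m (x k') < m" unfolding i by (rule l)
  show "generic d k (box_part R k' m (Suc (part_index R k' m (x k')))) x"
    unfolding i using x l' by (auto simp: generic_def fst_box_part snd_box_part)
qed

text \<open>By this, a hypothesis on all generic lines of \<open>R\<close> passes to the children of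
  a vertex.\<close>

lemma generic_part:
  assumes R: "rational_box d R" and k': "k' \<in> {1..d}" and l: "l < m"
    and x: "generic d k (box_part R k' m (Suc l)) x"
  shows "generic d k R x" "k' \<noteq> k \<Longrightarrow> part_index R k' m (x k') = l"
proof -
  have "subbox d (box_part R k' m (Suc l)) R" by (rule subbox_part[OF R k' l])
  then show "generic d k R x"
    using x unfolding generic_def subbox_def by (meson DiffD1 order_le_less_trans order_less_le_trans)
  show "part_index R k' m (x k') = l" if "k' \<noteq> k"
  proof -
    have "fst (box_part R k' m (Suc l)) k' < x k'" "x k' < snd (box_part R k' m (Suc l)) k'"
      using x k' that by (auto simp: generic_def)
    then show ?thesis
      using l R k' by (intro part_index_eq) (auto simp: rational_box_def fst_box_part snd_box_part)
  qed
qed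

lemma generic_same_part: "generic d k (box_part R k m l) x \<longleftrightarrow> generic d k R x"
  by (auto simp: generic_def fst_box_part snd_box_part)

lemma valid_line_through:
  assumes "over_sig (cut_sig K L) t" "K \<subseteq> {1..d}" "rational_box d R" "generic d k R x"
  shows "valid_line (line_through k x R t)"
  using assms(1,3,4)
proof (induction k x R t rule: line_through.induct)
  case (2 k x R k' m w ts)
  obtain len: "length ts = m" "2 \<le> m" and k': "k' \<in> {1..d}" using 2(3) assms(2) by (auto simp: cut_sig_def)
  have m: "0 < m" using len by simp
  show ?case
  proof (cases "k' = k")
    case True
    have "valid_line (line_through k x (box_part R k m (Suc l)) (ts ! l))" if "l < m" for l
      using 2(1)[OF True, of l] that 2(3-5) len rational_box_part[OF 2(4) k' that] True
      by (simp add: generic_same_part)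
    then show ?thesis using len True by simp
  next
    case False
    note i = part_index_locate[OF 2(4) k' False 2(5) m]
    show ?thesis
      using 2(2)[OF False] i len 2(3) rational_box_part[OF 2(4) k' i(1)] False by simp
  qed
qed simp_all

lemma cuts_in_box:
  assumes "over_sig (cut_sig K L) t" "K \<subseteq> {1..d}" "rational_box d R" "(x, c) \<in> cuts d R t"
  shows "x \<in> box_pts d R"
  using assms(1,3,4)
proof (induction R t rule: named_boxes.induct)
  case (2 R s ts)
  obtain k w where s: "s = Gen (k, length ts, w)" "k \<in> {1..d}"
    using over_sig_cut_Node[OF 2(2) assms(2)] by metis
  consider (own) "(x, c) \<in> own_cuts d R s" | (child) l where "l < length ts" "(x, c) \<in> cuts d (part R s (Suc l)) (ts ! l)"
    using 2(4) by auto
  then show ?case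
  proof cases
    case own
    then show ?thesis using s by auto
  next
    case child
    have r: "rational_box d (part R s (Suc l))" using rational_box_part[OF 2(3) s(2) child(1)] s(1) by simp
    have "x \<in> box_pts d (part R s (Suc l))" using 2(1)[of l] 2(2) child r by simp
    then show ?thesis using box_pts_parts[OF 2(3) s(2), of "length ts"] child(1) s(1) by fastforce
  qed
qed simp

text \<open>A cut inside a part that the line does not enter could touch the line only on a face
  between two parts, which an irrational coordinate excludes.\<close>

lemma line_through_trace:
  fixes t :: "(nat \<times> nat \<times> 'l) tree"
  assumes "over_sig (cut_sig K L) t" "K \<subseteq> {1..d}" "rational_box d R" "generic d k R x" "k \<in> {1..d}"
  shows "(x(k := y), k, c) \<in> cuts d R t \<longleftrightarrow> (y, c) \<in> trace (fst R k) (snd R k) (line_through k x R t)"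
  using assms(1,3,4,5)
proof (induction k x R t rule: line_through.induct)
  case (2 k x R k' m w ts)
  obtain len: "length ts = m" "2 \<le> m" and k': "k' \<in> {1..d}" using 2(3) assms(2) by (auto simp: cut_sig_def)
  have m: "0 < m" using len by simp
  have ab: "fst R k < snd R k" using 2(4,6) by (simp add: rational_box_def)
  show ?case
  proof (cases "k' = k")
    case True
    have child: "(x(k := y), k, c) \<in> cuts d (box_part R k m (Suc l)) (ts ! l) \<longleftrightarrow>
        (y, c) \<in> trace (cut_coord (fst R k) (snd R k) m l) (cut_coord (fst R k) (snd R k) m (Suc l))
          (line_through k x (box_part R k m (Suc l)) (ts ! l))" if "l < m" for l
      using 2(1)[OF True, of l] that 2(3-6) len rational_box_part[OF 2(4) k' that] True
      by (simp add: generic_same_part fst_box_part snd_box_part fun_upd_def)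
    have own: "(x(k := y), k, c) \<in> own_cuts d R (Gen (k, m, w) :: (nat \<times> nat \<times> 'l, (nat \<times> nat \<times> 'l) tree) sym) \<longleftrightarrow>
      (\<exists>l\<in>{1..<m}. y = cut_coord (fst R k) (snd R k) m l \<and> c = (m, w))"
    proof -
      have "x(k := cut_coord (fst R k) (snd R k) m l) \<in> box_pts d R" if "l \<in> {1..<m}" for l
      proof -
        have "cut_coord (fst R k) (snd R k) m 0 \<le> cut_coord (fst R k) (snd R k) m l"
          "cut_coord (fst R k) (snd R k) m l \<le> cut_coord (fst R k) (snd R k) m m"
          unfolding cut_coord_le_iff[OF m ab] using that by auto
        then show ?thesis
          using 2(5,6) by (auto simp: box_pts_def PiE_iff generic_def extensional_def
              cut_coord_0[OF m] cut_coord_last[OF m] less_imp_le)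
      qed
      moreover have "{1..m - 1} = {1..<m}" using m by auto
      ultimately show ?thesis by (auto simp: cut_pos_eq)
    qed
    have children: "(\<exists>l<length ts. (x(k := y), k, c) \<in> cuts d (box_part R k m (Suc l)) (ts ! l)) \<longleftrightarrow>
      (\<exists>l<length ts. (y, c) \<in> trace (cut_coord (fst R k) (snd R k) m l) (cut_coord (fst R k) (snd R k) m (Suc l))
          (line_through k x (box_part R k m (Suc l)) (ts ! l)))" using child len by blast
    show ?thesis
      unfolding True line_through.simps if_P[OF refl] mem_cuts_Node mem_trace_Cut own children by (simp cong: conj_cong)
  next
    case False
    let ?i = "part_index R k' m (x k')"
    note i = part_index_locate[OF 2(4) k' False 2(5) m]
    have "(x(k := y), k, c) \<in> cuts d R (Node (Gen (k', m, w)) ts) \<longleftrightarrow>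
      (\<exists>l<m. (x(k := y), k, c) \<in> cuts d (box_part R k' m (Suc l)) (ts ! l))"
      using False len by auto
    also have "\<dots> \<longleftrightarrow> (x(k := y), k, c) \<in> cuts d (box_part R k' m (Suc ?i)) (ts ! ?i)"
    proof
      assume "\<exists>l<m. (x(k := y), k, c) \<in> cuts d (box_part R k' m (Suc l)) (ts ! l)"
      then obtain l where l: "l < m" "(x(k := y), k, c) \<in> cuts d (box_part R k' m (Suc l)) (ts ! l)" by blast
      have over: "over_sig (cut_sig K L) (ts ! l)" using 2(3) l len by simp
      have "x(k := y) \<in> box_pts d (box_part R k' m (Suc l))"
        by (rule cuts_in_box[OF over assms(2) rational_box_part[OF 2(4) k' l(1)] l(2)])
      then have "cut_coord (fst R k') (snd R k') m l \<le> x k'" "x k' \<le> cut_coord (fst R k') (snd R k') m (Suc l)"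
        using k' False by (force simp: box_pts_def PiE_iff fst_box_part snd_box_part)+
      moreover have r: "x k' \<notin> \<rat>" "fst R k' \<in> \<rat>" "snd R k' \<in> \<rat>" "fst R k' < snd R k'"
        using 2(4,5) k' False by (auto simp: generic_def rational_box_def)
      moreover have "cut_coord (fst R k') (snd R k') m n \<noteq> x k'" for n
        using cut_coord_Rats[OF r(2,3)] r(1) by metis
      ultimately have "?i = l"
        by (intro part_index_eq m) (simp_all add: less_le, metis)
      then show "(x(k := y), k, c) \<in> cuts d (box_part R k' m (Suc ?i)) (ts ! ?i)" using l by simp
    qed (use i in blast)
    also have "\<dots> \<longleftrightarrow> (y, c) \<in> trace (fst R k) (snd R k) (line_through k x (box_part R k' m (Suc ?i)) (ts ! ?i))"
      using 2(2)[OF False] i len 2(3,6) rational_box_part[OF 2(4) k' i(1)] False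
      by (simp add: fst_box_part snd_box_part fun_upd_def)
    moreover have "line_through k x R (Node (Gen (k', m, w)) ts) = line_through k x (box_part R k' m (Suc ?i)) (ts ! ?i)"
      using False i len by simp
    ultimately show ?thesis by (simp only:)
  qed
qed (simp_all add: cut_sig_def)

text \<open>Reduces the geometry of dimension \<open>d\<close> to \<open>trace_inj\<close>: the cuts
  determine the trace of every generic line, and the trace determines the line.\<close>

lemma line_through_cong:
  assumes s: "over_sig (cut_sig K L) s" and t: "over_sig (cut_sig K L) t" and K: "K \<subseteq> {1..d}"
    and R: "rational_box d R" and k: "k \<in> {1..d}" and x: "generic d k R x" and eq: "cuts d R s = cuts d R t"
  shows "line_through k x R s = line_through k x R t"
proof (rule trace_inj)
  show "valid_line (line_through k x R s)" by (rule valid_line_through[OF s K R x])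
  show "valid_line (line_through k x R t)" by (rule valid_line_through[OF t K R x])
  show "fst R k < snd R k" using R k by (simp add: rational_box_def)
  show "trace (fst R k) (snd R k) (line_through k x R s) = trace (fst R k) (snd R k) (line_through k x R t)"
    using line_through_trace[OF s K R x k] line_through_trace[OF t K R x k] eq by auto
qed


section \<open>A subdivision determines its tree up to exchange of cuts\<close>

text \<open>If the root of \<open>t\<close> has another direction, a generic line of a child is
  generic in \<open>R\<close> and sees the same cuts. So by induction each child can be given the
  wanted cut as its root, and one exchange moves it to the top.\<close>

lemma pull_root:
  assumes "over_sig (cut_sig K L) t" "K \<subseteq> {1..d}" "rational_box d R"
    and "\<And>x. generic d k R x \<Longrightarrow> \<exists>ls. line_through k x R t = Cut (m, w) ls"
  shows "\<exists>us. length us = m \<and> 2 \<le> m \<and> cut_eq t (Node (Gen (k, m, w)) us)"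
  using assms(1,3,4)
proof (induction R t rule: named_boxes.induct)
  case (1 R i)
  \<comment> \<open>The hypothesis is not void: some generic line exists, and in a leaf it shows no
    cut.\<close>
  obtain x where "generic d k R x" using generic_exists[OF 1(2)] .
  then show ?case using 1(3) by fastforce
next
  case (2 R s ts)
  obtain k' w' where s: "s = Gen (k', length ts, w')" "k' \<in> {1..d}" "2 \<le> length ts"
    using over_sig_cut_Node[OF 2(2) assms(2)] by metis
  show ?case
  proof (cases "k' = k")
    case True
    obtain x where "generic d k R x" using generic_exists[OF 2(3)] .
    then have "(length ts, w') = (m, w)" using 2(4) s True by fastforce
    then show ?thesis using s True cut_eq_refl by (intro exI[of _ ts]) auto
  next
    case False
    have "\<exists>us. length us = m \<and> 2 \<le> m \<and> cut_eq (ts ! l) (Node (Gen (k, m, w)) us)" if l: "l < length ts" for l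
    proof (rule 2(1))
      show "l \<in> {..<length ts}" using l by simp
      show "over_sig (cut_sig K L) (ts ! l)" using 2(2) l by simp
      show "rational_box d (part R s (Suc l))" using rational_box_part[OF 2(3) s(2) l] s(1) by simp
      fix x assume "generic d k (part R s (Suc l)) x"
      then have "generic d k (box_part R k' (length ts) (Suc l)) x" using s(1) by simp
      note g = generic_part[OF 2(3) s(2) l this]
      show "\<exists>ls. line_through k x (part R s (Suc l)) (ts ! l) = Cut (m, w) ls"
        using 2(4)[OF g(1)] g(2)[OF False] s(1) False l by simp
    qed
    then obtain U where U: "\<And>l. l < length ts \<Longrightarrow> length (U l) = m"
      "\<And>l. l < length ts \<Longrightarrow> 2 \<le> m" "\<And>l. l < length ts \<Longrightarrow> cut_eq (ts ! l) (Node (Gen (k, m, w)) (U l))" by metis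
    have "0 < length ts" using s(3) by linarith
    then have m: "2 \<le> m" "0 < m" "0 < length ts" using U(2)[of 0] by linarith+
    have "cut_eq (Node s ts) (Node s (map (\<lambda>l. Node (Gen (k, m, w)) (map (\<lambda>j. U l ! j) [0..<m])) [0..<length ts]))"
    proof (rule cut_eq_Node)
      have "map (\<lambda>j. U l ! j) [0..<m] = U l" if "l < length ts" for l
        using U(1)[OF that] by (metis map_nth)
      then show "list_all2 cut_eq ts (map (\<lambda>l. Node (Gen (k, m, w)) (map (\<lambda>j. U l ! j) [0..<m])) [0..<length ts])"
        using U(3) by (auto simp: list_all2_conv_all_nth)
    qed
    \<comment> \<open>All children now have the same root symbol with the same number of parts, so
      their subtrees form a grid.\<close>
    also have "cut_eq \<dots> (Node (Gen (k, m, w)) (map (\<lambda>j. Node s (map (\<lambda>l. U l ! j) [0..<length ts])) [0..<m]))"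
      unfolding s(1) using False m by (intro cut_eq_swap) auto
    finally (cut_eq_trans) show ?thesis using m by (intro exI conjI) auto
  qed
qed

text \<open>The coordinates of a rectangle tell to which part it belongs, so equality of named
  rectangles passes to the children.\<close>

lemma named_boxes_child:
  assumes over: "over_sig (cut_sig K L) (Node (Gen (k, length ts, w)) ts)" and K: "K \<subseteq> {1..d}"
    and R: "rational_box d R" and l: "l < length ts"
  shows "named_boxes (box_part R k (length ts) (Suc l)) (ts ! l) =
    {(i, Q) \<in> named_boxes R (Node (Gen (k, length ts, w)) ts).
      cut_coord (fst R k) (snd R k) (length ts) l \<le> fst Q k \<and> snd Q k \<le> cut_coord (fst R k) (snd R k) (length ts) (Suc l)}"
    (is "?A = ?B")
proof -
  have k: "k \<in> {1..d}" using over K by (auto simp: cut_sig_def)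
  have m: "0 < length ts" using l by linarith
  have ab: "fst R k < snd R k" using R k by (simp add: rational_box_def)
  have q: "cut_coord (fst R k) (snd R k) (length ts) l' \<le> fst Q k" "fst Q k < snd Q k"
    "snd Q k \<le> cut_coord (fst R k) (snd R k) (length ts) (Suc l')"
    if "l' < length ts" "(i, Q) \<in> named_boxes (box_part R k (length ts) (Suc l')) (ts ! l')" for l' i Q
  proof -
    have "over_sig (cut_sig K L) (ts ! l')" using over that(1) by simp
    from named_boxes_rational[OF this K rational_box_part[OF R k that(1)] that(2)]
    show "cut_coord (fst R k) (snd R k) (length ts) l' \<le> fst Q k" "fst Q k < snd Q k"
      "snd Q k \<le> cut_coord (fst R k) (snd R k) (length ts) (Suc l')"
      using k by (force simp: rational_box_def subbox_def fst_box_part snd_box_part)+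
  qed
  show ?thesis
  proof (intro equalityI subsetI)
    fix y assume "y \<in> ?A"
    then show "y \<in> ?B" using q[OF l] l by (cases y) auto
  next
    fix y assume y: "y \<in> ?B"
    obtain i Q where iQ: "y = (i, Q)" by (cases y)
    obtain l' where l': "l' < length ts" "(i, Q) \<in> named_boxes (box_part R k (length ts) (Suc l')) (ts ! l')"
      using y iQ by auto
    have "cut_coord (fst R k) (snd R k) (length ts) l < cut_coord (fst R k) (snd R k) (length ts) (Suc l')"
      "cut_coord (fst R k) (snd R k) (length ts) l' < cut_coord (fst R k) (snd R k) (length ts) (Suc l)"
      using q[OF l'] y iQ by auto
    then have "l' = l" unfolding cut_coord_less_iff[OF m ab] by simp
    then show "y \<in> ?A" using l' iQ by simp
  qed
qed

text \<open>The hypothesis concerns lines instead of sets of cuts. Labelled points on a common face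
  of two parts cannot be assigned to one of them, so equality of cuts does not pass to the children
  directly, while equality of lines does.\<close>

lemma tree_determined:
  assumes "over_sig (cut_sig K L) s" "over_sig (cut_sig K L) t" "K \<subseteq> {1..d}" "rational_box d R"
    and "named_boxes R s = named_boxes R t"
    and "\<And>k x. k \<in> {1..d} \<Longrightarrow> generic d k R x \<Longrightarrow> line_through k x R s = line_through k x R t"
  shows "cut_eq s t"
  using assms(1,2,4-)
proof (induction R s arbitrary: t rule: named_boxes.induct)
  case (1 R i)
  show ?case
  proof (cases t)
    case (Leaf j)
    then show ?thesis using 1(4) cut_eq_refl by simp
  next
    case (Node s' ts)
    then obtain k w where s': "s' = Gen (k, length ts, w)" "k \<in> {1..d}"
      using over_sig_cut_Node[OF _ assms(3)] 1(2) by metis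
    \<comment> \<open>A line in the direction of the root cut of \<open>t\<close> shows this cut,
      but in a leaf it shows none.\<close>
    obtain x where "generic d k R x" using generic_exists[OF 1(3)] .
    then show ?thesis using 1(5)[OF s'(2)] s' Node by fastforce
  qed
next
  case (2 R s ts)
  obtain k w where s: "s = Gen (k, length ts, w)" "k \<in> {1..d}"
    using over_sig_cut_Node[OF 2(2) assms(3)] by metis
  have "\<exists>us. length us = length ts \<and> 2 \<le> length ts \<and> cut_eq t (Node (Gen (k, length ts, w)) us)"
  proof (rule pull_root[OF 2(3) assms(3) 2(4)])
    fix x assume "generic d k R x"
    then have "line_through k x R t = line_through k x R (Node s ts)" using 2(6)[OF s(2)] by simp
    also have "\<dots> = Cut (length ts, w) (map (\<lambda>l. line_through k x (box_part R k (length ts) (Suc l)) (ts ! l)) [0..<length ts])"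
      by (simp add: s(1))
    finally show "\<exists>ls. line_through k x R t = Cut (length ts, w) ls" by blast
  qed
  then obtain us where us: "length us = length ts" "cut_eq t (Node s us)" using s(1) by blast
  have ou: "over_sig (cut_sig K L) (Node s us)" using cut_eq_over_sig[OF us(2)] 2(3) by blast
  have nb: "named_boxes R (Node s ts) = named_boxes R (Node s us)"
    using 2(5) cut_eq_named_boxes[OF us(2), of R] by simp
  \<comment> \<open>Pulling the cut to the root of \<open>t\<close> changes the tree but not its
    cuts, hence none of its lines.\<close>
  have lines: "line_through k0 x R (Node s ts) = line_through k0 x R (Node s us)"
    if "k0 \<in> {1..d}" "generic d k0 R x" for k0 x
    using 2(6)[OF that] line_through_cong[OF 2(3) ou assms(3) 2(4) that cut_eq_cuts[OF us(2) assms(3) 2(3,4)]] by simp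
  have "cut_eq (ts ! l) (us ! l)" if l: "l < length ts" for l
  proof (rule 2(1))
    show "l \<in> {..<length ts}" using l by simp
    show "over_sig (cut_sig K L) (ts ! l)" "over_sig (cut_sig K L) (us ! l)" using 2(2) ou l us(1) by simp_all
    show "rational_box d (part R s (Suc l))" using rational_box_part[OF 2(4) s(2) l] s(1) by simp
    have o1: "over_sig (cut_sig K L) (Node (Gen (k, length ts, w)) ts)"
      and o2: "over_sig (cut_sig K L) (Node (Gen (k, length us, w)) us)"
      using 2(2) ou s(1) us(1) by simp_all
    show "named_boxes (part R s (Suc l)) (ts ! l) = named_boxes (part R s (Suc l)) (us ! l)"
      using named_boxes_child[OF o1 assms(3) 2(4) l] named_boxes_child[OF o2 assms(3) 2(4), of l] nb l us(1) s(1)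
      by (simp del: named_boxes.simps)
    fix k0 x assume k0: "k0 \<in> {1..d}" and x: "generic d k0 (part R s (Suc l)) x"
    have "generic d k0 (box_part R k (length ts) (Suc l)) x" using x s(1) by simp
    note g = generic_part[OF 2(4) s(2) l this]
    show "line_through k0 x (part R s (Suc l)) (ts ! l) = line_through k0 x (part R s (Suc l)) (us ! l)"
    proof (cases "k = k0")
      case True
      then show ?thesis using lines[OF k0 g(1)] s(1) us(1) l by simp
    next
      case False
      then show ?thesis using lines[OF k0 g(1)] g(2)[OF False] s(1) us(1) l by simp
    qed
  qed
  then have "cut_eq (Node s ts) (Node s us)" using us(1) by (intro cut_eq_Node) (auto simp: list_all2_conv_all_nth)
  then show ?case using us(2) cut_eq_sym cut_eq_trans by blast
qed

lemma cut_value_eq_imp_cut_eq: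
  assumes s: "s \<in> ops (tree_operad (cut_sig {1..d} L))" and t: "t \<in> ops (tree_operad (cut_sig {1..d} L))"
    and eq: "cut_value d s = cut_value d t"
  shows "cut_eq s t"
proof -
  have over: "over_sig (cut_sig {1..d} L) s" "over_sig (cut_sig {1..d} L) t" using s t by (auto simp: mem_ops_tree)
  note e = cut_value_inject[OF s t eq]
  show ?thesis
    by (rule tree_determined[OF over order_refl rational_unit_box e(1)
          line_through_cong[OF over order_refl rational_unit_box _ _ e(2)]])
qed


section \<open>Free operads on free symmetric collections\<close>

context
  fixes X :: "'x symcoll"
  assumes sym: "symmetric_collection X" and free: "free_collection X"
begin

section \<open>Orbits and base points\<close>

definition orbit :: "nat \<Rightarrow> 'x \<Rightarrow> 'x set" where
  "orbit m v = {sact X m v \<sigma> |\<sigma>. \<sigma> permutes {1..m}}"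

lemma mem_orbits_iff: "w \<in> orbits X m \<longleftrightarrow> (\<exists>v\<in>val X m. w = orbit m v)"
  by (auto simp: orbits_def orbit_def)

lemma sact_val:
  assumes "1 \<le> m" "v \<in> val X m" "\<sigma> permutes {1..m}"
  shows "sact X m v \<sigma> \<in> val X m"
proof -
  have "Mor X {1..m} {1..m} \<sigma> \<in> val X m \<rightarrow> val X m"
    using sym assms(1) permutes_imp_bij[OF assms(3)] unfolding symmetric_collection_def fin_obj_def by auto
  then show ?thesis using assms(2) by blast
qed

lemma sact_id: "1 \<le> m \<Longrightarrow> v \<in> val X m \<Longrightarrow> sact X m v id = v"
  using sym unfolding symmetric_collection_def fin_obj_def by auto

lemma sact_comp:
  assumes "1 \<le> m" "v \<in> val X m" "\<sigma> permutes {1..m}" "\<tau> permutes {1..m}"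
  shows "sact X m v (\<sigma> \<circ> \<tau>) = sact X m (sact X m v \<sigma>) \<tau>"
proof -
  have "\<forall>I J K f g. fin_obj I \<and> fin_obj J \<and> fin_obj K \<and> bij_betw f I J \<and> bij_betw g J K \<longrightarrow>
        (\<forall>w\<in>Ob X K. Mor X I K (g \<circ> f) w = Mor X I J f (Mor X J K g w))"
    using sym unfolding symmetric_collection_def by (elim conjE)
  moreover have "fin_obj {1..m}" using assms(1) by (simp add: fin_obj_def)
  ultimately show ?thesis
    using assms(2) permutes_imp_bij[OF assms(3)] permutes_imp_bij[OF assms(4)] by blast
qed

text \<open>Freeness enters here: an element of an orbit determines the permutation that leads to it
  from a fixed base point.\<close>

lemma sact_inj:
  assumes m: "1 \<le> m" and v: "v \<in> val X m" and s: "\<sigma> permutes {1..m}" and t: "\<tau> permutes {1..m}"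
    and eq: "sact X m v \<sigma> = sact X m v \<tau>"
  shows "\<sigma> = \<tau>"
proof -
  have it: "inv \<tau> permutes {1..m}" by (rule permutes_inv[OF t])
  have "sact X m v (\<sigma> \<circ> inv \<tau>) = sact X m v (\<tau> \<circ> inv \<tau>)"
    using sact_comp[OF m v s it] sact_comp[OF m v t it] eq by simp
  also have "\<dots> = v" using permutes_inv_o(1)[OF t] sact_id[OF m v] by simp
  finally have "\<sigma> \<circ> inv \<tau> = id"
    using free m v permutes_compose[OF it s] unfolding free_collection_def by blast
  then have "(\<sigma> \<circ> inv \<tau>) \<circ> \<tau> = \<tau>" by simp
  then show ?thesis using permutes_inv_o(2)[OF t] by (simp add: comp_assoc)
qed

lemma orbitI: "\<sigma> permutes {1..m} \<Longrightarrow> sact X m v \<sigma> \<in> orbit m v"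
  unfolding orbit_def by blast

lemma orbit_refl: "1 \<le> m \<Longrightarrow> v \<in> val X m \<Longrightarrow> v \<in> orbit m v"
  using orbitI[OF permutes_id, of m v] by (simp only: sact_id)

lemma orbit_sact:
  assumes m: "1 \<le> m" and v: "v \<in> val X m" and s: "\<sigma> permutes {1..m}"
  shows "orbit m (sact X m v \<sigma>) = orbit m v"
proof (intro equalityI subsetI)
  fix u assume "u \<in> orbit m (sact X m v \<sigma>)"
  then obtain \<tau> where t: "\<tau> permutes {1..m}" "u = sact X m (sact X m v \<sigma>) \<tau>" by (auto simp: orbit_def)
  then show "u \<in> orbit m v"
    using sact_comp[OF m v s t(1)] orbitI[OF permutes_compose[OF t(1) s], of v] by (simp only:)
next
  fix u assume "u \<in> orbit m v"
  then obtain \<tau> where t: "\<tau> permutes {1..m}" "u = sact X m v \<tau>" by (auto simp: orbit_def)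
  have p: "inv \<sigma> \<circ> \<tau> permutes {1..m}" by (rule permutes_compose[OF t(1) permutes_inv[OF s]])
  have "\<sigma> \<circ> (inv \<sigma> \<circ> \<tau>) = \<tau>" using permutes_inv_o(1)[OF s] by (simp add: comp_assoc[symmetric])
  then have "u = sact X m (sact X m v \<sigma>) (inv \<sigma> \<circ> \<tau>)" using sact_comp[OF m v s p] t(2) by simp
  then show "u \<in> orbit m (sact X m v \<sigma>)" using orbitI[OF p] by (simp only:)
qed

definition base_point :: "'x set \<Rightarrow> 'x" where
  "base_point w = (SOME v. v \<in> w)"

lemma base_point:
  assumes m: "1 \<le> m" and w: "w \<in> orbits X m"
  shows "base_point w \<in> val X m" "orbit m (base_point w) = w"
proof -
  obtain v where v: "v \<in> val X m" "w = orbit m v" using w mem_orbits_iff by blast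
  then have "v \<in> w" using orbit_refl[OF m] by blast
  then have "base_point w \<in> w" unfolding base_point_def by (rule someI)
  then obtain \<sigma> where "\<sigma> permutes {1..m}" "base_point w = sact X m v \<sigma>" using v by (auto simp: orbit_def)
  then show "base_point w \<in> val X m" "orbit m (base_point w) = w"
    using sact_val[OF m v(1)] orbit_sact[OF m v(1)] v(2) by auto
qed

text \<open>The coordinate of \<open>v\<close> in its orbit with respect to the base point, unique
  by freeness.\<close>

definition position :: "nat \<Rightarrow> 'x \<Rightarrow> nat \<Rightarrow> nat" where
  "position m v = (SOME \<sigma>. \<sigma> permutes {1..m} \<and> sact X m (base_point (orbit m v)) \<sigma> = v)"

lemma position:
  assumes m: "1 \<le> m" and v: "v \<in> val X m"
  shows "position m v permutes {1..m}" "sact X m (base_point (orbit m v)) (position m v) = v"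
proof -
  have "orbit m v \<in> orbits X m" using v mem_orbits_iff by blast
  then have "orbit m (base_point (orbit m v)) = orbit m v" by (rule base_point(2)[OF m])
  then have "v \<in> orbit m (base_point (orbit m v))" using orbit_refl[OF m v] by simp
  then have "\<exists>\<sigma>. \<sigma> permutes {1..m} \<and> sact X m (base_point (orbit m v)) \<sigma> = v" by (auto simp: orbit_def)
  from someI_ex[OF this] show "position m v permutes {1..m}" "sact X m (base_point (orbit m v)) (position m v) = v"
    by (auto simp: position_def)
qed

lemma position_eqI:
  assumes m: "1 \<le> m" and v: "v \<in> val X m" and s: "\<sigma> permutes {1..m}"
    and eq: "sact X m (base_point (orbit m v)) \<sigma> = v"
  shows "position m v = \<sigma>"
proof (rule sact_inj[OF m _ position(1)[OF m v] s])
  show "base_point (orbit m v) \<in> val X m" using base_point(1)[OF m] v mem_orbits_iff by blast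
  show "sact X m (base_point (orbit m v)) (position m v) = sact X m (base_point (orbit m v)) \<sigma>"
    using position(2)[OF m v] eq by simp
qed

section \<open>Orbits as free generators\<close>

definition free_gen :: "'x set \<Rightarrow> nat \<Rightarrow> 'x tree" where
  "free_gen w m = rep (tree_operad (gen_sig X)) (gen_rels X) (corolla (Gen (base_point w)) m)"

lemma gen_tree_is_operad: "is_operad (tree_operad (gen_sig X))"
  by (rule tree_operad_is_operad) (auto simp: gen_sig_def)

lemma free_operad_is_operad: "is_operad (free_operad X)"
  unfolding free_operad_def by (rule quotient_is_operad[OF gen_tree_is_operad])

lemma free_operad_rep_hom:
  "operad_hom (rep (tree_operad (gen_sig X)) (gen_rels X)) (tree_operad (gen_sig X)) (free_operad X)"
  unfolding free_operad_def by (rule rep_hom[OF gen_tree_is_operad])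

lemma gen_corolla:
  "1 \<le> m \<Longrightarrow> v \<in> val X m \<Longrightarrow> corolla (Gen v) m \<in> ops (tree_operad (gen_sig X))"
  by (rule corolla_ops) (auto simp: gen_sig_def)

lemma arity_corolla: "arity (tree_operad S) (corolla s m) = m"
  by (simp add: tree_operad_simps leaves_corolla)

lemma free_gen_ops:
  assumes "1 \<le> m" "w \<in> orbits X m"
  shows "free_gen w m \<in> ops (free_operad X)" "arity (free_operad X) (free_gen w m) = m"
  using hom_ops[OF free_operad_rep_hom gen_corolla[OF assms(1) base_point(1)[OF assms]]]
    hom_arity[OF free_operad_rep_hom gen_corolla[OF assms(1) base_point(1)[OF assms]]]
  by (simp_all add: free_gen_def arity_corolla)

lemma rep_gen_corolla:
  assumes m: "1 \<le> m" and v: "v \<in> val X m"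
  shows "rep (tree_operad (gen_sig X)) (gen_rels X) (corolla (Gen v) m)
    = act (free_operad X) (free_gen (orbit m v) m) (position m v)"
proof -
  let ?T = "tree_operad (gen_sig X)" and ?b = "base_point (orbit m v)"
  have o: "orbit m v \<in> orbits X m" using v mem_orbits_iff by blast
  note b = base_point(1)[OF m o] and p = position[OF m v]
  have c: "corolla (Gen ?b) m \<in> ops ?T" by (rule gen_corolla[OF m b])
  have p': "position m v permutes {1..arity ?T (corolla (Gen ?b) m)}" using p(1) by (simp add: arity_corolla)
  have "rep ?T (gen_rels X) (corolla (Gen (sact X m ?b (position m v))) m)
      = rep ?T (gen_rels X) (act ?T (corolla (Gen ?b) m) (position m v))"
  proof (rule rep_relation)
    show "(corolla (Gen (sact X m ?b (position m v))) m, act ?T (corolla (Gen ?b) m) (position m v)) \<in> gen_rels X"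
      using m b p(1) unfolding gen_rels_def by blast
    show "corolla (Gen (sact X m ?b (position m v))) m \<in> ops ?T" using gen_corolla[OF m v] p(2) by simp
    show "act ?T (corolla (Gen ?b) m) (position m v) \<in> ops ?T" by (rule operad_act[OF gen_tree_is_operad c p'])
    show "arity ?T (corolla (Gen (sact X m ?b (position m v))) m) = arity ?T (act ?T (corolla (Gen ?b) m) (position m v))"
      using operad_arity_act[OF gen_tree_is_operad c p'] by (simp add: arity_corolla)
  qed
  then show ?thesis using hom_act[OF free_operad_rep_hom c p'] p(2) by (simp add: free_gen_def)
qed

lemma free_operad_suboperad:
  assumes Z: "suboperad Z (free_operad X)"
    and gen: "\<And>m w. 1 \<le> m \<Longrightarrow> w \<in> orbits X m \<Longrightarrow> free_gen w m \<in> Z"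
  shows "ops (free_operad X) \<subseteq> Z"
proof
  let ?T = "tree_operad (gen_sig X)"
  fix x assume "x \<in> ops (free_operad X)"
  then obtain t where t: "t \<in> ops ?T" "x = rep ?T (gen_rels X) t"
    unfolding free_operad_def ops_quotient by blast
  show "x \<in> Z"
    unfolding t(2)
  proof (rule hom_tree_suboperad[OF free_operad_rep_hom Z _ t(1)])
    fix s m assume "(s, m) \<in> gen_sig X"
    then obtain v where v: "s = Gen v" "1 \<le> m" "v \<in> val X m" by (auto simp: gen_sig_def)
    have o: "orbit m v \<in> orbits X m" using v mem_orbits_iff by blast
    have "act (free_operad X) (free_gen (orbit m v) m) (position m v) \<in> Z"
      using Z gen[OF v(2) o] free_gen_ops[OF v(2) o] position(1)[OF v(2,3)] unfolding suboperad_def by simp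
    then show "rep ?T (gen_rels X) (corolla s m) \<in> Z" using rep_gen_corolla[OF v(2,3)] v(1) by simp
  qed
qed

text \<open>Values \<open>c\<close> may be prescribed arbitrarily on the orbits. A generator
  \<open>v\<close> is then sent to the value of its orbit, moved by \<open>position m v\<close>; by
  freeness this respects the relations.\<close>

lemma free_operad_universal:
  assumes O': "is_operad O'"
    and c: "\<And>m w. 1 \<le> m \<Longrightarrow> w \<in> orbits X m \<Longrightarrow> c w m \<in> ops O' \<and> arity O' (c w m) = m"
  obtains h where "operad_hom h (free_operad X) O'"
    "\<And>m w. 1 \<le> m \<Longrightarrow> w \<in> orbits X m \<Longrightarrow> h (free_gen w m) = c w m"
proof -
  let ?T = "tree_operad (gen_sig X)"
  \<comment> \<open>The last case is a default, as only \<open>Gen\<close> occurs in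
    \<open>gen_sig\<close>.\<close>
  define \<iota> where "\<iota> s m = (case s of Gen v \<Rightarrow> act O' (c (orbit m v) m) (position m v) | _ \<Rightarrow> ident O')"
    for s :: "('x, 'x tree) sym" and m
  have \<iota>: "\<iota> s m \<in> ops O' \<and> arity O' (\<iota> s m) = m" if "(s, m) \<in> gen_sig X" for s m
  proof -
    obtain v where v: "s = Gen v" "1 \<le> m" "v \<in> val X m" using \<open>(s, m) \<in> gen_sig X\<close> by (auto simp: gen_sig_def)
    have "orbit m v \<in> orbits X m" using v mem_orbits_iff by blast
    then have "c (orbit m v) m \<in> ops O'" "arity O' (c (orbit m v) m) = m" using c v(2) by auto
    then show ?thesis
      using operad_act[OF O', of "c (orbit m v) m" "position m v"] operad_arity_act[OF O', of "c (orbit m v) m" "position m v"]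
        position(1)[OF v(2,3)] v(1) by (simp add: \<iota>_def)
  qed
  let ?h = "eval O' \<iota>"
  have h: "operad_hom ?h ?T O'" by (rule eval_hom[OF O' \<iota>])
  have hc: "?h (corolla (Gen v) m) = act O' (c (orbit m v) m) (position m v)" if "1 \<le> m" "v \<in> val X m" for m v
    using eval_corolla[where \<iota> = \<iota> and S = "gen_sig X" and s = "Gen v" and m = m, OF O' \<iota>] that
    by (simp add: \<iota>_def gen_sig_def)
  have rels: "?h a = ?h b" if "(a, b) \<in> gen_rels X" for a b
  proof -
    obtain v m \<sigma> where v: "1 \<le> m" "v \<in> val X m" and s: "\<sigma> permutes {1..m}"
      and a: "a = corolla (Gen (sact X m v \<sigma>)) m" and b: "b = act ?T (corolla (Gen v) m) \<sigma>"
      using \<open>(a, b) \<in> gen_rels X\<close> unfolding gen_rels_def by blast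
    have o: "orbit m v \<in> orbits X m" using v mem_orbits_iff by blast
    note os = orbit_sact[OF v s] and p = position[OF v]
    \<comment> \<open>The orbit and its base point stay the same under \<open>\<sigma>\<close>, so
      positions are composed.\<close>
    have "position m (sact X m v \<sigma>) = position m v \<circ> \<sigma>"
    proof (rule position_eqI[OF v(1) sact_val[OF v s] permutes_compose[OF s p(1)]])
      show "sact X m (base_point (orbit m (sact X m v \<sigma>))) (position m v \<circ> \<sigma>) = sact X m v \<sigma>"
        unfolding os using sact_comp[OF v(1) base_point(1)[OF v(1) o] p(1) s] p(2) by simp
    qed
    moreover have "act O' (c (orbit m v) m) (position m v \<circ> \<sigma>) = act O' (act O' (c (orbit m v) m) (position m v)) \<sigma>"
      using c[OF v(1) o] p(1) s by (intro operad_act_comp[OF O']) simp_all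
    moreover have "?h b = act O' (?h (corolla (Gen v) m)) \<sigma>"
      unfolding b using s by (intro hom_act[OF h gen_corolla[OF v]]) (simp add: arity_corolla)
    ultimately show ?thesis using hc[OF v] hc[OF v(1) sact_val[OF v s]] os a by simp
  qed
  show ?thesis
  proof
    show "operad_hom ?h (free_operad X) O'"
      unfolding free_operad_def by (rule hom_quotient[OF gen_tree_is_operad h rels])
    fix m w assume m: "1 \<le> m" and w: "w \<in> orbits X m"
    note b = base_point[OF m w]
    have "?h (free_gen w m) = ?h (corolla (Gen (base_point w)) m)"
      unfolding free_gen_def by (rule hom_rep[OF gen_tree_is_operad h rels gen_corolla[OF m b(1)]])
    also have "\<dots> = act O' (c w m) (position m (base_point w))" using hc[OF m b(1)] b(2) by simp
    also have "position m (base_point w) = id"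
      using b sact_id[OF m b(1)] by (intro position_eqI[OF m b(1) permutes_id]) simp
    finally show "?h (free_gen w m) = c w m" unfolding operad_act_id[OF O' conjunct1[OF c[OF m w]]] .
  qed
qed

end


section \<open>The iterated tensor product\<close>

text \<open>In place of the universal property of \<open>A\<close>, only its instance for the one target that matters
  is recorded, the map \<open>h\<close> to the cut operad.\<close>

definition cut_presented :: "nat \<Rightarrow> (nat \<Rightarrow> nat \<Rightarrow> 'l set) \<Rightarrow> nat set \<Rightarrow> 'b operad \<Rightarrow>
    ((nat \<times> nat \<times> 'l, (nat \<times> nat \<times> 'l) tree) sym \<Rightarrow> 'b) \<Rightarrow>
    ('b \<Rightarrow> box list \<times> (point \<times> nat \<times> nat \<times> 'l) set) \<Rightarrow> bool" where
  "cut_presented d L K A G h \<longleftrightarrow> is_operad A \<and> operad_hom h A (cut_operad d L) \<and>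
     (\<forall>(s, m)\<in>cut_sig K L. G s \<in> ops A \<and> arity A (G s) = m \<and> h (G s) = cut_value d (corolla s m)) \<and>
     (\<forall>k k' m m' w w'. (Gen (k, m, w), m) \<in> cut_sig K L \<and> (Gen (k', m', w'), m') \<in> cut_sig K L \<and> k < k' \<longrightarrow>
        interchanges A (G (Gen (k, m, w))) (G (Gen (k', m', w')))) \<and>
     (\<forall>Z. suboperad Z A \<and> (\<forall>(s, m)\<in>cut_sig K L. G s \<in> Z) \<longrightarrow> ops A \<subseteq> Z)"

lemma cut_value_corolla:
  assumes "K \<subseteq> {1..d}" "(s, m) \<in> cut_sig K L"
  shows "cut_value d (corolla s m) \<in> ops (cut_operad d L)" "arity (cut_operad d L) (cut_value d (corolla s m)) = m"
proof -
  have "(s, m) \<in> cut_sig {1..d} L" using assms cut_sig_mono[OF assms(1)] by blast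
  note c = corolla_ops[OF this]
  show "cut_value d (corolla s m) \<in> ops (cut_operad d L)" "arity (cut_operad d L) (cut_value d (corolla s m)) = m"
    using hom_ops[OF cut_value_hom c] hom_arity[OF cut_value_hom c] by (simp_all add: tree_operad_simps leaves_corolla)
qed

lemma cut_presented_free:
  assumes sym: "symmetric_collection (X k)" and free: "free_collection (X k)"
    and one: "val (X k) 1 = {}" and k: "k \<in> {1..d}"
  obtains G h where "cut_presented d (\<lambda>k m. orbits (X k) m) {k} (free_operad (X k)) G h"
proof -
  let ?L = "\<lambda>k m. orbits (X k) m"
  let ?G = "\<lambda>s. case s of Gen (k, m, w) \<Rightarrow> free_gen (X k) w m | _ \<Rightarrow> undefined"
  let ?c = "\<lambda>w m. cut_value d (corolla (Gen (k, m, w)) m)"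
  \<comment> \<open>There is nothing in arity 1, so every orbit gives a cut into at least two parts
    and each generator has a counterpart in \<open>cut_sig\<close>.\<close>
  have m2: "2 \<le> m" if "1 \<le> m" "w \<in> orbits (X k) m" for m w
  proof (rule ccontr)
    assume "\<not> 2 \<le> m"
    then have "m = 1" using that(1) by simp
    then show False using that(2) one by (simp add: orbits_def)
  qed
  have sig: "(Gen (k, m, w), m) \<in> cut_sig {k} ?L" if "1 \<le> m" "w \<in> orbits (X k) m" for m w
    using m2[OF that] that by (auto simp: cut_sig_def)
  have kd: "{k} \<subseteq> {1..d}" using k by simp
  have c: "?c w m \<in> ops (cut_operad d ?L) \<and> arity (cut_operad d ?L) (?c w m) = m"
    if "1 \<le> m" "w \<in> orbits (X k) m" for m w
    using cut_value_corolla[OF kd sig[OF that]] by blast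
  have "\<exists>h. operad_hom h (free_operad (X k)) (cut_operad d ?L) \<and>
      (\<forall>m w. 1 \<le> m \<longrightarrow> w \<in> orbits (X k) m \<longrightarrow> h (free_gen (X k) w m) = ?c w m)"
    by (rule free_operad_universal[where c = ?c, OF sym free cut_operad_is_operad c])
      (assumption+, rule exI, rule conjI, assumption, blast)
  then obtain h where h: "operad_hom h (free_operad (X k)) (cut_operad d ?L)"
    "\<And>m w. 1 \<le> m \<Longrightarrow> w \<in> orbits (X k) m \<Longrightarrow> h (free_gen (X k) w m) = ?c w m"
    by blast
  have "cut_presented d ?L {k} (free_operad (X k)) ?G h"
    unfolding cut_presented_def
  proof (intro conjI allI impI)
    show "is_operad (free_operad (X k))" by (rule free_operad_is_operad[OF sym free])
    show "operad_hom h (free_operad (X k)) (cut_operad d ?L)" by (rule h)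
    show "\<forall>(s, m)\<in>cut_sig {k} ?L. ?G s \<in> ops (free_operad (X k)) \<and> arity (free_operad (X k)) (?G s) = m \<and>
        h (?G s) = cut_value d (corolla s m)"
      using free_gen_ops[OF sym free] h(2) by (auto simp: cut_sig_def)
  next
    fix Z assume Z: "suboperad Z (free_operad (X k)) \<and> (\<forall>(s, m)\<in>cut_sig {k} ?L. ?G s \<in> Z)"
    then show "ops (free_operad (X k)) \<subseteq> Z"
      using sig by (intro free_operad_suboperad[OF sym free]) fastforce+
  qed (auto simp: cut_sig_def)
  then show ?thesis by (rule that)
qed

text \<open>Values of \<open>h\<close> involve only directions in \<open>K\<close>. This allows two
  factors with disjoint sets of directions to interchange in the cut operad.\<close>

lemma cut_presented_values:
  assumes A: "cut_presented d L K A G h" and K: "K \<subseteq> {1..d}" and a: "a \<in> ops A"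
  obtains t where "t \<in> ops (tree_operad (cut_sig K L))" "h a = cut_value d t"
proof -
  let ?T = "tree_operad (cut_sig K L)"
  have hA: "is_operad A" "operad_hom h A (cut_operad d L)" using A by (auto simp: cut_presented_def)
  have hom: "operad_hom (cut_value d) ?T (cut_operad d L)"
    by (rule hom_tree_mono[OF cut_sig_mono[OF K] cut_value_hom])
  let ?Z = "{a \<in> ops A. h a \<in> cut_value d ` ops ?T}"
  have "suboperad ?Z A"
    by (rule suboperad_hom_vimage[OF hA(2) hom_image_suboperad[OF hom cut_tree_is_operad] hA(1)])
  moreover have "\<forall>(s, m)\<in>cut_sig K L. G s \<in> ?Z"
  proof (intro ballI, clarify)
    fix s m assume sm: "(s, m) \<in> cut_sig K L"
    then have "G s \<in> ops A \<and> h (G s) = cut_value d (corolla s m)" using A unfolding cut_presented_def by auto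
    then show "G s \<in> ops A \<and> h (G s) \<in> cut_value d ` ops ?T" using corolla_ops[OF sm] by simp
  qed
  ultimately have "ops A \<subseteq> ?Z" using A unfolding cut_presented_def by blast
  then show ?thesis using a that by blast
qed

lemma cut_presented_tensor:
  fixes P Q :: "'x tree operad"
  assumes P: "cut_presented d L K P G h" and Q: "cut_presented d L K' Q G' h'"
    and K: "K \<subseteq> {1..d}" "K' \<subseteq> {1..d}" and lt: "\<And>k k'. k \<in> K \<Longrightarrow> k' \<in> K' \<Longrightarrow> k < k'"
    and K': "\<And>k k'. k \<in> K' \<Longrightarrow> k' \<in> K' \<Longrightarrow> k = k'"
  obtains G'' h'' where "cut_presented d L (K \<union> K') (P \<otimes>\<^sub>B\<^sub>V Q) G'' h''"
proof -
  have oP: "is_operad P" and hP: "operad_hom h P (cut_operad d L)" and oQ: "is_operad Q" and hQ: "operad_hom h' Q (cut_operad d L)"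
    using P Q by (auto simp: cut_presented_def)
  have gP: "G s \<in> ops P" "arity P (G s) = m" "h (G s) = cut_value d (corolla s m)" if "(s, m) \<in> cut_sig K L" for s m
    using P that unfolding cut_presented_def by auto
  have gQ: "G' s \<in> ops Q" "arity Q (G' s) = m" "h' (G' s) = cut_value d (corolla s m)" if "(s, m) \<in> cut_sig K' L" for s m
    using Q that unfolding cut_presented_def by auto
  have disj: "K \<inter> K' = {}" using lt by blast
  have hh': "interchanges (cut_operad d L) (h p) (h' q)" if p: "p \<in> ops P" and q: "q \<in> ops Q" for p q
  proof -
    obtain t where t: "t \<in> ops (tree_operad (cut_sig K L))" "h p = cut_value d t"
      by (rule cut_presented_values[OF P K(1) p])
    obtain s where s: "s \<in> ops (tree_operad (cut_sig K' L))" "h' q = cut_value d s"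
      by (rule cut_presented_values[OF Q K(2) q])
    show ?thesis unfolding t(2) s(2) by (rule cut_value_interchanges[OF t(1) s(1) K disj])
  qed
  have "\<exists>g. operad_hom g (P \<otimes>\<^sub>B\<^sub>V Q) (cut_operad d L) \<and>
      (\<forall>p\<in>ops P. g (tensor_left P Q p) = h p) \<and> (\<forall>q\<in>ops Q. g (tensor_right P Q q) = h' q)"
    by (rule tensor_universal[OF oP oQ cut_operad_is_operad hP hQ hh'])
      (assumption+, rule exI, rule conjI, assumption, blast)
  then obtain g where g: "operad_hom g (P \<otimes>\<^sub>B\<^sub>V Q) (cut_operad d L)"
    "\<And>p. p \<in> ops P \<Longrightarrow> g (tensor_left P Q p) = h p" "\<And>q. q \<in> ops Q \<Longrightarrow> g (tensor_right P Q q) = h' q"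
    by blast
  note lh = tensor_left_hom[OF oP oQ] and rh = tensor_right_hom[OF oP oQ] and oPQ = tensor_is_operad[OF oP oQ]
  \<comment> \<open>The sets of directions are disjoint, so the direction of a symbol tells from
    which factor it comes.\<close>
  let ?G = "\<lambda>s. if s \<in> {Gen (k, m, w) |k m w. k \<in> K} then tensor_left P Q (G s) else tensor_right P Q (G' s)"
  have GL: "?G s = tensor_left P Q (G s)" if "(s, m) \<in> cut_sig K L" for s m
    using that by (auto simp: cut_sig_def)
  have GR: "?G s = tensor_right P Q (G' s)" if "(s, m) \<in> cut_sig K' L" for s m
    using that disj by (auto simp: cut_sig_def)
  have split: "(s, m) \<in> cut_sig (K \<union> K') L \<longleftrightarrow> (s, m) \<in> cut_sig K L \<or> (s, m) \<in> cut_sig K' L" for s m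
    by (auto simp: cut_sig_def)
  have "cut_presented d L (K \<union> K') (P \<otimes>\<^sub>B\<^sub>V Q) ?G g"
    unfolding cut_presented_def
  proof (intro conjI)
    show "is_operad (P \<otimes>\<^sub>B\<^sub>V Q)" by (rule oPQ)
    show "operad_hom g (P \<otimes>\<^sub>B\<^sub>V Q) (cut_operad d L)" by (rule g)
    show "\<forall>(s, m)\<in>cut_sig (K \<union> K') L. ?G s \<in> ops (P \<otimes>\<^sub>B\<^sub>V Q) \<and> arity (P \<otimes>\<^sub>B\<^sub>V Q) (?G s) = m \<and>
        g (?G s) = cut_value d (corolla s m)"
    proof (intro ballI, clarify)
      fix s m assume "(s, m) \<in> cut_sig (K \<union> K') L"
      then consider "(s, m) \<in> cut_sig K L" | "(s, m) \<in> cut_sig K' L" using split by blast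
      then show "?G s \<in> ops (P \<otimes>\<^sub>B\<^sub>V Q) \<and> arity (P \<otimes>\<^sub>B\<^sub>V Q) (?G s) = m \<and> g (?G s) = cut_value d (corolla s m)"
      proof cases
        case 1
        show ?thesis
          unfolding GL[OF 1] using gP[OF 1] hom_ops[OF lh gP(1)[OF 1]] hom_arity[OF lh gP(1)[OF 1]] g(2) by simp
      next
        case 2
        show ?thesis
          unfolding GR[OF 2] using gQ[OF 2] hom_ops[OF rh gQ(1)[OF 2]] hom_arity[OF rh gQ(1)[OF 2]] g(3) by simp
      qed
    qed
    show "\<forall>k k' m m' w w'. (Gen (k, m, w), m) \<in> cut_sig (K \<union> K') L \<and> (Gen (k', m', w'), m') \<in> cut_sig (K \<union> K') L \<and> k < k' \<longrightarrow>
        interchanges (P \<otimes>\<^sub>B\<^sub>V Q) (?G (Gen (k, m, w))) (?G (Gen (k', m', w')))"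
    proof (intro allI impI, elim conjE)
      fix k k' m m' w w'
      assume a: "(Gen (k, m, w), m) \<in> cut_sig (K \<union> K') L" and b: "(Gen (k', m', w'), m') \<in> cut_sig (K \<union> K') L" and kk: "k < k'"
      \<comment> \<open>All directions of the right factor exceed those of the left, and there is at
        most one of them; so the smaller of two directions belongs to the left factor.\<close>
      have "k \<in> K"
      proof (rule ccontr)
        assume "k \<notin> K"
        then have kK': "k \<in> K'" using a by (auto simp: cut_sig_def)
        have "k' \<in> K \<or> k' \<in> K'" using b by (auto simp: cut_sig_def)
        then show False using lt[OF _ kK', of k'] K'[OF kK', of k'] kk by auto
      qed
      then have a': "(Gen (k, m, w), m) \<in> cut_sig K L" using a by (auto simp: cut_sig_def)
      consider "(Gen (k', m', w'), m') \<in> cut_sig K L" | "(Gen (k', m', w'), m') \<in> cut_sig K' L"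
        using b split by blast
      then show "interchanges (P \<otimes>\<^sub>B\<^sub>V Q) (?G (Gen (k, m, w))) (?G (Gen (k', m', w')))"
      proof cases
        case 1
        have "interchanges P (G (Gen (k, m, w))) (G (Gen (k', m', w')))"
          using P a' 1 kk unfolding cut_presented_def by blast
        then show ?thesis
          unfolding GL[OF a'] GL[OF 1] by (rule hom_interchanges[OF oP lh gP(1)[OF a'] gP(1)[OF 1]])
      next
        case 2
        show ?thesis unfolding GL[OF a'] GR[OF 2] by (rule tensor_interchanges[OF oP oQ gP(1)[OF a'] gQ(1)[OF 2]])
      qed
    qed
    show "\<forall>Z. suboperad Z (P \<otimes>\<^sub>B\<^sub>V Q) \<and> (\<forall>(s, m)\<in>cut_sig (K \<union> K') L. ?G s \<in> Z) \<longrightarrow> ops (P \<otimes>\<^sub>B\<^sub>V Q) \<subseteq> Z"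
    proof (intro allI impI, elim conjE)
      fix Z assume Z: "suboperad Z (P \<otimes>\<^sub>B\<^sub>V Q)" and gen: "\<forall>(s, m)\<in>cut_sig (K \<union> K') L. ?G s \<in> Z"
      have genZ: "?G s \<in> Z" if "(s, m) \<in> cut_sig (K \<union> K') L" for s m using gen that by blast
      have "\<forall>(s, m)\<in>cut_sig K L. G s \<in> {p \<in> ops P. tensor_left P Q p \<in> Z}"
        using genZ GL gP(1) split by fastforce
      then have L': "ops P \<subseteq> {p \<in> ops P. tensor_left P Q p \<in> Z}"
        using P suboperad_hom_vimage[OF lh Z oP] unfolding cut_presented_def by blast
      have "\<forall>(s, m)\<in>cut_sig K' L. G' s \<in> {q \<in> ops Q. tensor_right P Q q \<in> Z}"
        using genZ GR gQ(1) split by fastforce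
      then have R': "ops Q \<subseteq> {q \<in> ops Q. tensor_right P Q q \<in> Z}"
        using Q suboperad_hom_vimage[OF rh Z oQ] unfolding cut_presented_def by blast
      show "ops (P \<otimes>\<^sub>B\<^sub>V Q) \<subseteq> Z" using L' R' by (intro tensor_suboperad[OF oP oQ Z]) blast+
    qed
  qed
  then show ?thesis by (rule that)
qed

text \<open>The isomorphism is asked for from \<open>C\<close> to \<open>A\<close>, opposite to the
  map that the universal properties provide.\<close>

lemma hom_bij_iso:
  assumes A: "is_operad A" and h: "operad_hom h A C" and bij: "bij_betw h (ops A) (ops C)"
  shows "\<exists>f. operad_iso f C A"
proof -
  let ?f = "inv_into (ops A) h"
  have f: "?f c \<in> ops A" "h (?f c) = c" if "c \<in> ops C" for c
    using that bij by (auto simp: bij_betw_def inv_into_into f_inv_into_f)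
  have fh: "?f (h a) = a" if "a \<in> ops A" for a using that bij by (simp add: bij_betw_def)
  have "operad_iso ?f C A"
    unfolding operad_iso_def
  proof (intro conjI ballI allI impI)
    show "bij_betw ?f (ops C) (ops A)" by (rule bij_betw_inv_into[OF bij])
    show "?f (ident C) = ident A" using fh[OF operad_ident[OF A]] hom_ident[OF h] by simp
  next
    fix c assume c: "c \<in> ops C"
    show ar: "arity A (?f c) = arity C c" using hom_arity[OF h f(1)[OF c]] f(2)[OF c] by simp
    fix \<sigma> assume "\<sigma> permutes {1..arity C c}"
    then have s: "\<sigma> permutes {1..arity A (?f c)}" using ar by simp
    show "?f (act C c \<sigma>) = act A (?f c) \<sigma>"
      using fh[OF operad_act[OF A f(1)[OF c] s]] hom_act[OF h f(1)[OF c] s] f(2)[OF c] by simp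
  next
    fix c cs assume c: "composable C c cs"
    then have c0: "c \<in> ops C" and cs: "set cs \<subseteq> ops C" by (auto simp: composable_def)
    have c': "composable A (?f c) (map ?f cs)"
      using c f(1) hom_arity[OF h f(1)[OF c0]] f(2)[OF c0] by (auto simp: composable_def)
    have "map h (map ?f cs) = cs" unfolding map_map using cs f(2) by (intro map_idI) auto
    then show "?f (compose C c cs) = compose A (?f c) (map ?f cs)"
      using fh[OF operad_compose[OF A c']] hom_compose[OF h c'] f(2)[OF c0] by (simp del: map_map)
  qed
  then show ?thesis by blast
qed

lemma cut_presented_isomorphic:
  assumes A: "cut_presented d L {1..d} A G h"
  shows "cut_operad d L \<cong>\<^sub>o\<^sub>p A"
proof -
  let ?S = "cut_sig {1..d} L"
  let ?T = "tree_operad ?S"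
  have oA: "is_operad A" and hA: "operad_hom h A (cut_operad d L)" using A by (auto simp: cut_presented_def)
  have gA: "G s \<in> ops A \<and> arity A (G s) = m" "h (G s) = cut_value d (corolla s m)" if "(s, m) \<in> ?S" for s m
    using A that unfolding cut_presented_def by auto
  let ?ev = "eval A (\<lambda>s m. G s)"
  have ev: "operad_hom ?ev ?T A" by (rule eval_hom[OF oA gA(1)])
  have evc: "?ev (corolla s m) = G s" if "(s, m) \<in> ?S" for s m
    by (rule eval_corolla[OF oA gA(1) that])
  have hev: "h (?ev t) = cut_value d t" if "t \<in> ops ?T" for t
    using hom_tree_unique[OF hom_trans[OF ev hA] cut_value_hom _ that] evc gA(2) by simp
  have "\<forall>(s, m)\<in>?S. G s \<in> ?ev ` ops ?T"
  proof (intro ballI, clarify)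
    fix s m assume sm: "(s, m) \<in> ?S"
    show "G s \<in> ?ev ` ops ?T" using imageI[OF corolla_ops[OF sm], of ?ev] unfolding evc[OF sm] .
  qed
  then have surj: "ops A \<subseteq> ?ev ` ops ?T"
    using A hom_image_suboperad[OF ev cut_tree_is_operad] unfolding cut_presented_def by blast
  have inter: "interchanges A (?ev (corolla (Gen (k, m, w)) m)) (?ev (corolla (Gen (k', m', w')) m'))"
    if "(Gen (k, m, w), m) \<in> ?S" "(Gen (k', m', w'), m') \<in> ?S" "k < k'" for k k' m m' w w'
    unfolding evc[OF that(1)] evc[OF that(2)] using A that unfolding cut_presented_def by blast
  have "bij_betw h (ops A) (ops (cut_operad d L))"
  proof (rule bij_betw_imageI)
    show "inj_on h (ops A)"
    proof (rule inj_onI)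
      fix a b assume ab: "a \<in> ops A" "b \<in> ops A" "h a = h b"
      obtain s t where st: "s \<in> ops ?T" "a = ?ev s" "t \<in> ops ?T" "b = ?ev t" using surj ab by blast
      have "cut_value d s = cut_value d t" using ab(3) hev st by simp
      then have "cut_eq s t" by (rule cut_value_eq_imp_cut_eq[OF st(1,3)])
      then show "a = b" using cut_eq_hom[OF ev inter _ st(1)] st(2,4) by simp
    qed
    have "h ` ops A = cut_value d ` ops ?T"
    proof (intro equalityI subsetI)
      fix c assume "c \<in> h ` ops A"
      then show "c \<in> cut_value d ` ops ?T" using surj hev by force
    next
      fix c assume "c \<in> cut_value d ` ops ?T"
      then show "c \<in> h ` ops A" using hev hom_ops[OF ev] by force
    qed
    then show "h ` ops A = ops (cut_operad d L)" using cut_value_surj by metis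
  qed
  then show ?thesis
    unfolding operad_isomorphic_def using cut_operad_is_operad oA hom_bij_iso[OF oA hA] by blast
qed

theorem theorem3p2:
  fixes d :: nat and X :: "nat \<Rightarrow> 'x symcoll"
  assumes "d \<ge> 1"
    and "\<And>k. k \<in> {1..d} \<Longrightarrow> symmetric_collection (X k)"
    and "\<And>k. k \<in> {1..d} \<Longrightarrow> free_collection (X k)"
    and "\<And>k. k \<in> {1..d} \<Longrightarrow> val (X k) 0 = {}"
    and "\<And>k. k \<in> {1..d} \<Longrightarrow> val (X k) 1 = {}"
  shows "cut_operad d (\<lambda>k m. orbits (X k) m)
           \<cong>\<^sub>o\<^sub>p foldl (\<otimes>\<^sub>B\<^sub>V) (free_operad (X 1)) (map (\<lambda>k. free_operad (X k)) [2..<d + 1])"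
proof -
  let ?L = "\<lambda>k m. orbits (X k) m"
  let ?A = "\<lambda>n. foldl (\<otimes>\<^sub>B\<^sub>V) (free_operad (X 1)) (map (\<lambda>k. free_operad (X k)) [2..<n + 1])"
  \<comment> \<open>Induction on the number of factors with a target of fixed dimension
    \<open>d\<close>: the tensor product of the first \<open>n\<close> factors is mapped to
    subdivisions of the same cube that use only the directions up to \<open>n\<close>.\<close>
  have "\<exists>G h. cut_presented d ?L {1..n} (?A n) G h" if "1 \<le> n" "n \<le> d" for n
    using that
  proof (induction n rule: nat_induct_at_least)
    case base
    have "1 \<in> {1..d}" using assms(1) by simp
    then obtain G h where "cut_presented d ?L {1} (free_operad (X 1)) G h"
      using cut_presented_free[of X 1 d] assms(2,3,5) by metis
    moreover have "{1..1::nat} = {1}" "[2..<1 + 1] = []" by auto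
    ultimately show ?case by (metis foldl_Nil list.map(1))
  next
    case (Suc n)
    obtain G h where A: "cut_presented d ?L {1..n} (?A n) G h" using Suc by auto
    have k: "Suc n \<in> {1..d}" using Suc by simp
    obtain G' h' where B: "cut_presented d ?L {Suc n} (free_operad (X (Suc n))) G' h'"
      using cut_presented_free[of X "Suc n" d] assms(2,3,5) k by metis
    obtain G'' h'' where C: "cut_presented d ?L ({1..n} \<union> {Suc n}) (?A n \<otimes>\<^sub>B\<^sub>V free_operad (X (Suc n))) G'' h''"
      by (rule cut_presented_tensor[OF A B]) (use Suc in auto)
    have "{1..n} \<union> {Suc n} = {1..Suc n}" by auto
    moreover have "[2..<Suc n + 1] = [2..<n + 1] @ [Suc n]" using Suc(1) by (simp add: upt_Suc)
    ultimately show ?case using C by auto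
  qed
  then obtain G h where "cut_presented d ?L {1..d} (?A d) G h" using assms(1) by blast
  then show ?thesis by (rule cut_presented_isomorphic)
qed

end
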